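(* Assume the abstract phase-space setting with $E=L^2(\mathcal G)$ satisfies (A1), (A2) and (A3). Let $\{\eta_\gamma:\gamma\in\Gamma\}$ be a well-spread family of non-negative symbols with $\sum_\gamma\eta_\gamma\approx1$. Then there exist constants $0<c\le C<\infty$ such that for all sufficiently small $\varepsilon>0$, $$c\|f\|_2^2\le\sum_{\gamma\in\Gamma}\|M^\varepsilon_{\eta_\gamma}f\|_2^2\le C\|f\|_2^2,\qquad f\in S_{L^2}.$$ Furthermore, there exists $\alpha>0$ such that for every choice of numbers $N_\gamma\in\mathbb N$ with $\alpha\|\eta_\gamma\|_1\le N_\gamma$ and $\sup_\gamma N_\gamma<\infty$, the family $\{\lambda^\gamma_k\phi^\gamma_k:\gamma\in\Gamma,1\le k\le N_\gamma\}$ is a frame of $S_{L^2}$.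
   Context: $\mathcal G$ is a locally compact, $\sigma$-compact group with left Haar measure $dy$ and modular function $\Delta$; $L^p_m$ denotes weighted $L^p$ with norm $\|fm\|_p$; $L_xf(y)=f(x^{-1}y)$, $R_xf(y)=f(yx)$. $w:\mathcal G\to(0,\infty)$ is an admissible weight for $L^2(\mathcal G)$: $w(x)=\Delta(x^{-1})w(x^{-1})$, $w(xy)\le w(x)w(y)$, and $w(x)\ge C\max\{u(x),u(x^{-1}),v(x),\Delta(x^{-1})v(x^{-1})\}$ with $u(x)=\|L_x\|_{L^2\to L^2}$, $v(x)=\Delta(x^{-1})\|R_{x^{-1}}\|_{L^2\to L^2}$. With $V$ a fixed symmetric relatively compact neighbourhood of the identity, $f^\#(x)=\operatorname{ess\,sup}_{y\in V}|f(xy)|$, $f_\#(x)=\operatorname{ess\,sup}_{y\in V}|f(yx)|$, $W(L^\infty,L^1_w)=\{f:f^\#\in L^1_w\}$, $W_R(L^\infty,L^1_w)=\{f:f_\#\in L^1_w\}$, and $W(L^1,L^\infty_{1/w})$ is the space of locally integrable $f$ with $x\mapsto\int_{xV}|f|$ in $L^\infty_{1/w}$. (A1) $S_{L^2}$ is a closed subspace of $L^2(\mathcal G)$ consisting of continuous functions. (A2) $P:W(L^1,L^\infty_{1/w})\to L^\infty_{1/w}$ is bounded linear with $P(L^2)=S_{L^2}$, $Pf=f$ on $S_{L^2}$, and there is a non-negative $K\in W(L^\infty,L^1_w)\cap W_R(L^\infty,L^1_w)$ with $|Pf(x)|\le\int|f(y)|K(y^{-1}x)dy$. (A3) $P:L^2(\mathcal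 G)\to S_{L^2}$ is the orthogonal projection. Phase-space multiplier: $M_mf=P(mf)$, $f\in S_{L^2}$. A family of symbols $\{\eta_\gamma:\gamma\in\Gamma\}$ is well-spread if $\sup_x\#(\Gamma\cap xV)<\infty$ and $|\eta_\gamma(x)|\le g(\gamma^{-1}x)$ for some $g\in W_R(L^\infty,L^1_w)$. $\sum_\gamma\eta_\gamma\approx1$ means $A\le\sum_\gamma\eta_\gamma\le B$ with $0<A\le B$. For non-negative $\eta_\gamma$, $M_{\eta_\gamma}$ is positive trace class on $S_{L^2}$, diagonalized as $M_{\eta_\gamma}f=\sum_{k\ge1}\lambda^\gamma_k\langle f,\phi^\gamma_k\rangle\phi^\gamma_k$ with $\{\phi^\gamma_k\}$ orthonormal in $S_{L^2}$ and $\lambda^\gamma_k$ non-increasing; $M^\varepsilon_{\eta_\gamma}f=\sum_{k:\lambda^\gamma_k>\varepsilon}\lambda^\gamma_k\langle f,\phi^\gamma_k\rangle\phi^\gamma_k$. A family $\{e_j\}$ is a frame of $S_{L^2}$ if $a\|f\|_2^2\le\sum_j|\langle f,e_j\rangle|^2\le b\|f\|_2^2$ for all $f\in S_{L^2}$, some $0<a\le b$. *)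

theory Defs
  imports "HOL-Analysis.Analysis"
begin

text \<open>Conventions. The (not necessarily abelian) group G is a type of class
  topological_group_add, written additively: xy is x + y, x^-1 is - x,
  the identity is 0. Functions on G are complex valued.\<close>

definition locally_compact_sigma_compact :: "'g::topological_space itself \<Rightarrow> bool" where
  "locally_compact_sigma_compact _ \<longleftrightarrow>
     (\<forall>x::'g. \<exists>U K. open U \<and> compact K \<and> x \<in> U \<and> U \<subseteq> K) \<and>
     (\<exists>C :: nat \<Rightarrow> 'g set. (\<forall>n. compact (C n)) \<and> (\<Union>n. C n) = UNIV)"

definition left_haar_measure :: "'g::{topological_group_add,t2_space} measure \<Rightarrow> bool" where
  "left_haar_measure \<mu> \<longleftrightarrow>
     sets \<mu> = sets borel \<and>
     (\<forall>x A. A \<in> sets borel \<longrightarrow> emeasure \<mu> ((\<lambda>y. x + y) ` A) = emeasure \<mu> A) \<and>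
     (\<forall>K. compact K \<longrightarrow> emeasure \<mu> K < \<infinity>) \<and>
     (\<forall>U. open U \<and> U \<noteq> {} \<longrightarrow> emeasure \<mu> U > 0) \<and>
     (\<forall>A. A \<in> sets borel \<longrightarrow>
        emeasure \<mu> A = (INF U\<in>{U. open U \<and> A \<subseteq> U}. emeasure \<mu> U)) \<and>
     (\<forall>U. open U \<longrightarrow>
        emeasure \<mu> U = (SUP K\<in>{K. compact K \<and> K \<subseteq> U}. emeasure \<mu> K))"

definition modular_function :: "'g::{topological_group_add,t2_space} measure \<Rightarrow> ('g \<Rightarrow> real) \<Rightarrow> bool" where
  "modular_function \<mu> \<Delta> \<longleftrightarrow>
     (\<forall>x. \<Delta> x > 0) \<and>
     (\<forall>x A. A \<in> sets borel \<longrightarrow>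
        emeasure \<mu> ((\<lambda>y. y + x) ` A) = ennreal (\<Delta> x) * emeasure \<mu> A)"

definition L2 :: "'g measure \<Rightarrow> ('g \<Rightarrow> complex) set" where
  "L2 \<mu> = {f. f \<in> borel_measurable \<mu> \<and> integrable \<mu> (\<lambda>x. (cmod (f x))\<^sup>2)}"

definition L2norm :: "'g measure \<Rightarrow> ('g \<Rightarrow> complex) \<Rightarrow> real" where
  "L2norm \<mu> f = sqrt (\<integral>x. (cmod (f x))\<^sup>2 \<partial>\<mu>)"

definition L2inner :: "'g measure \<Rightarrow> ('g \<Rightarrow> complex) \<Rightarrow> ('g \<Rightarrow> complex) \<Rightarrow> complex" where
  "L2inner \<mu> f g = (\<integral>x. f x * cnj (g x) \<partial>\<mu>)"

definition L2opnorm :: "'g measure \<Rightarrow> (('g \<Rightarrow> complex) \<Rightarrow> ('g \<Rightarrow> complex)) \<Rightarrow> real" where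
  "L2opnorm \<mu> T = (SUP f\<in>{f \<in> L2 \<mu>. L2norm \<mu> f \<le> 1}. L2norm \<mu> (T f))"

definition left_transl :: "'g::group_add \<Rightarrow> ('g \<Rightarrow> complex) \<Rightarrow> ('g \<Rightarrow> complex)" where
  "left_transl x f = (\<lambda>y. f (- x + y))"

definition right_transl :: "'g::group_add \<Rightarrow> ('g \<Rightarrow> complex) \<Rightarrow> ('g \<Rightarrow> complex)" where
  "right_transl x f = (\<lambda>y. f (y + x))"

definition closed_continuous_subspace ::
    "'g::topological_space measure \<Rightarrow> ('g \<Rightarrow> complex) set \<Rightarrow> bool" where
  "closed_continuous_subspace \<mu> S \<longleftrightarrow>
     S \<subseteq> L2 \<mu> \<and> (\<forall>f\<in>S. continuous_on UNIV f) \<and>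
     (\<lambda>x. 0) \<in> S \<and> (\<forall>f\<in>S. \<forall>g\<in>S. (\<lambda>x. f x + g x) \<in> S) \<and>
     (\<forall>c. \<forall>f\<in>S. (\<lambda>x. c * f x) \<in> S) \<and>
     (\<forall>F f. (\<forall>n. F n \<in> S) \<longrightarrow> f \<in> L2 \<mu> \<longrightarrow>
        (\<lambda>n. L2norm \<mu> (\<lambda>x. F n x - f x)) \<longlonglongrightarrow> 0 \<longrightarrow>
        (\<exists>g\<in>S. AE x in \<mu>. g x = f x))"

definition admissible_weight ::
    "'g::{topological_group_add,t2_space} measure \<Rightarrow> ('g \<Rightarrow> real) \<Rightarrow> ('g \<Rightarrow> real) \<Rightarrow> bool" where
  "admissible_weight \<mu> \<Delta> w \<longleftrightarrow>
     w \<in> borel_measurable borel \<and> (\<forall>x. w x > 0) \<and>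
     (\<forall>x. w x = \<Delta> (- x) * w (- x)) \<and>
     (\<forall>x y. w (x + y) \<le> w x * w y) \<and>
     (let u = (\<lambda>x. L2opnorm \<mu> (left_transl x));
          v = (\<lambda>x. \<Delta> (- x) * L2opnorm \<mu> (right_transl (- x)))
      in \<exists>C>0. \<forall>x. w x \<ge> C * Max {u x, u (- x), v x, \<Delta> (- x) * v (- x)})"

definition locmax :: "'g::group_add measure \<Rightarrow> 'g set \<Rightarrow> ('g \<Rightarrow> complex) \<Rightarrow> 'g \<Rightarrow> ennreal" where
  "locmax \<mu> V f x = Inf {z. AE y in \<mu>. y \<in> V \<longrightarrow> ennreal (cmod (f (x + y))) \<le> z}"

definition locmaxR :: "'g::group_add measure \<Rightarrow> 'g set \<Rightarrow> ('g \<Rightarrow> complex) \<Rightarrow> 'g \<Rightarrow> ennreal" where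
  "locmaxR \<mu> V f x = Inf {z. AE y in \<mu>. y \<in> V \<longrightarrow> ennreal (cmod (f (y + x))) \<le> z}"

definition W_Linf_L1w :: "'g::group_add measure \<Rightarrow> 'g set \<Rightarrow> ('g \<Rightarrow> real) \<Rightarrow> ('g \<Rightarrow> complex) set" where
  "W_Linf_L1w \<mu> V w = {f. f \<in> borel_measurable \<mu> \<and> locmax \<mu> V f \<in> borel_measurable \<mu> \<and>
      (\<integral>\<^sup>+x. locmax \<mu> V f x * ennreal (w x) \<partial>\<mu>) < \<infinity>}"

definition WR_Linf_L1w :: "'g::group_add measure \<Rightarrow> 'g set \<Rightarrow> ('g \<Rightarrow> real) \<Rightarrow> ('g \<Rightarrow> complex) set" where
  "WR_Linf_L1w \<mu> V w = {f. f \<in> borel_measurable \<mu> \<and> locmaxR \<mu> V f \<in> borel_measurable \<mu> \<and>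
      (\<integral>\<^sup>+x. locmaxR \<mu> V f x * ennreal (w x) \<partial>\<mu>) < \<infinity>}"

definition W_L1_Linfw_norm :: "'g::group_add measure \<Rightarrow> 'g set \<Rightarrow> ('g \<Rightarrow> real) \<Rightarrow> ('g \<Rightarrow> complex) \<Rightarrow> ennreal" where
  "W_L1_Linfw_norm \<mu> V w f = Inf {z. AE x in \<mu>.
      (\<integral>\<^sup>+y. indicator ((\<lambda>v. x + v) ` V) y * ennreal (cmod (f y)) \<partial>\<mu>) / ennreal (w x) \<le> z}"

definition W_L1_Linfw :: "'g::{group_add,topological_space} measure \<Rightarrow> 'g set \<Rightarrow> ('g \<Rightarrow> real) \<Rightarrow> ('g \<Rightarrow> complex) set" where
  "W_L1_Linfw \<mu> V w = {f. f \<in> borel_measurable \<mu> \<and>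
      (\<forall>K. compact K \<longrightarrow> (\<integral>\<^sup>+y. indicator K y * ennreal (cmod (f y)) \<partial>\<mu>) < \<infinity>) \<and>
      W_L1_Linfw_norm \<mu> V w f < \<infinity>}"

definition Linfw_norm :: "'g measure \<Rightarrow> ('g \<Rightarrow> real) \<Rightarrow> ('g \<Rightarrow> complex) \<Rightarrow> ennreal" where
  "Linfw_norm \<mu> w f = Inf {z. AE x in \<mu>. ennreal (cmod (f x)) / ennreal (w x) \<le> z}"

definition phase_space_setting ::
    "'g::{topological_group_add,t2_space} measure \<Rightarrow> ('g \<Rightarrow> real) \<Rightarrow> ('g \<Rightarrow> real) \<Rightarrow> 'g set
     \<Rightarrow> ('g \<Rightarrow> complex) set \<Rightarrow> (('g \<Rightarrow> complex) \<Rightarrow> ('g \<Rightarrow> complex)) \<Rightarrow> bool" where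
  "phase_space_setting \<mu> \<Delta> w V S P \<longleftrightarrow>
     locally_compact_sigma_compact TYPE('g) \<and>
     left_haar_measure \<mu> \<and> modular_function \<mu> \<Delta> \<and> admissible_weight \<mu> \<Delta> w \<and>
     \<comment> \<open>V: symmetric, relatively compact (Borel) neighbourhood of the identity\<close>
     V \<in> sets borel \<and> uminus ` V = V \<and> compact (closure V) \<and> 0 \<in> interior V \<and>
     \<comment> \<open>(A1)\<close>
     closed_continuous_subspace \<mu> S \<and>
     \<comment> \<open>(A2)\<close>
     (\<forall>f\<in>W_L1_Linfw \<mu> V w. P f \<in> borel_measurable \<mu> \<and> Linfw_norm \<mu> w (P f) < \<infinity>) \<and>
     (\<forall>f\<in>W_L1_Linfw \<mu> V w. \<forall>g\<in>W_L1_Linfw \<mu> V w. \<forall>a b.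
         AE x in \<mu>. P (\<lambda>y. a * f y + b * g y) x = a * P f x + b * P g x) \<and>
     (\<exists>C::real. \<forall>f\<in>W_L1_Linfw \<mu> V w.
         Linfw_norm \<mu> w (P f) \<le> ennreal C * W_L1_Linfw_norm \<mu> V w f) \<and>
     (\<forall>f\<in>L2 \<mu>. \<exists>g\<in>S. AE x in \<mu>. P f x = g x) \<and>
     (\<forall>f\<in>S. AE x in \<mu>. P f x = f x) \<and>
     (\<exists>K::'g \<Rightarrow> real. (\<forall>x. K x \<ge> 0) \<and>
         (\<lambda>x. complex_of_real (K x)) \<in> W_Linf_L1w \<mu> V w \<and>
         (\<lambda>x. complex_of_real (K x)) \<in> WR_Linf_L1w \<mu> V w \<and>
         (\<forall>f\<in>W_L1_Linfw \<mu> V w. AE x in \<mu>.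
            ennreal (cmod (P f x)) \<le> (\<integral>\<^sup>+y. ennreal (cmod (f y)) * ennreal (K (- y + x)) \<partial>\<mu>))) \<and>
     \<comment> \<open>(A3): on L2, P is the orthogonal projection onto S\<close>
     (\<forall>f\<in>L2 \<mu>. \<forall>h\<in>S. L2inner \<mu> (\<lambda>x. f x - P f x) h = 0)"

definition well_spread ::
    "'g::{topological_group_add,t2_space} measure \<Rightarrow> 'g set \<Rightarrow> ('g \<Rightarrow> real) \<Rightarrow> 'g set \<Rightarrow> ('g \<Rightarrow> 'g \<Rightarrow> real) \<Rightarrow> bool" where
  "well_spread \<mu> V w \<Gamma> \<eta> \<longleftrightarrow>
     (\<exists>n::nat. \<forall>x. finite (\<Gamma> \<inter> (\<lambda>v. x + v) ` V) \<and> card (\<Gamma> \<inter> (\<lambda>v. x + v) ` V) \<le> n) \<and>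
     (\<exists>g. g \<in> WR_Linf_L1w \<mu> V w \<and> (\<forall>\<gamma>\<in>\<Gamma>. \<forall>x. \<bar>\<eta> \<gamma> x\<bar> \<le> cmod (g (- \<gamma> + x))))"

definition sum_approx_one :: "'g measure \<Rightarrow> 'g set \<Rightarrow> ('g \<Rightarrow> 'g \<Rightarrow> real) \<Rightarrow> bool" where
  "sum_approx_one \<mu> \<Gamma> \<eta> \<longleftrightarrow>
     (\<exists>A B. 0 < A \<and> A \<le> B \<and>
        (AE x in \<mu>. (\<lambda>\<gamma>. \<eta> \<gamma> x) summable_on \<Gamma> \<and>
                     A \<le> (\<Sum>\<^sub>\<infinity>\<gamma>\<in>\<Gamma>. \<eta> \<gamma> x) \<and> (\<Sum>\<^sub>\<infinity>\<gamma>\<in>\<Gamma>. \<eta> \<gamma> x) \<le> B))"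

definition multiplier :: "(('g \<Rightarrow> complex) \<Rightarrow> ('g \<Rightarrow> complex)) \<Rightarrow> ('g \<Rightarrow> real) \<Rightarrow> ('g \<Rightarrow> complex) \<Rightarrow> ('g \<Rightarrow> complex)" where
  "multiplier P m f = P (\<lambda>x. complex_of_real (m x) * f x)"

definition diagonalizes ::
    "'g measure \<Rightarrow> ('g \<Rightarrow> complex) set \<Rightarrow> (('g \<Rightarrow> complex) \<Rightarrow> ('g \<Rightarrow> complex)) \<Rightarrow> ('g \<Rightarrow> real)
     \<Rightarrow> (nat \<Rightarrow> real) \<Rightarrow> (nat \<Rightarrow> 'g \<Rightarrow> complex) \<Rightarrow> bool" where
  "diagonalizes \<mu> S P m lam phi \<longleftrightarrow>
     (\<forall>k\<ge>1. lam k \<ge> 0 \<and> lam (Suc k) \<le> lam k) \<and>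
     (\<forall>k\<ge>1. lam k > 0 \<longrightarrow> phi k \<in> S) \<and>
     (\<forall>k\<ge>1. \<forall>l\<ge>1. lam k > 0 \<longrightarrow> lam l > 0 \<longrightarrow>
        L2inner \<mu> (phi k) (phi l) = (if k = l then 1 else 0)) \<and>
     (\<forall>f\<in>S. (\<lambda>n. L2norm \<mu> (\<lambda>x. multiplier P m f x -
          (\<Sum>k\<in>{1..n}. complex_of_real (lam k) * L2inner \<mu> f (phi k) * phi k x))) \<longlonglongrightarrow> 0)"

text \<open>Truncated multiplier M^eps (finite sum since lam k tends to 0).\<close>
definition trunc_multiplier ::
    "'g measure \<Rightarrow> (nat \<Rightarrow> real) \<Rightarrow> (nat \<Rightarrow> 'g \<Rightarrow> complex) \<Rightarrow> real \<Rightarrow> ('g \<Rightarrow> complex) \<Rightarrow> ('g \<Rightarrow> complex)" where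
  "trunc_multiplier \<mu> lam phi \<epsilon> f = (\<lambda>x.
     \<Sum>k\<in>{k. 1 \<le> k \<and> lam k > \<epsilon>}. complex_of_real (lam k) * L2inner \<mu> f (phi k) * phi k x)"

definition is_frame :: "'g measure \<Rightarrow> ('g \<Rightarrow> complex) set \<Rightarrow> 'i set \<Rightarrow> ('i \<Rightarrow> 'g \<Rightarrow> complex) \<Rightarrow> bool" where
  "is_frame \<mu> S J e \<longleftrightarrow>
     (\<exists>a b. 0 < a \<and> a \<le> b \<and>
        (\<forall>f\<in>S. (\<lambda>j. (cmod (L2inner \<mu> f (e j)))\<^sup>2) summable_on J \<and>
           a * (L2norm \<mu> f)\<^sup>2 \<le> (\<Sum>\<^sub>\<infinity>j\<in>J. (cmod (L2inner \<mu> f (e j)))\<^sup>2) \<and>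
           (\<Sum>\<^sub>\<infinity>j\<in>J. (cmod (L2inner \<mu> f (e j)))\<^sup>2) \<le> b * (L2norm \<mu> f)\<^sup>2))"

end

theory Submission
  imports Defs
begin

text \<open>
  Write \<open>q\<^sub>\<gamma>(f) = \<integral> \<eta>\<^sub>\<gamma> |f|\<^sup>2 = \<Sum>\<^sub>k \<lambda>\<^sub>k |\<langle>f, \<phi>\<^sub>k\<rangle>|\<^sup>2\<close>; then \<open>\<Sum>\<^sub>\<gamma> q\<^sub>\<gamma>(f)\<close> is comparable to \<open>\<parallel>f\<parallel>\<^sup>2\<close>,
  and \<open>\<lambda>\<^sub>k \<le> sup \<eta>\<^sub>\<gamma>\<close> gives the upper bounds. For the lower bounds one must show that the parts
  \<open>t\<^sub>\<gamma>\<close> of the forms \<open>q\<^sub>\<gamma>\<close> belonging to eigenvalues \<open>\<le> \<epsilon>\<close> have a small sum. Split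
  \<open>f = P(f 1\<^sub>\<gamma>\<^sub>U) + P(f 1\<^sub>\<gamma>\<^sub>U\<^sub>c)\<close> with a large compact set \<open>U\<close>. On the first summand \<open>t\<^sub>\<gamma> \<le> \<epsilon> \<parallel>\<cdot>\<parallel>\<^sup>2\<close>, and
  the sets \<open>\<gamma>U\<close> have bounded overlap, so the sum is \<open>O(\<epsilon>)\<parallel>f\<parallel>\<^sup>2\<close>. On the second \<open>t\<^sub>\<gamma> \<le> q\<^sub>\<gamma>\<close>, and the sum
  is small by the Cauchy-Schwarz inequality, Tonelli's theorem and the decay of the kernel \<open>K\<close> and of the
  envelope of the symbols. The frames come from \<open>\<Sum>\<^sub>k \<lambda>\<^sub>k \<le> const \<integral> \<eta>\<^sub>\<gamma>\<close>, a consequence of the bound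
  \<open>|f(x)| \<le> const \<parallel>f\<parallel>\<close> on \<open>S\<close>: it forces every eigenvalue \<open>> \<epsilon>\<close> to have index \<open>\<le> N\<^sub>\<gamma>\<close>.

  The group need not be second countable, so the group operations need not be measurable for the
  product of the Borel \<sigma>-algebras. They are measurable for the Baire \<sigma>-algebra, and Borel functions agree
  almost everywhere with Baire functions; this gives Tonelli's theorem for convolution integrals.
\<close>

section \<open>Baire sets and Tonelli's theorem\<close>

text \<open>For a single \<gamma> the eigenvalues up to \<epsilon> contribute at most \<epsilon>
  times the squared norm of f, and \<Gamma> may be infinite, so this bound cannot be summed until f
  has been localized near \<gamma>. A cut-off takes f out of S, where the spectral expansion is
  available; applying P to both pieces brings them back and keeps their sum equal to f. The price is
  that the far piece is no longer supported far from \<gamma>: only the decay of the kernel keeps it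
  away from the bulk of the symbol. The comparisons with the norm and with truncated sums are proved
  for finite subsets of \<Gamma>, with constants that do not depend on the subset, and are passed to
  infinite sums at the end. A lower bound at one threshold settles every smaller one, because
  lowering the threshold only adds non-negative terms.\<close>

definition baire :: "'g::topological_space measure" where
  "baire = sigma UNIV {{x. f x > 0} | f :: 'g \<Rightarrow> real. continuous_on UNIV f}"

lemma space_baire [simp]: "space baire = UNIV"
  by (simp add: baire_def)

lemma sets_baire: "sets baire = sigma_sets UNIV {{x. f x > 0} | f :: 'g::topological_space \<Rightarrow> real. continuous_on UNIV f}"
  by (simp add: baire_def)

lemma positivity_set_baire:
  fixes f :: "'g::topological_space \<Rightarrow> real"
  assumes "continuous_on UNIV f"
  shows "{x. f x > 0} \<in> sets baire"
  unfolding sets_baire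
  by (rule sigma_sets.Basic, rule CollectI, intro exI conjI) (rule refl, rule assms)

lemma continuous_imp_baire_measurable:
  fixes f :: "'g::topological_space \<Rightarrow> real"
  assumes "continuous_on UNIV f"
  shows "f \<in> borel_measurable baire"
proof -
  have "{x. a < f x} \<in> sets baire" for a
  proof -
    have "continuous_on UNIV (\<lambda>x. f x - a)"
      using assms by (intro continuous_intros)
    then have "{x. f x - a > 0} \<in> sets baire"
      by (rule positivity_set_baire)
    then show ?thesis
      by simp
  qed
  then show ?thesis
    by (simp add: borel_measurable_iff_greater)
qed

text \<open>The generators are positivity sets of continuous real functions, so maps into
  \<open>baire\<close> are tested by composing with such functions. Continuity of a group operation
  becomes measurability as soon as continuous real functions on its domain are measurable.\<close>

lemma measurable_baireI:
  assumes "\<And>f :: 'g::topological_space \<Rightarrow> real. continuous_on UNIV f \<Longrightarrow> (\<lambda>x. f (T x)) \<in> borel_measurable M"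
  shows "T \<in> measurable M (baire :: 'g measure)"
  unfolding baire_def
proof (rule measurable_measure_of)
  fix A :: "'g set"
  assume "A \<in> {{x. 0 < f x} |f :: 'g \<Rightarrow> real. continuous_on UNIV f}"
  then obtain f :: "'g \<Rightarrow> real" where f: "continuous_on UNIV f" "A = {x. 0 < f x}"
    by auto
  have "T -` A \<inter> space M = {x \<in> space M. 0 < f (T x)}"
    using f by auto
  also have "\<dots> \<in> sets M"
    using assms[OF f(1)] by measurable
  finally show "T -` A \<inter> space M \<in> sets M" .
qed auto

lemma id_measurable_borel_baire: "(\<lambda>x. x) \<in> measurable borel baire"
  by (rule measurable_baireI) (simp add: borel_measurable_continuous_onI)

section \<open>Sums and translates of subsets of the group\<close>

definition set_sum :: "'g::plus set \<Rightarrow> 'g set \<Rightarrow> 'g set" where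
  "set_sum A B = (\<lambda>(x, y). x + y) ` (A \<times> B)"

lemma set_sumI: "a \<in> A \<Longrightarrow> b \<in> B \<Longrightarrow> a + b \<in> set_sum A B"
  by (force simp: set_sum_def)

lemma compact_set_sum:
  fixes A B :: "'g::topological_monoid_add set"
  assumes "compact A" "compact B"
  shows "compact (set_sum A B)"
  unfolding set_sum_def case_prod_unfold
  by (intro compact_continuous_image continuous_intros compact_Times assms)

lemma compact_uminus:
  fixes A :: "'g::topological_group_add set"
  assumes "compact A"
  shows "compact (uminus ` A)"
  by (rule compact_continuous_image[OF _ assms])
    (auto simp: continuous_on_def intro!: tendsto_intros)

lemma continuous_on_uminus_group:
  fixes f :: "'a::topological_space \<Rightarrow> 'g::topological_group_add"
  assumes "continuous_on A f"
  shows "continuous_on A (\<lambda>x. - f x)"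
  using assms by (auto simp: continuous_on_def intro!: tendsto_intros)

lemma left_translation_image:
  fixes x :: "'g::group_add"
  shows "(\<lambda>y. x + y) ` A = (\<lambda>y. - x + y) -` A"
proof (intro equalityI subsetI)
  fix y assume "y \<in> (\<lambda>y. - x + y) -` A"
  then have "- x + y \<in> A" "y = x + (- x + y)"
    by simp_all
  then show "y \<in> (\<lambda>y. x + y) ` A"
    by (rule rev_image_eqI)
qed auto

lemma right_translation_image:
  fixes x :: "'g::group_add"
  shows "(\<lambda>y. y + x) ` A = (\<lambda>y. y - x) -` A"
proof (intro equalityI subsetI)
  fix y assume "y \<in> (\<lambda>y. y - x) -` A"
  then have "y - x \<in> A" "y = y - x + x"
    by simp_all
  then show "y \<in> (\<lambda>y. y + x) ` A"
    by (rule rev_image_eqI)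
qed auto

lemma open_left_translation:
  fixes A :: "'g::topological_group_add set"
  assumes "open A"
  shows "open ((\<lambda>y. x + y) ` A)"
  unfolding left_translation_image
  by (intro open_vimage assms continuous_intros)

section \<open>Haar measure under translations\<close>

locale haar_group =
  fixes \<mu> :: "'g::{topological_group_add,t2_space} measure" and \<Delta> :: "'g \<Rightarrow> real"
  assumes lcsc: "locally_compact_sigma_compact TYPE('g)"
    and haar: "left_haar_measure \<mu>"
    and modular: "modular_function \<mu> \<Delta>"
begin

lemma sets_mu: "sets \<mu> = sets borel"
  using haar by (simp add: left_haar_measure_def)

lemma space_mu [simp]: "space \<mu> = UNIV"
  using sets_eq_imp_space_eq[OF sets_mu] by simp

lemma measurable_mu_eq: "measurable \<mu> N = measurable borel N"
  by (intro measurable_cong_sets sets_mu refl)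

lemma measurable_eq_mu: "measurable N \<mu> = measurable N borel"
  by (intro measurable_cong_sets sets_mu refl)

lemma continuous_measurable_mu_mu:
  "continuous_on UNIV f \<Longrightarrow> f \<in> measurable \<mu> \<mu>"
  by (simp add: measurable_mu_eq measurable_eq_mu borel_measurable_continuous_onI)

lemma measurable_translations:
  shows "(\<lambda>y. x + y) \<in> measurable \<mu> \<mu>" "(\<lambda>y. y + x) \<in> measurable \<mu> \<mu>"
    "(\<lambda>y. y - x) \<in> measurable \<mu> \<mu>" "(\<lambda>y. - y) \<in> measurable \<mu> \<mu>"
    "(\<lambda>y. x - y) \<in> measurable \<mu> \<mu>" "(\<lambda>y. - y + x) \<in> measurable \<mu> \<mu>"
  unfolding diff_conv_add_uminus
  by (intro continuous_measurable_mu_mu continuous_intros continuous_on_uminus_group)+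

lemma compact_sets_mu: "compact A \<Longrightarrow> A \<in> sets \<mu>"
  by (simp add: sets_mu compact_imp_closed)

lemma haar_facts:
  shows "\<And>x A. A \<in> sets borel \<Longrightarrow> emeasure \<mu> ((\<lambda>y. x + y) ` A) = emeasure \<mu> A"
    and emeasure_compact: "\<And>A. compact A \<Longrightarrow> emeasure \<mu> A < \<infinity>"
    and emeasure_open_pos: "\<And>A. open A \<Longrightarrow> A \<noteq> {} \<Longrightarrow> emeasure \<mu> A > 0"
    and outer_regular: "\<And>A. A \<in> sets borel \<Longrightarrow> emeasure \<mu> A = (INF U\<in>{U. open U \<and> A \<subseteq> U}. emeasure \<mu> U)"
    and inner_regular_open: "\<And>U. open U \<Longrightarrow> emeasure \<mu> U = (SUP K\<in>{K. compact K \<and> K \<subseteq> U}. emeasure \<mu> K)"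
  using haar unfolding left_haar_measure_def by blast+

lemma modular_facts:
  shows Delta_pos: "\<And>x. \<Delta> x > 0"
    and emeasure_right_image: "\<And>x A. A \<in> sets borel \<Longrightarrow> emeasure \<mu> ((\<lambda>y. y + x) ` A) = ennreal (\<Delta> x) * emeasure \<mu> A"
  using modular unfolding modular_function_def by blast+

lemma emeasure_left:
  assumes "A \<in> sets \<mu>"
  shows "emeasure \<mu> ((\<lambda>y. x + y) -` A) = emeasure \<mu> A"
  using haar_facts(1)[of A "- x"] assms left_translation_image[of "- x" A] sets_mu by simp

lemma emeasure_right:
  assumes "A \<in> sets \<mu>"
  shows "emeasure \<mu> ((\<lambda>y. y + x) -` A) = ennreal (\<Delta> (- x)) * emeasure \<mu> A"
proof -
  have "(\<lambda>y. y + x) -` A = (\<lambda>y. y + (- x)) ` A"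
    unfolding right_translation_image by (simp only: diff_minus_eq_add)
  then show ?thesis
    using emeasure_right_image[of A "- x"] assms sets_mu by simp
qed

lemma distr_left: "distr \<mu> \<mu> (\<lambda>y. x + y) = \<mu>"
  using measurable_translations(1)[of x]
  by (intro measure_eqI) (auto simp: emeasure_distr emeasure_left)

lemma nn_integral_left:
  assumes "f \<in> borel_measurable \<mu>"
  shows "(\<integral>\<^sup>+y. f (x + y) \<partial>\<mu>) = (\<integral>\<^sup>+y. f y \<partial>\<mu>)"
  using nn_integral_distr[OF measurable_translations(1), of f x] assms
  by (simp add: distr_left)

lemma distr_right: "distr \<mu> \<mu> (\<lambda>y. y + x) = density \<mu> (\<lambda>_. ennreal (\<Delta> (- x)))"
  using measurable_translations(2)[of x]
  by (intro measure_eqI) (auto simp: emeasure_distr emeasure_right emeasure_density nn_integral_cmult)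

lemma nn_integral_right:
  assumes [measurable]: "f \<in> borel_measurable \<mu>"
  shows "(\<integral>\<^sup>+y. f (y + x) \<partial>\<mu>) = ennreal (\<Delta> (- x)) * (\<integral>\<^sup>+y. f y \<partial>\<mu>)"
  using nn_integral_distr[OF measurable_translations(2), of f x] assms
  by (simp add: distr_right nn_integral_density nn_integral_cmult)

lemma AE_left:
  assumes "AE y in \<mu>. Q y"
  shows "AE y in \<mu>. Q (x + y)"
proof -
  obtain N where N: "{y. \<not> Q y} \<subseteq> N" "N \<in> sets \<mu>" "emeasure \<mu> N = 0"
    using assms by (auto elim: AE_E)
  show ?thesis
  proof (rule AE_I[where N = "(\<lambda>y. x + y) -` N"])
    show "(\<lambda>y. x + y) -` N \<in> sets \<mu>"
      using measurable_sets[OF measurable_translations(1) N(2)] by simp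
  qed (use N emeasure_left in auto)
qed

lemma AE_right:
  assumes "AE y in \<mu>. Q y"
  shows "AE y in \<mu>. Q (y + x)"
proof -
  obtain N where N: "{y. \<not> Q y} \<subseteq> N" "N \<in> sets \<mu>" "emeasure \<mu> N = 0"
    using assms by (auto elim: AE_E)
  show ?thesis
  proof (rule AE_I[where N = "(\<lambda>y. y + x) -` N"])
    show "(\<lambda>y. y + x) -` N \<in> sets \<mu>"
      using measurable_sets[OF measurable_translations(2) N(2)] by simp
  qed (use N emeasure_right in auto)
qed

section \<open>Compact exhaustions and Urysohn functions\<close>

lemma compact_exhaustion:
  obtains C :: "nat \<Rightarrow> 'g set"
  where "\<And>n. compact (C n)" "incseq C" "(\<Union>n. C n) = UNIV"
proof -
  obtain D :: "nat \<Rightarrow> 'g set" where D: "\<And>n. compact (D n)" "(\<Union>n. D n) = UNIV"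
    using lcsc unfolding locally_compact_sigma_compact_def by blast
  show thesis
  proof
    show "compact (\<Union>i\<le>n. D i)" for n
      using D by (intro compact_UN) auto
    show "incseq (\<lambda>n. \<Union>i\<le>n. D i)"
      by (force simp: incseq_def)
    show "(\<Union>n. \<Union>i\<le>n. D i) = UNIV"
      using D(2) by auto
  qed
qed

text \<open>Translates of one neighbourhood of the identity suffice: their union over
  \<open>C\<close> lies in \<open>set_sum C K\<close>, which is compact as a continuous image of a
  product.\<close>

lemma compact_subset_open_subset_compact:
  assumes "compact (C :: 'g set)"
  obtains O' D where "open O'" "C \<subseteq> O'" "O' \<subseteq> D" "compact D"
proof -
  obtain U K where U: "open U" "compact K" "(0::'g) \<in> U" "U \<subseteq> K"
    using lcsc unfolding locally_compact_sigma_compact_def by blast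
  show thesis
  proof
    show "open (\<Union>c\<in>C. (\<lambda>y. c + y) ` U)"
      using U by (intro open_UN ballI open_left_translation)
    show "C \<subseteq> (\<Union>c\<in>C. (\<lambda>y. c + y) ` U)"
    proof
      fix c assume "c \<in> C"
      moreover have "c \<in> (\<lambda>y. c + y) ` U"
        using U(3) by (metis add.right_neutral image_eqI)
      ultimately show "c \<in> (\<Union>c\<in>C. (\<lambda>y. c + y) ` U)" by (rule UN_I)
    qed
    show "(\<Union>c\<in>C. (\<lambda>y. c + y) ` U) \<subseteq> set_sum C K"
      by (intro UN_least image_subsetI set_sumI) (use U(4) in blast)+
    show "compact (set_sum C K)"
      using assms U by (intro compact_set_sum)
  qed
qed

lemma completely_regular: "completely_regular_space (euclidean :: 'g topology)"
proof (rule locally_compact_regular_imp_completely_regular_space)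
  have "\<forall>x::'g. \<exists>U K. open U \<and> compact K \<and> x \<in> U \<and> U \<subseteq> K"
    using lcsc unfolding locally_compact_sigma_compact_def by (rule conjunct1)
  then show "locally_compact_space (euclidean :: 'g topology)"
    unfolding locally_compact_space_def topspace_euclidean open_openin[symmetric] compactin_euclidean_iff
    by (intro ballI) (rule spec)
  have "Hausdorff_space (euclidean :: 'g topology)"
    unfolding Hausdorff_space_def disjnt_def open_openin[symmetric]
    by (intro allI impI, elim conjE) (rule hausdorff)
  then show "Hausdorff_space (euclidean :: 'g topology) \<or> regular_space (euclidean :: 'g topology)" ..
qed

lemma Urysohn_compact_open:
  assumes "compact C" "open O'" "C \<subseteq> (O' :: 'g set)"
  obtains f :: "'g \<Rightarrow> real" where "continuous_on UNIV f" "\<And>x. 0 \<le> f x" "\<And>x. x \<in> C \<Longrightarrow> f x = 1"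
    "\<And>x. x \<notin> O' \<Longrightarrow> f x = 0"
proof -
  obtain f where f: "continuous_map (euclidean :: 'g topology) (top_of_set {0..1::real}) f"
     "f ` (- O') \<subseteq> {0}" "f ` C \<subseteq> {1}"
    using Urysohn_completely_regular_compact_closed[of 0 1 "euclidean :: 'g topology" C "- O'"]
      completely_regular assms
    by (auto simp: disjnt_def)
  show thesis
    using f by (intro that[of f]) (auto simp: continuous_map_in_subtopology image_subset_iff Pi_iff)
qed

text \<open>A compact set need not be a Baire set, so every approximation from inside by compact
  sets is routed through the positivity set of a Urysohn function.\<close>

lemma baire_between:
  assumes "compact C" "open O'" "C \<subseteq> (O' :: 'g set)"
  obtains D where "D \<in> sets baire" "open D" "C \<subseteq> D" "D \<subseteq> O'"
proof -
  obtain f :: "'g \<Rightarrow> real" where f: "continuous_on UNIV f" "\<And>x. 0 \<le> f x" "\<And>x. x \<in> C \<Longrightarrow> f x = 1"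
    "\<And>x. x \<notin> O' \<Longrightarrow> f x = 0"
    using Urysohn_compact_open[OF assms] by blast
  show thesis
  proof
    show "{x. f x > 0} \<in> sets baire"
      using f(1) by (rule positivity_set_baire)
    show "open {x. f x > 0}"
      using f(1) by (intro open_Collect_less continuous_intros)
    show "C \<subseteq> {x. f x > 0}" using f by force
    show "{x. f x > 0} \<subseteq> O'" using f by force
  qed
qed

text \<open>This is the gain over the Borel algebra. On each compact square
  \<open>C n \<times> C n\<close> the ring \<open>R\<close> separates points, because it contains
  the continuous functions of one coordinate, and Stone-Weierstrass approximates \<open>H\<close>
  uniformly there. Every point lies in all squares from some index on, so \<open>H\<close> is a
  pointwise limit of members of \<open>R\<close>.\<close>

lemma continuous_imp_baire_pair_measurable:
  fixes H :: "'g \<times> 'g \<Rightarrow> real"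
  assumes H: "continuous_on UNIV H"
  shows "H \<in> borel_measurable (baire \<Otimes>\<^sub>M baire)"
proof -
  obtain C :: "nat \<Rightarrow> 'g set" where C: "\<And>n. compact (C n)" "incseq C" "(\<Union>n. C n) = UNIV"
    using compact_exhaustion by blast
  define R where "R = {q :: 'g \<times> 'g \<Rightarrow> real. continuous_on UNIV q \<and> q \<in> borel_measurable (baire \<Otimes>\<^sub>M baire)}"
  have "function_ring_on R (C n \<times> C n)" for n
  proof
    show "compact (C n \<times> C n)"
      using C by (intro compact_Times)
    show "continuous_on (C n \<times> C n) q" if "q \<in> R" for q
      using that by (auto simp: R_def intro: continuous_on_subset)
    show "(\<lambda>x. p x + q x) \<in> R" if "p \<in> R" "q \<in> R" for p q
      using that by (auto simp: R_def intro: continuous_on_add borel_measurable_add)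
    show "(\<lambda>x. p x * q x) \<in> R" if "p \<in> R" "q \<in> R" for p q
      using that by (auto simp: R_def intro: continuous_on_mult borel_measurable_times)
    show "(\<lambda>_. c) \<in> R" for c
      by (auto simp: R_def)
    have sep: "\<exists>f :: 'g \<Rightarrow> real. continuous_on UNIV f \<and> f a \<noteq> f b" if "a \<noteq> b" for a b
    proof -
      obtain f :: "'g \<Rightarrow> real" where "continuous_on UNIV f" "f a = 1" "f b = 0"
        by (rule Urysohn_compact_open[of "{a}" "- {b}"]) (use \<open>a \<noteq> b\<close> in auto)
      then show ?thesis by (intro exI[of _ f]) simp
    qed
    show "\<exists>f\<in>R. f x \<noteq> f y" if "x \<noteq> y" for x y
    proof (cases "fst x = fst y")
      case False
      then obtain f :: "'g \<Rightarrow> real" where f: "continuous_on UNIV f" "f (fst x) \<noteq> f (fst y)"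
        using sep by blast
      have "continuous_on UNIV (\<lambda>z::'g \<times> 'g. f (fst z))"
        by (rule continuous_on_compose2[OF f(1)]) (auto intro!: continuous_intros)
      moreover have "(\<lambda>z::'g \<times> 'g. f (fst z)) \<in> borel_measurable (baire \<Otimes>\<^sub>M baire)"
        using continuous_imp_baire_measurable[OF f(1)] by measurable
      ultimately show ?thesis
        using f(2) by (intro bexI[of _ "\<lambda>z. f (fst z)"]) (auto simp: R_def)
    next
      case True
      then have "snd x \<noteq> snd y"
        using that by (auto simp: prod_eq_iff)
      then obtain f :: "'g \<Rightarrow> real" where f: "continuous_on UNIV f" "f (snd x) \<noteq> f (snd y)"
        using sep by blast
      have "continuous_on UNIV (\<lambda>z::'g \<times> 'g. f (snd z))"
        by (rule continuous_on_compose2[OF f(1)]) (auto intro!: continuous_intros)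
      moreover have "(\<lambda>z::'g \<times> 'g. f (snd z)) \<in> borel_measurable (baire \<Otimes>\<^sub>M baire)"
        using continuous_imp_baire_measurable[OF f(1)] by measurable
      ultimately show ?thesis
        using f(2) by (intro bexI[of _ "\<lambda>z. f (snd z)"]) (auto simp: R_def)
    qed
  qed
  then have "\<exists>q\<in>R. \<forall>z\<in>C n \<times> C n. \<bar>H z - q z\<bar> < 1 / real (Suc n)" for n
    using H by (intro function_ring_on.Stone_Weierstrass_basic) (auto intro: continuous_on_subset)
  then obtain q where q: "\<And>n. q n \<in> R" "\<And>n z. z \<in> C n \<times> C n \<Longrightarrow> \<bar>H z - q n z\<bar> < 1 / real (Suc n)"
    by metis
  show ?thesis
  proof (rule borel_measurable_LIMSEQ_real)
    show "q n \<in> borel_measurable (baire \<Otimes>\<^sub>M baire)" for n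
      using q(1) by (simp add: R_def)
    show "(\<lambda>n. q n z) \<longlonglongrightarrow> H z" for z
    proof -
      obtain m1 m2 where "fst z \<in> C m1" "snd z \<in> C m2"
        using C(3) by (metis UNIV_I UN_E)
      then have "z \<in> C n \<times> C n" if "n \<ge> max m1 m2" for n
        using incseqD[OF C(2), of m1 n] incseqD[OF C(2), of m2 n] that
        by (auto simp: mem_Times_iff)
      then have "\<forall>\<^sub>F n in sequentially. norm (q n z - H z) \<le> 1 / real (Suc n)"
        using q(2) by (intro eventually_sequentiallyI[of "max m1 m2"])
          (metis abs_minus_commute less_imp_le real_norm_def)
      moreover have "(\<lambda>n. 1 / real (Suc n)) \<longlonglongrightarrow> 0"
        using LIMSEQ_inverse_real_of_nat by (simp add: inverse_eq_divide)
      ultimately have "(\<lambda>n. q n z - H z) \<longlonglongrightarrow> 0"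
        by (rule Lim_null_comparison)
      then show ?thesis
        by (rule LIM_zero_cancel)
    qed
  qed
qed

lemma continuous_imp_baire_pair_baire_measurable:
  fixes T :: "'g \<times> 'g \<Rightarrow> 'g"
  assumes "continuous_on UNIV T"
  shows "T \<in> measurable (baire \<Otimes>\<^sub>M baire) baire"
proof (rule measurable_baireI)
  fix f :: "'g \<Rightarrow> real"
  assume "continuous_on UNIV f"
  then have "continuous_on UNIV (\<lambda>z. f (T z))"
    by (rule continuous_on_compose2) (use assms in auto)
  then show "(\<lambda>z. f (T z)) \<in> borel_measurable (baire \<Otimes>\<^sub>M baire)"
    by (rule continuous_imp_baire_pair_measurable)
qed

lemma continuous_imp_baire_baire_measurable:
  fixes T :: "'g \<Rightarrow> 'g"
  assumes "continuous_on UNIV T"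
  shows "T \<in> measurable baire baire"
proof (rule measurable_baireI)
  fix f :: "'g \<Rightarrow> real"
  assume "continuous_on UNIV f"
  then have "continuous_on UNIV (\<lambda>z. f (T z))"
    by (rule continuous_on_compose2) (use assms in auto)
  then show "(\<lambda>z. f (T z)) \<in> borel_measurable baire"
    by (rule continuous_imp_baire_measurable)
qed

section \<open>The restriction of Haar measure to the Baire sets\<close>

lemma id_measurable_mu_baire: "(\<lambda>x. x) \<in> measurable \<mu> baire"
  using id_measurable_borel_baire by (simp add: measurable_mu_eq)

lemma baire_measurable_mu: "f \<in> borel_measurable baire \<Longrightarrow> f \<in> borel_measurable \<mu>"
  using measurable_compose[OF id_measurable_mu_baire] by blast

lemma baire_sets_mu: "A \<in> sets baire \<Longrightarrow> A \<in> sets \<mu>"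
  using measurable_sets[OF id_measurable_mu_baire] by auto

text \<open>Tonelli's theorem is applied to a \<sigma>-finite measure living on the Baire algebra
  itself. As the image of \<open>\<mu>\<close> under the identity, it gives Baire functions the same
  integrals.\<close>

definition \<nu> where "\<nu> = distr \<mu> baire (\<lambda>x. x)"

lemma sets_nu: "sets \<nu> = sets baire" and space_nu [simp]: "space \<nu> = UNIV"
  by (simp_all add: \<nu>_def)

lemma emeasure_nu: "A \<in> sets baire \<Longrightarrow> emeasure \<nu> A = emeasure \<mu> A"
  using id_measurable_mu_baire by (simp add: \<nu>_def emeasure_distr)

lemma nn_integral_nu: "f \<in> borel_measurable baire \<Longrightarrow> (\<integral>\<^sup>+x. f x \<partial>\<nu>) = (\<integral>\<^sup>+x. f x \<partial>\<mu>)"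
  using id_measurable_mu_baire by (simp add: \<nu>_def nn_integral_distr)

lemma baire_exhaustion:
  obtains W D :: "nat \<Rightarrow> 'g set"
  where "\<And>n. W n \<in> sets baire" "\<And>n. open (W n)" "\<And>n. W n \<subseteq> D n" "\<And>n. compact (D n)"
    "(\<Union>n. W n) = UNIV"
proof -
  obtain C :: "nat \<Rightarrow> 'g set" where C: "\<And>n. compact (C n)" "incseq C" "(\<Union>n. C n) = UNIV"
    using compact_exhaustion by blast
  have "\<exists>W D. W \<in> sets baire \<and> open W \<and> W \<subseteq> D \<and> compact D \<and> C n \<subseteq> W" for n
  proof -
    obtain O' D where OD: "open O'" "C n \<subseteq> O'" "O' \<subseteq> D" "compact D"
      using compact_subset_open_subset_compact[OF C(1)] by blast
    obtain W where W: "W \<in> sets baire" "open W" "C n \<subseteq> W" "W \<subseteq> O'"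
      using baire_between[OF C(1) OD(1,2)] by blast
    show ?thesis
      by (intro exI[of _ W] exI[of _ D] conjI W OD(4) subset_trans[OF W(4) OD(3)])
  qed
  then have "\<exists>W D. \<forall>n. W n \<in> sets baire \<and> open (W n) \<and> W n \<subseteq> D n \<and> compact (D n) \<and> C n \<subseteq> W n"
    by metis
  then obtain W D where WD: "\<forall>n. W n \<in> sets baire \<and> open (W n) \<and> W n \<subseteq> D n \<and> compact (D n) \<and> C n \<subseteq> W n"
    by (elim exE)
  show thesis
  proof (rule that[of W D])
    show "(\<Union>n. W n) = UNIV"
      using C(3) WD by (metis SUP_mono' top.extremum_uniqueI)
  qed (use WD in auto)
qed

lemma sigma_finite_nu: "sigma_finite_measure \<nu>"
proof -
  obtain W D :: "nat \<Rightarrow> 'g set"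
  where W: "\<And>n. W n \<in> sets baire" "\<And>n. open (W n)" "\<And>n. W n \<subseteq> D n" "\<And>n. compact (D n)"
    "(\<Union>n. W n) = UNIV"
    using baire_exhaustion by blast
  have "emeasure \<nu> (W n) \<noteq> \<infinity>" for n
    using W emeasure_compact[OF W(4)[of n]] emeasure_mono[OF W(3)[of n] compact_sets_mu[OF W(4)]]
    by (auto simp: emeasure_nu top_unique)
  then show ?thesis
    using W by (intro sigma_finite_measure.intro exI[of _ "range W"]) (auto simp: sets_nu)
qed

lemma pair_sigma_finite_nu: "pair_sigma_finite \<nu> \<nu>"
  using sigma_finite_nu by (simp add: pair_sigma_finite_def)

lemma baire_nn_integral_measurable:
  assumes F: "(\<lambda>z. F (fst z) (snd z)) \<in> borel_measurable (baire \<Otimes>\<^sub>M baire)"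
  shows "(\<lambda>x. \<integral>\<^sup>+y. F x y \<partial>\<mu>) \<in> borel_measurable baire"
proof -
  interpret sigma_finite_measure \<nu> by (rule sigma_finite_nu)
  have "(\<lambda>z. F (fst z) (snd z)) \<in> borel_measurable (baire \<Otimes>\<^sub>M \<nu>)"
    using F by (simp add: measurable_cong_sets[OF sets_pair_measure_cong[OF refl sets_nu] refl])
  from borel_measurable_nn_integral_fst[OF this]
  have "(\<lambda>x. \<integral>\<^sup>+y. F x y \<partial>\<nu>) \<in> borel_measurable baire"
    by simp
  also have "(\<lambda>x. \<integral>\<^sup>+y. F x y \<partial>\<nu>) = (\<lambda>x. \<integral>\<^sup>+y. F x y \<partial>\<mu>)"
    using measurable_compose[OF measurable_Pair1' F] by (intro ext nn_integral_nu) simp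
  finally show ?thesis .
qed

lemma baire_Fubini:
  assumes F: "(\<lambda>z. F (fst z) (snd z)) \<in> borel_measurable (baire \<Otimes>\<^sub>M baire)"
  shows "(\<integral>\<^sup>+x. \<integral>\<^sup>+y. F x y \<partial>\<mu> \<partial>\<mu>) = (\<integral>\<^sup>+y. \<integral>\<^sup>+x. F x y \<partial>\<mu> \<partial>\<mu>)"
proof -
  interpret pair_sigma_finite \<nu> \<nu> by (rule pair_sigma_finite_nu)
  have F': "(\<lambda>z. F (fst z) (snd z)) \<in> borel_measurable (\<nu> \<Otimes>\<^sub>M \<nu>)"
    using F by (simp add: measurable_cong_sets[OF sets_pair_measure_cong[OF sets_nu sets_nu] refl])
  have Fs: "(\<lambda>z. F (snd z) (fst z)) \<in> borel_measurable (baire \<Otimes>\<^sub>M baire)"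
    using measurable_compose[OF measurable_pair_swap' F] by (simp add: case_prod_unfold)
  have "(\<integral>\<^sup>+x. \<integral>\<^sup>+y. F x y \<partial>\<mu> \<partial>\<mu>) = (\<integral>\<^sup>+x. \<integral>\<^sup>+y. F x y \<partial>\<mu> \<partial>\<nu>)"
    by (rule nn_integral_nu[symmetric]) (rule baire_nn_integral_measurable[OF F])
  also have "\<dots> = (\<integral>\<^sup>+x. \<integral>\<^sup>+y. F x y \<partial>\<nu> \<partial>\<nu>)"
    using measurable_compose[OF measurable_Pair1' F]
    by (intro nn_integral_cong nn_integral_nu[symmetric]) simp
  also have "\<dots> = (\<integral>\<^sup>+y. \<integral>\<^sup>+x. F x y \<partial>\<nu> \<partial>\<nu>)"
    using Fubini[OF F'] by simp
  also have "\<dots> = (\<integral>\<^sup>+y. \<integral>\<^sup>+x. F x y \<partial>\<mu> \<partial>\<nu>)"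
    using measurable_compose[OF measurable_Pair1' Fs]
    by (intro nn_integral_cong nn_integral_nu) simp
  also have "\<dots> = (\<integral>\<^sup>+y. \<integral>\<^sup>+x. F x y \<partial>\<mu> \<partial>\<mu>)"
    by (rule nn_integral_nu) (rule baire_nn_integral_measurable[OF Fs])
  finally show ?thesis .
qed

end

lemma ennreal_mult_cancel_right_pos:
  fixes a b c :: ennreal
  assumes "a * c = b * c" "0 < c" "c < top"
  shows "a = b"
  using assms ennreal_mult_cancel_left[of c a b] by (auto simp: mult.commute)

section \<open>Borel sets and functions modulo null sets\<close>

context haar_group
begin

text \<open>Inner regularity supplies compact subsets whose measures approach that of
  \<open>U\<close>, and an open Baire set is interposed between each of them and \<open>U\<close>.
  Since the measure is finite, equal measures mean a null difference.\<close>

lemma open_finite_baire_subset: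
  assumes U: "open U" "emeasure \<mu> U < \<infinity>"
  obtains D where "D \<in> sets baire" "D \<subseteq> U" "emeasure \<mu> (U - D) = 0"
proof -
  have Us: "U \<in> sets \<mu>"
    using U by (simp add: sets_mu)
  have "{K. compact K \<and> K \<subseteq> U} \<noteq> {}"
    by (auto intro: exI[of _ "{}"])
  from ennreal_SUP_countable_SUP[OF this, of "emeasure \<mu>"]
  obtain f :: "nat \<Rightarrow> ennreal" where f: "range f \<subseteq> emeasure \<mu> ` {K. compact K \<and> K \<subseteq> U}"
    "emeasure \<mu> U = (SUP n. f n)"
    using inner_regular_open[OF U(1)] by auto
  have "\<exists>D. D \<in> sets baire \<and> D \<subseteq> U \<and> f n \<le> emeasure \<mu> D" for n
  proof -
    have "f n \<in> emeasure \<mu> ` {K. compact K \<and> K \<subseteq> U}"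
      using f(1) by (rule subsetD) (rule rangeI)
    then obtain K where K: "compact K" "K \<subseteq> U" "f n = emeasure \<mu> K"
      by auto
    obtain D where D: "D \<in> sets baire" "open D" "K \<subseteq> D" "D \<subseteq> U"
      using baire_between[OF K(1) U(1) K(2)] by blast
    have "emeasure \<mu> K \<le> emeasure \<mu> D"
      by (rule emeasure_mono[OF D(3) baire_sets_mu[OF D(1)]])
    then show ?thesis
      using D K(3) by (intro exI[of _ D]) simp
  qed
  then obtain D where D: "\<And>n. D n \<in> sets baire" "\<And>n. D n \<subseteq> U" "\<And>n. f n \<le> emeasure \<mu> (D n)"
    by metis
  have Ds: "(\<Union>n. D n) \<in> sets baire"
    using D(1) by blast
  have sub: "(\<Union>n. D n) \<subseteq> U"
    using D(2) by blast
  have "emeasure \<mu> U \<le> emeasure \<mu> (\<Union>n. D n)"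
    unfolding f(2)
  proof (rule SUP_least)
    fix n
    have "emeasure \<mu> (D n) \<le> emeasure \<mu> (\<Union>n. D n)"
      by (rule emeasure_mono[OF _ baire_sets_mu[OF Ds]]) blast
    with D(3)[of n] show "f n \<le> emeasure \<mu> (\<Union>n. D n)"
      by (rule order_trans)
  qed
  moreover have le: "emeasure \<mu> (\<Union>n. D n) \<le> emeasure \<mu> U"
    by (rule emeasure_mono[OF sub Us])
  ultimately have "emeasure \<mu> (U - (\<Union>n. D n)) = 0"
    using U(2) baire_sets_mu[OF Ds] Us sub
    by (subst emeasure_Diff) (auto intro: diff_eq_0_ennreal)
  with Ds sub show thesis
    by (rule that)
qed

text \<open>The finite case applies to the pieces \<open>U \<inter> W n\<close>, and only countably
  many exceptional null sets arise.\<close>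

lemma open_AE_baire:
  assumes "open U"
  shows "\<exists>B\<in>sets baire. AE x in \<mu>. x \<in> U \<longleftrightarrow> x \<in> B"
proof -
  obtain W D :: "nat \<Rightarrow> 'g set"
  where W: "\<And>n. W n \<in> sets baire" "\<And>n. open (W n)" "\<And>n. W n \<subseteq> D n" "\<And>n. compact (D n)"
    "(\<Union>n. W n) = UNIV"
    using baire_exhaustion by blast
  have "\<exists>B\<in>sets baire. B \<subseteq> U \<inter> W n \<and> emeasure \<mu> (U \<inter> W n - B) = 0" for n
  proof -
    have "emeasure \<mu> (U \<inter> W n) \<le> emeasure \<mu> (D n)"
      using W(3)[of n] by (intro emeasure_mono compact_sets_mu W) blast
    also have "\<dots> < \<infinity>"
      by (rule emeasure_compact[OF W(4)])
    finally obtain B where "B \<in> sets baire" "B \<subseteq> U \<inter> W n" "emeasure \<mu> (U \<inter> W n - B) = 0"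
      using open_finite_baire_subset[OF open_Int[OF assms W(2)]] by blast
    then show ?thesis
      by (intro bexI[of _ B] conjI)
  qed
  then obtain B where B: "\<And>n. B n \<in> sets baire" "\<And>n. B n \<subseteq> U \<inter> W n" "\<And>n. emeasure \<mu> (U \<inter> W n - B n) = 0"
    by metis
  have "U \<inter> W n - B n \<in> null_sets \<mu>" for n
    using assms W(2)[of n] baire_sets_mu[OF B(1)[of n]] B(3) by (auto intro!: null_setsI simp: sets_mu)
  then have "AE x in \<mu>. \<forall>n. x \<notin> U \<inter> W n - B n"
    unfolding AE_all_countable by (intro allI AE_not_in)
  then have "AE x in \<mu>. x \<in> U \<longleftrightarrow> x \<in> (\<Union>n. B n)"
  proof (rule AE_mp, intro AE_I2 impI iffI)
    fix x assume x: "\<forall>n. x \<notin> U \<inter> W n - B n" "x \<in> U"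
    obtain n where "x \<in> W n"
      using W(5) by (metis UNIV_I UN_E)
    then show "x \<in> (\<Union>n. B n)"
      using x by blast
  qed (use B(2) in blast)
  moreover have "(\<Union>n. B n) \<in> sets baire"
    using B(1) by blast
  ultimately show ?thesis
    by (intro bexI)
qed

text \<open>The sets that agree almost everywhere with some Baire set form a \<sigma>-algebra, and
  the open sets belong to it.\<close>

lemma borel_AE_baire:
  assumes "A \<in> sets \<mu>"
  shows "\<exists>B\<in>sets baire. AE x in \<mu>. x \<in> A \<longleftrightarrow> x \<in> B"
proof -
  have "A \<in> sigma_sets UNIV {U :: 'g set. open U}"
    using assms by (simp add: sets_mu borel_def)
  then show ?thesis
  proof induction
    case (Basic U)
    then show ?case by (intro open_AE_baire) simp
  next
    case Empty
    show ?case by (intro bexI[of _ "{}"]) auto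
  next
    case (Compl A)
    then obtain B where B: "B \<in> sets baire" "AE x in \<mu>. x \<in> A \<longleftrightarrow> x \<in> B" by blast
    have "AE x in \<mu>. x \<in> UNIV - A \<longleftrightarrow> x \<in> UNIV - B"
      using B(2) by eventually_elim simp
    moreover have "UNIV - B \<in> sets baire"
      using sets.compl_sets[OF B(1)] by simp
    ultimately show ?case by (intro bexI)
  next
    case (Union A)
    then obtain B where B: "\<And>n. B n \<in> sets baire" "\<And>n. AE x in \<mu>. x \<in> A n \<longleftrightarrow> x \<in> B n"
      by metis
    have "AE x in \<mu>. \<forall>n. x \<in> A n \<longleftrightarrow> x \<in> B n"
      using B(2) by (simp add: AE_all_countable)
    then have "AE x in \<mu>. x \<in> (\<Union>n. A n) \<longleftrightarrow> x \<in> (\<Union>n. B n)"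
      by eventually_elim simp
    moreover have "(\<Union>n. B n) \<in> sets baire"
      using B(1) by blast
    ultimately show ?case by (intro bexI)
  qed
qed

lemma borel_measurable_AE_baire:
  fixes f :: "'g \<Rightarrow> ennreal"
  assumes "f \<in> borel_measurable \<mu>"
  obtains g where "g \<in> borel_measurable baire" "AE x in \<mu>. f x = g x"
proof -
  have "\<exists>g\<in>borel_measurable baire. AE x in \<mu>. f x = g x"
    using assms
  proof (induction rule: borel_measurable_induct)
    case (cong f g)
    then have "f = g" by auto
    then show ?case using cong by simp
  next
    case (set A)
    then obtain B where B: "B \<in> sets baire" "AE x in \<mu>. x \<in> A \<longleftrightarrow> x \<in> B"
      using borel_AE_baire by blast
    have "AE x in \<mu>. (indicator A x :: ennreal) = indicator B x"
      using B(2) by eventually_elim (simp add: indicator_def)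
    then show ?case
      using B(1) by (intro bexI[of _ "indicator B"]) auto
  next
    case (mult u c)
    then obtain g where g: "g \<in> borel_measurable baire" "AE x in \<mu>. u x = g x" by blast
    then show ?case
      by (intro bexI[of _ "\<lambda>x. c * g x"]) auto
  next
    case (add u v)
    then obtain g h where g: "g \<in> borel_measurable baire" "AE x in \<mu>. u x = g x"
       "h \<in> borel_measurable baire" "AE x in \<mu>. v x = h x" by blast
    then have "AE x in \<mu>. v x + u x = h x + g x"
      by auto
    then show ?case
      using g by (intro bexI[of _ "\<lambda>x. h x + g x"]) auto
  next
    case (seq U)
    then obtain g where g: "\<And>i. g i \<in> borel_measurable baire" "\<And>i. AE x in \<mu>. U i x = g i x"
      by metis
    have "AE x in \<mu>. \<forall>i. U i x = g i x"
      using g(2) by (simp add: AE_all_countable)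
    then have "AE x in \<mu>. (SUP i. U i) x = (SUP i. g i x)"
      by eventually_elim (simp add: image_comp)
    moreover have "(\<lambda>x. SUP i. g i x) \<in> borel_measurable baire"
      using g(1) by measurable
    ultimately show ?case by (intro bexI)
  qed
  then show thesis
    using that by blast
qed

section \<open>The modular function and inversion\<close>

lemma baire_neighbourhood:
  obtains E D :: "'g set" where "E \<in> sets baire" "open E" "0 \<in> E" "E \<subseteq> D" "compact D"
    "0 < emeasure \<mu> E" "emeasure \<mu> E < \<infinity>"
proof -
  obtain O' D where OD: "open O'" "{0} \<subseteq> O'" "O' \<subseteq> D" "compact (D :: 'g set)"
    using compact_subset_open_subset_compact[of "{0}"] by auto
  obtain E where E: "E \<in> sets baire" "open E" "{0} \<subseteq> E" "E \<subseteq> O'"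
    using baire_between[of "{0}" O'] OD by auto
  have "emeasure \<mu> E \<le> emeasure \<mu> D"
    using E OD by (intro emeasure_mono compact_sets_mu) auto
  also have "\<dots> < \<infinity>"
    using OD by (intro emeasure_compact)
  finally have "emeasure \<mu> E < \<infinity>" .
  moreover have "0 < emeasure \<mu> E"
    using E by (intro emeasure_open_pos) auto
  ultimately show thesis
    using E OD by (intro that[of E D]) auto
qed

text \<open>Both sides are the factor by which right translation by x and then by y scales the
  measure of one set; positive finite measure of that set allows cancellation.\<close>

lemma Delta_add: "\<Delta> (x + y) = \<Delta> x * \<Delta> y"
proof -
  obtain E D :: "'g set" where E: "E \<in> sets baire" "0 < emeasure \<mu> E" "emeasure \<mu> E < \<infinity>"
    using baire_neighbourhood by metis
  have Eb: "E \<in> sets borel"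
    using baire_sets_mu[OF E(1)] by (simp add: sets_mu)
  have 1: "(\<lambda>z. z + x) ` E \<in> sets borel"
  proof -
    have "(\<lambda>y. y - x) -` E \<inter> space \<mu> \<in> sets \<mu>"
      using Eb by (intro measurable_sets[OF measurable_translations(3)]) (simp add: sets_mu)
    then show ?thesis
      by (simp add: right_translation_image sets_mu)
  qed
  have "(\<lambda>z. z + y) ` (\<lambda>z. z + x) ` E = (\<lambda>z. z + (x + y)) ` E"
    by (simp add: image_image add.assoc)
  then have "ennreal (\<Delta> (x + y)) * emeasure \<mu> E = ennreal (\<Delta> y) * (ennreal (\<Delta> x) * emeasure \<mu> E)"
    using emeasure_right_image[OF Eb] emeasure_right_image[OF 1] by metis
  also have "\<dots> = ennreal (\<Delta> x * \<Delta> y) * emeasure \<mu> E"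
    using Delta_pos by (simp add: ennreal_mult less_imp_le mult_ac)
  finally show ?thesis
    using ennreal_mult_cancel_right_pos[of _ "emeasure \<mu> E"] E(2,3) Delta_pos[of x] Delta_pos[of y] Delta_pos[of "x + y"]
    by (metis ennreal_inj infinity_ennreal_def less_imp_le mult_pos_pos)
qed

lemma Delta_zero: "\<Delta> 0 = 1"
  using Delta_add[of 0 0] Delta_pos[of 0] by simp

lemma Delta_uminus: "\<Delta> x * \<Delta> (- x) = 1" "\<Delta> (- x) * \<Delta> x = 1"
  using Delta_add[of x "- x"] Delta_add[of "- x" x] Delta_zero by simp_all

lemma continuous_group_maps:
  shows "continuous_on UNIV (\<lambda>z :: 'g \<times> 'g. fst z + snd z)" "continuous_on UNIV (\<lambda>z :: 'g \<times> 'g. snd z + fst z)"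
    "continuous_on UNIV (\<lambda>z :: 'g \<times> 'g. - snd z + fst z)" "continuous_on UNIV (\<lambda>z :: 'g \<times> 'g. - fst z + snd z)"
    "continuous_on UNIV (\<lambda>z :: 'g \<times> 'g. fst z - snd z)" "continuous_on UNIV (\<lambda>z :: 'g \<times> 'g. snd z - fst z)"
    "continuous_on UNIV (\<lambda>z :: 'g. - z)"
  unfolding diff_conv_add_uminus
  by (intro continuous_intros continuous_on_uminus_group)+

lemmas baire_group_maps [measurable] =
  continuous_group_maps(1-6)[THEN continuous_imp_baire_pair_baire_measurable]
  continuous_group_maps(7)[THEN continuous_imp_baire_baire_measurable]

text \<open>\<open>modular_function\<close> states positivity and the scaling rule only, so
  measurability is extracted from the scaling rule: up to the constant factor
  \<open>emeasure \<mu> E\<close>, \<Delta>(x^-1) is a section integral of the product-measurable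
  function \<open>indicator E (y + x)\<close>.\<close>

lemma Delta_measurable_baire: "(\<lambda>x. ennreal (\<Delta> (- x))) \<in> borel_measurable baire"
proof -
  obtain E D :: "'g set" where E [measurable]: "E \<in> sets baire" and E': "0 < emeasure \<mu> E" "emeasure \<mu> E < \<infinity>"
    using baire_neighbourhood by metis
  have "(\<lambda>x. \<integral>\<^sup>+y. indicator E (y + x) \<partial>\<mu>) \<in> borel_measurable baire"
    by (rule baire_nn_integral_measurable) measurable
  also have "(\<lambda>x. \<integral>\<^sup>+y. indicator E (y + x) \<partial>\<mu>) = (\<lambda>x. ennreal (\<Delta> (- x)) * emeasure \<mu> E)"
    using baire_sets_mu[OF E] by (simp add: nn_integral_right)
  finally have "(\<lambda>x. ennreal (\<Delta> (- x)) * emeasure \<mu> E / emeasure \<mu> E) \<in> borel_measurable baire"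
    by measurable
  then show ?thesis
    using E' by (simp add: ennreal_mult_divide_eq)
qed

lemma Delta_measurable [measurable]: "(\<lambda>x. ennreal (\<Delta> (- x))) \<in> borel_measurable \<mu>"
  by (rule baire_measurable_mu[OF Delta_measurable_baire])

text \<open>Takes the place of continuity of \<Delta>: the right translates of \<open>E\<close> by
  inverses of points of \<open>D\<close> all lie in one compact set \<open>Q\<close>, so the factors
  scaling \<open>emeasure \<mu> E\<close> are at most the quotient of the two measures.\<close>

lemma Delta_bounded_on_compact:
  assumes "compact D"
  obtains R :: real where "0 < R" "\<And>x. x \<in> D \<Longrightarrow> \<Delta> (- x) \<le> R"
proof -
  obtain E D' :: "'g set" where E: "E \<in> sets baire" "open E" "0 \<in> E" "E \<subseteq> D'" "compact D'"
    "0 < emeasure \<mu> E" "emeasure \<mu> E < \<infinity>"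
    using baire_neighbourhood by metis
  define Q where "Q = set_sum D' (uminus ` D)"
  have Q: "compact Q"
    unfolding Q_def by (intro compact_set_sum compact_uminus E assms)
  have "\<Delta> (- x) \<le> measure \<mu> Q / measure \<mu> E" if "x \<in> D" for x
  proof -
    have "(\<lambda>y. y + - x) ` E \<subseteq> Q"
      unfolding Q_def by (intro image_subsetI set_sumI) (use E that in auto)
    then have "emeasure \<mu> ((\<lambda>y. y + - x) ` E) \<le> emeasure \<mu> Q"
      by (intro emeasure_mono compact_sets_mu Q)
    then have "ennreal (\<Delta> (- x)) * emeasure \<mu> E \<le> emeasure \<mu> Q"
      using emeasure_right_image[of E "- x"] baire_sets_mu[OF E(1)] by (simp add: sets_mu)
    then have "ennreal (\<Delta> (- x) * measure \<mu> E) \<le> ennreal (measure \<mu> Q)"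
      using E(7) emeasure_compact[OF Q] Delta_pos[of "- x"]
      by (simp add: emeasure_eq_ennreal_measure ennreal_mult less_imp_le top.not_eq_extremum)
    then have "\<Delta> (- x) * measure \<mu> E \<le> measure \<mu> Q"
      by simp
    moreover have "0 < measure \<mu> E"
      using E(6,7) by (simp add: measure_def enn2real_positive_iff)
    ultimately show ?thesis
      by (simp add: field_simps)
  qed
  \<comment> \<open>Adding 1 makes the bound strictly positive even when \<open>Q\<close> has
    measure zero, for instance for empty \<open>D\<close>.\<close>
  then show thesis
    by (intro that[of "measure \<mu> Q / measure \<mu> E + 1"])
       (auto intro: add_nonneg_pos intro!: divide_nonneg_nonneg order_trans[OF _ less_imp_le[OF less_add_one]])
qed

text \<open>The inversion formula d(x^-1) = \<Delta>(x^-1) dx. The double integral of 1_E(x) 1_F(yx)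
  is evaluated in both orders, with the substitution x to y^-1 x in between; the auxiliary set
  \<open>F\<close> has positive finite measure and is divided out at the end.\<close>

lemma emeasure_uminus_baire:
  assumes E [measurable]: "E \<in> sets baire"
  shows "emeasure \<mu> (uminus -` E) = (\<integral>\<^sup>+x. indicator E x * ennreal (\<Delta> (- x)) \<partial>\<mu>)"
proof -
  obtain F D :: "'g set" where F [measurable]: "F \<in> sets baire" and F': "0 < emeasure \<mu> F" "emeasure \<mu> F < \<infinity>"
    using baire_neighbourhood by metis
  note [measurable] = baire_sets_mu[OF E] baire_sets_mu[OF F]
  have uE: "uminus -` E \<in> sets \<mu>"
    using measurable_sets[OF measurable_translations(4) baire_sets_mu[OF E]] by simp
  have "(\<integral>\<^sup>+x. indicator E x * ennreal (\<Delta> (- x)) \<partial>\<mu>) * emeasure \<mu> F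
      = (\<integral>\<^sup>+x. indicator E x * ennreal (\<Delta> (- x)) * emeasure \<mu> F \<partial>\<mu>)"
    by (rule nn_integral_multc[symmetric]) measurable
  also have "\<dots> = (\<integral>\<^sup>+x. indicator E x * (\<integral>\<^sup>+y. indicator F (y + x) \<partial>\<mu>) \<partial>\<mu>)"
    by (simp add: nn_integral_right mult.assoc)
  also have "\<dots> = (\<integral>\<^sup>+x. \<integral>\<^sup>+y. indicator E x * indicator F (y + x) \<partial>\<mu> \<partial>\<mu>)"
  proof (intro nn_integral_cong nn_integral_cmult[symmetric])
    fix x
    show "(\<lambda>y. indicator F (y + x) :: ennreal) \<in> borel_measurable \<mu>"
      by (rule measurable_compose[OF measurable_translations(2)]) measurable
  qed
  also have "\<dots> = (\<integral>\<^sup>+y. \<integral>\<^sup>+x. indicator E x * indicator F (y + x) \<partial>\<mu> \<partial>\<mu>)"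
    by (rule baire_Fubini) measurable
  also have "\<dots> = (\<integral>\<^sup>+y. \<integral>\<^sup>+x. indicator E (- y + x) * indicator F x \<partial>\<mu> \<partial>\<mu>)"
  proof (rule nn_integral_cong)
    fix y
    have "(\<lambda>x. indicator E x * indicator F (y + x) :: ennreal) \<in> borel_measurable \<mu>"
      by (intro borel_measurable_times_ennreal measurable_compose[OF measurable_translations(1)]) measurable
    from nn_integral_left[OF this, of "- y"]
    show "(\<integral>\<^sup>+x. indicator E x * indicator F (y + x) \<partial>\<mu>) = (\<integral>\<^sup>+x. indicator E (- y + x) * indicator F x \<partial>\<mu> :: ennreal)"
      by (simp add: add.assoc[symmetric])
  qed
  also have "\<dots> = (\<integral>\<^sup>+x. \<integral>\<^sup>+y. indicator E (- y + x) * indicator F x \<partial>\<mu> \<partial>\<mu>)"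
    by (rule baire_Fubini) measurable
  also have "\<dots> = (\<integral>\<^sup>+x. emeasure \<mu> (uminus -` E) * indicator F x \<partial>\<mu>)"
  proof (rule nn_integral_cong)
    fix x
    have 1: "(\<lambda>y. indicator E (- y + x) :: ennreal) \<in> borel_measurable \<mu>"
      by (rule measurable_compose[OF measurable_translations(6)]) measurable
    have "(\<integral>\<^sup>+y. indicator E (- y + x) * indicator F x \<partial>\<mu> :: ennreal) = (\<integral>\<^sup>+y. indicator E (- y + x) \<partial>\<mu>) * indicator F x"
      using 1 by (rule nn_integral_multc)
    also have "(\<integral>\<^sup>+y. indicator E (- y + x) \<partial>\<mu> :: ennreal) = (\<integral>\<^sup>+y. indicator E (- y) \<partial>\<mu>)"
      using nn_integral_left[OF 1, of x] by (simp add: minus_add add.assoc)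
    also have "\<dots> = (\<integral>\<^sup>+y. indicator (uminus -` E) y \<partial>\<mu>)"
      by (intro nn_integral_cong) (simp add: indicator_def)
    also have "\<dots> = emeasure \<mu> (uminus -` E)"
      using uE by simp
    finally show "(\<integral>\<^sup>+y. indicator E (- y + x) * indicator F x \<partial>\<mu>) = emeasure \<mu> (uminus -` E) * indicator F x" .
  qed
  also have "\<dots> = emeasure \<mu> (uminus -` E) * emeasure \<mu> F"
    by (simp add: nn_integral_cmult)
  finally show ?thesis
    using ennreal_mult_cancel_right_pos[of _ "emeasure \<mu> F"] F' by (simp only: infinity_ennreal_def)
qed

text \<open>A Borel null set need not lie in a Baire null set a priori, so it is enclosed in an open set
  of small measure whose inverse is exhausted from inside by Baire sets.\<close>

lemma null_set_uminus_bounded: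
  assumes N: "N \<in> sets \<mu>" "emeasure \<mu> N = 0" "N \<subseteq> W" and W: "open W" "W \<subseteq> D" "compact D"
  shows "emeasure \<mu> (uminus -` N) = 0"
proof -
  obtain R where R: "0 < R" "\<And>x. x \<in> D \<Longrightarrow> \<Delta> (- x) \<le> R"
    using Delta_bounded_on_compact[OF W(3)] by blast
  have "emeasure \<mu> (uminus -` N) \<le> ennreal e" if e: "0 < e" for e
  proof -
    \<comment> \<open>Inside \<open>D\<close> inversion enlarges measures by at most the factor
      \<open>R\<close>, so the tolerance \<open>e / R\<close> for a neighbourhood of
      \<open>N\<close> becomes \<open>e\<close> for its inverse.\<close>
    have "(INF U\<in>{U. open U \<and> N \<subseteq> U}. emeasure \<mu> U) < ennreal (e / R)"
      using outer_regular[of N] N e R(1) by (simp add: sets_mu)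
    then obtain U0 where U0: "open U0" "N \<subseteq> U0" "emeasure \<mu> U0 < ennreal (e / R)"
      unfolding INF_less_iff by auto
    define U where "U = U0 \<inter> W"
    have U: "open U" "N \<subseteq> U" "U \<subseteq> D"
      using U0 W N by (auto simp: U_def)
    have "emeasure \<mu> U \<le> emeasure \<mu> U0"
      using U0 by (intro emeasure_mono) (auto simp: U_def sets_mu)
    then have Ue: "emeasure \<mu> U \<le> ennreal (e / R)"
      using U0 by simp
    have oU: "open (uminus -` U)"
      using U(1) continuous_group_maps(7) by (rule open_vimage)
    have "emeasure \<mu> K \<le> ennreal e" if K: "compact K" "K \<subseteq> uminus -` U" for K
    proof -
      obtain B where B: "B \<in> sets baire" "open B" "K \<subseteq> B" "B \<subseteq> uminus -` U"
        by (rule baire_between[OF K(1) oU K(2)])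
      have E: "uminus -` B \<in> sets baire"
        using measurable_sets[OF baire_group_maps(7) B(1)] by simp
      have EU: "uminus -` B \<subseteq> U"
        using B(4) by (metis minus_minus subset_iff vimage_eq)
      have "emeasure \<mu> K \<le> emeasure \<mu> B"
        using B by (intro emeasure_mono baire_sets_mu)
      also have "B = uminus -` (uminus -` B)"
        by auto
      also have "emeasure \<mu> \<dots> = (\<integral>\<^sup>+x. indicator (uminus -` B) x * ennreal (\<Delta> (- x)) \<partial>\<mu>)"
        by (rule emeasure_uminus_baire[OF E])
      also have "\<dots> \<le> (\<integral>\<^sup>+x. ennreal R * indicator U x \<partial>\<mu>)"
        using R(2) EU U(3) by (intro nn_integral_mono) (auto simp: indicator_def intro!: ennreal_leI)
      also have "\<dots> = ennreal R * emeasure \<mu> U"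
        using U(1) by (intro nn_integral_cmult_indicator) (simp add: sets_mu)
      also have "\<dots> \<le> ennreal R * ennreal (e / R)"
        by (intro mult_left_mono Ue) simp
      also have "\<dots> = ennreal e"
        using R(1) e by (simp add: ennreal_mult[symmetric])
      finally show ?thesis .
    qed
    then have "emeasure \<mu> (uminus -` U) \<le> ennreal e"
      unfolding inner_regular_open[OF oU] by (intro SUP_least) simp
    moreover have "emeasure \<mu> (uminus -` N) \<le> emeasure \<mu> (uminus -` U)"
      using U(2) oU by (intro emeasure_mono) (auto simp: sets_mu)
    ultimately show ?thesis
      by (rule order_trans[rotated])
  qed
  then show ?thesis
    using ennreal_le_epsilon[of 0 "emeasure \<mu> (uminus -` N)"] by simp
qed

text \<open>Inversion rescales measure by the modular function, for which a bound is at hand on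
  compact sets only. The exceptional set is therefore cut along an exhaustion and its pieces are
  inverted separately.\<close>

lemma AE_uminus:
  assumes "AE y in \<mu>. Q y"
  shows "AE y in \<mu>. Q (- y)"
proof -
  obtain N where N: "{y. \<not> Q y} \<subseteq> N" "N \<in> sets \<mu>" "emeasure \<mu> N = 0"
    using assms by (auto elim: AE_E)
  obtain W D :: "nat \<Rightarrow> 'g set"
  where W: "\<And>n. W n \<in> sets baire" "\<And>n. open (W n)" "\<And>n. W n \<subseteq> D n" "\<And>n. compact (D n)"
    "(\<Union>n. W n) = UNIV"
    using baire_exhaustion by blast
  have Ws: "N \<inter> W n \<in> sets \<mu>" for n
    using N(2) W(2) by (auto simp: sets_mu)
  have "emeasure \<mu> (N \<inter> W n) = 0" for n
    using emeasure_mono[of "N \<inter> W n" N \<mu>] N by simp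
  then have "emeasure \<mu> (uminus -` (N \<inter> W n)) = 0" for n
    by (rule null_set_uminus_bounded[OF Ws _ _ W(2) W(3) W(4)]) blast
  moreover have "uminus -` (N \<inter> W n) \<in> sets \<mu>" for n
    using measurable_sets[OF measurable_translations(4) Ws] by simp
  ultimately have "uminus -` (N \<inter> W n) \<in> null_sets \<mu>" for n
    by (intro null_setsI)
  then have "AE y in \<mu>. \<forall>n. y \<notin> uminus -` (N \<inter> W n)"
    unfolding AE_all_countable by (intro allI AE_not_in)
  then show ?thesis
  proof (rule AE_mp, intro AE_I2 impI)
    fix y assume y: "\<forall>n. y \<notin> uminus -` (N \<inter> W n)"
    obtain n where "- y \<in> W n"
      using W(5) by (metis UNIV_I UN_E)
    then show "Q (- y)"
      using y N(1) by blast
  qed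
qed

section \<open>Null sets under the group maps and Tonelli's theorem for convolutions\<close>

lemma AE_uminus_add:
  assumes "AE y in \<mu>. Q y"
  shows "AE y in \<mu>. Q (- y + x)"
  by (rule AE_uminus[OF AE_right[OF assms]])

lemma AE_diff:
  assumes "AE y in \<mu>. Q y"
  shows "AE y in \<mu>. Q (x - y)"
  using AE_uminus[OF AE_left[OF assms, of x]] by simp

lemma AE_diff_right:
  assumes "AE y in \<mu>. Q y"
  shows "AE y in \<mu>. Q (y - x)"
  using AE_right[OF assms, of "- x"] by simp

text \<open>The functions \<open>a\<close>, \<open>b\<close>, \<open>k\<close> are exchanged for
  Baire functions. By \<open>T1\<close> and \<open>T2\<close> null sets have null preimages under
  both partial maps of \<open>T\<close>, so for every fixed value of one variable the exchange of
  \<open>k\<close> is invisible to the integral over the other. This is why null sets of the product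
  never have to be discussed.\<close>

lemma convolution_swap:
  fixes a b k :: "'g \<Rightarrow> ennreal" and T :: "'g \<Rightarrow> 'g \<Rightarrow> 'g"
  assumes a: "a \<in> borel_measurable \<mu>" and b: "b \<in> borel_measurable \<mu>" and k: "k \<in> borel_measurable \<mu>"
    and T: "continuous_on UNIV (\<lambda>z. T (fst z) (snd z))"
    and T1: "\<And>Q x. (AE y in \<mu>. Q y) \<Longrightarrow> (AE y in \<mu>. Q (T x y))"
    and T2: "\<And>Q y. (AE x in \<mu>. Q x) \<Longrightarrow> (AE x in \<mu>. Q (T x y))"
  shows "(\<lambda>x. \<integral>\<^sup>+y. b y * k (T x y) \<partial>\<mu>) \<in> borel_measurable \<mu>" (is ?M)
    and "(\<integral>\<^sup>+x. a x * (\<integral>\<^sup>+y. b y * k (T x y) \<partial>\<mu>) \<partial>\<mu>) = (\<integral>\<^sup>+y. b y * (\<integral>\<^sup>+x. a x * k (T x y) \<partial>\<mu>) \<partial>\<mu>)" (is ?E)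
proof -
  obtain a' where a' [measurable]: "a' \<in> borel_measurable baire" and aa': "AE x in \<mu>. a x = a' x"
    using borel_measurable_AE_baire[OF a] by blast
  obtain b' where b' [measurable]: "b' \<in> borel_measurable baire" and bb': "AE x in \<mu>. b x = b' x"
    using borel_measurable_AE_baire[OF b] by blast
  obtain k' where k' [measurable]: "k' \<in> borel_measurable baire" and kk': "AE x in \<mu>. k x = k' x"
    using borel_measurable_AE_baire[OF k] by blast
  note [measurable] = continuous_imp_baire_pair_baire_measurable[OF T]
  have Ts [measurable]: "(\<lambda>z. T (snd z) (fst z)) \<in> measurable (baire \<Otimes>\<^sub>M baire) baire"
    using measurable_compose[OF measurable_pair_swap' continuous_imp_baire_pair_baire_measurable[OF T]]
    by (simp add: case_prod_unfold)
  have 1: "(\<integral>\<^sup>+y. b y * k (T x y) \<partial>\<mu>) = (\<integral>\<^sup>+y. b' y * k' (T x y) \<partial>\<mu>)" for x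
    using bb' T1[OF kk', of x] by (intro nn_integral_cong_AE) auto
  have 2: "(\<integral>\<^sup>+x. a x * k (T x y) \<partial>\<mu>) = (\<integral>\<^sup>+x. a' x * k' (T x y) \<partial>\<mu>)" for y
    using aa' T2[OF kk', of y] by (intro nn_integral_cong_AE) auto
  have "(\<lambda>x. \<integral>\<^sup>+y. b' y * k' (T x y) \<partial>\<mu>) \<in> borel_measurable baire"
    by (rule baire_nn_integral_measurable) measurable
  then show ?M
    unfolding 1 by (rule baire_measurable_mu)
  have Tx: "(\<lambda>y. T x y) \<in> measurable baire baire" for x
    using measurable_compose[OF measurable_Pair1' continuous_imp_baire_pair_baire_measurable[OF T], of x] by simp
  have Ty: "(\<lambda>x. T x y) \<in> measurable baire baire" for y
    using measurable_compose[OF measurable_Pair1' Ts, of y] by simp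
  have "(\<integral>\<^sup>+x. a x * (\<integral>\<^sup>+y. b y * k (T x y) \<partial>\<mu>) \<partial>\<mu>) = (\<integral>\<^sup>+x. a' x * (\<integral>\<^sup>+y. b' y * k' (T x y) \<partial>\<mu>) \<partial>\<mu>)"
    unfolding 1 using aa' by (intro nn_integral_cong_AE) auto
  also have "\<dots> = (\<integral>\<^sup>+x. \<integral>\<^sup>+y. a' x * (b' y * k' (T x y)) \<partial>\<mu> \<partial>\<mu>)"
    by (intro nn_integral_cong nn_integral_cmult[symmetric] baire_measurable_mu
        borel_measurable_times_ennreal b' measurable_compose[OF Tx k'])
  also have "\<dots> = (\<integral>\<^sup>+y. \<integral>\<^sup>+x. a' x * (b' y * k' (T x y)) \<partial>\<mu> \<partial>\<mu>)"
    by (rule baire_Fubini) measurable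
  also have "\<dots> = (\<integral>\<^sup>+y. \<integral>\<^sup>+x. b' y * (a' x * k' (T x y)) \<partial>\<mu> \<partial>\<mu>)"
    by (simp add: mult_ac)
  also have "\<dots> = (\<integral>\<^sup>+y. b' y * (\<integral>\<^sup>+x. a' x * k' (T x y) \<partial>\<mu>) \<partial>\<mu>)"
    by (intro nn_integral_cong nn_integral_cmult baire_measurable_mu
        borel_measurable_times_ennreal a' measurable_compose[OF Ty k'])
  also have "\<dots> = (\<integral>\<^sup>+y. b y * (\<integral>\<^sup>+x. a x * k (T x y) \<partial>\<mu>) \<partial>\<mu>)"
    unfolding 2 using bb' by (intro nn_integral_cong_AE) auto
  finally show ?E .
qed

end

section \<open>Wiener amalgam estimates\<close>

text \<open>Makes usable the infimum by which \<open>locmax\<close> and \<open>locmaxR\<close>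
  encode an essential supremum: an infimum in \<open>ennreal\<close> is that of a sequence, so
  countably many null sets suffice.\<close>

lemma AE_le_Inf_AE_bounds:
  fixes h :: "'a \<Rightarrow> ennreal"
  shows "AE y in M. y \<in> V \<longrightarrow> h y \<le> Inf {z. AE y in M. y \<in> V \<longrightarrow> h y \<le> z}"
proof -
  let ?Z = "{z. AE y in M. y \<in> V \<longrightarrow> h y \<le> z}"
  have "top \<in> ?Z" by simp
  then have "?Z \<noteq> {}" by blast
  from ennreal_Inf_countable_INF[OF this]
  obtain f :: "nat \<Rightarrow> ennreal" where f: "range f \<subseteq> ?Z" "Inf ?Z = (INF i. f i)"
    by blast
  have "AE y in M. y \<in> V \<longrightarrow> h y \<le> f i" for i
    using f(1) by auto
  then have "AE y in M. \<forall>i. y \<in> V \<longrightarrow> h y \<le> f i"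
    unfolding AE_all_countable by (rule allI)
  then show ?thesis
    unfolding f(2) by eventually_elim (auto intro: INF_greatest)
qed

context haar_group
begin

lemma measurable_compose_translations:
  assumes "f \<in> borel_measurable \<mu>"
  shows "(\<lambda>y. f (x + y)) \<in> borel_measurable \<mu>" "(\<lambda>y. f (y + x)) \<in> borel_measurable \<mu>"
    "(\<lambda>y. f (y - x)) \<in> borel_measurable \<mu>" "(\<lambda>y. f (- y)) \<in> borel_measurable \<mu>"
    "(\<lambda>y. f (x - y)) \<in> borel_measurable \<mu>" "(\<lambda>y. f (- y + x)) \<in> borel_measurable \<mu>"
  by (intro measurable_compose[OF measurable_translations(1) assms]
      measurable_compose[OF measurable_translations(2) assms]
      measurable_compose[OF measurable_translations(3) assms]
      measurable_compose[OF measurable_translations(4) assms]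
      measurable_compose[OF measurable_translations(5) assms]
      measurable_compose[OF measurable_translations(6) assms])+

lemma integral_left:
  fixes f :: "'g \<Rightarrow> real"
  assumes "f \<in> borel_measurable \<mu>"
  shows "(\<integral>y. f (x + y) \<partial>\<mu>) = (\<integral>y. f y \<partial>\<mu>)"
  using integral_distr[OF measurable_translations(1) assms, of x] by (simp add: distr_left)

text \<open>Integration over the part of a compact set where \<open>f\<close> exceeds
  \<open>h\<close> contradicts the hypothesis unless that part is null. The strict comparison
  requires a finite integral of \<open>h\<close>, which the bound \<open>T\<close> and compactness
  provide.\<close>

lemma AE_le_if_nn_integral_le:
  fixes f h :: "'g \<Rightarrow> ennreal"
  assumes [measurable]: "f \<in> borel_measurable \<mu>" "h \<in> borel_measurable \<mu>"
    and le: "\<And>A. A \<in> sets \<mu> \<Longrightarrow> (\<integral>\<^sup>+x. indicator A x * f x \<partial>\<mu>) \<le> (\<integral>\<^sup>+x. indicator A x * h x \<partial>\<mu>)"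
    and bound: "\<And>x. h x \<le> T" "T < \<infinity>"
  shows "AE x in \<mu>. f x \<le> h x"
proof -
  obtain C :: "nat \<Rightarrow> 'g set" where C: "\<And>n. compact (C n)" "incseq C" "(\<Union>n. C n) = UNIV"
    using compact_exhaustion by blast
  define A where "A n = C n \<inter> {x. h x < f x}" for n
  have Cs [measurable]: "C n \<in> sets \<mu>" for n
    by (rule compact_sets_mu[OF C(1)])
  have "{x \<in> space \<mu>. h x < f x} \<in> sets \<mu>"
    by measurable
  then have As [measurable]: "A n \<in> sets \<mu>" for n
    unfolding A_def using Cs[of n] by auto
  have "AE x in \<mu>. indicator (A n) x * f x \<le> indicator (A n) x * h x" for n
  proof (rule ccontr)
    assume n: "\<not> (AE x in \<mu>. indicator (A n) x * f x \<le> indicator (A n) x * h x)"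
    have "(\<integral>\<^sup>+x. indicator (A n) x * h x \<partial>\<mu>) \<le> (\<integral>\<^sup>+x. T * indicator (C n) x \<partial>\<mu>)"
      using bound(1) by (intro nn_integral_mono) (auto simp: indicator_def A_def)
    also have "\<dots> = T * emeasure \<mu> (C n)"
      by (intro nn_integral_cmult_indicator Cs)
    also have "\<dots> < \<infinity>"
      using bound(2) emeasure_compact[OF C(1), of n] by (simp add: ennreal_mult_less_top)
    finally have "(\<integral>\<^sup>+x. indicator (A n) x * h x \<partial>\<mu>) \<noteq> \<infinity>"
      by simp
    moreover have "AE x in \<mu>. indicator (A n) x * h x \<le> indicator (A n) x * f x"
      by (intro AE_I2) (auto simp: indicator_def A_def)
    ultimately have "(\<integral>\<^sup>+x. indicator (A n) x * h x \<partial>\<mu>) < (\<integral>\<^sup>+x. indicator (A n) x * f x \<partial>\<mu>)"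
      using n by (intro nn_integral_less) auto
    with le[OF As[of n]] show False
      by (simp add: not_less[symmetric])
  qed
  then have "AE x in \<mu>. \<forall>n. indicator (A n) x * f x \<le> indicator (A n) x * h x"
    by (simp add: AE_all_countable)
  then show ?thesis
  proof (rule AE_mp, intro AE_I2 impI)
    fix x assume *: "\<forall>n. indicator (A n) x * f x \<le> indicator (A n) x * h x"
    obtain n where "x \<in> C n"
      using C(3) by (metis UNIV_I UN_E)
    with spec[OF *, of n] show "f x \<le> h x"
      by (cases "h x < f x") (auto simp: indicator_def A_def)
  qed
qed

text \<open>Continuity from above of the finite measure with density \<open>h\<close>, along the
  complements of a compact exhaustion.\<close>

lemma nn_integral_tail_small:
  assumes h [measurable]: "h \<in> borel_measurable \<mu>" and fin: "(\<integral>\<^sup>+x. h x \<partial>\<mu>) < \<infinity>" and "0 < (\<delta>::ennreal)"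
  obtains Q where "compact Q" "(\<integral>\<^sup>+x. indicator (- Q) x * h x \<partial>\<mu>) < \<delta>"
proof -
  obtain C :: "nat \<Rightarrow> 'g set" where C: "\<And>n. compact (C n)" "incseq C" "(\<Union>n. C n) = UNIV"
    using compact_exhaustion by blast
  let ?M = "density \<mu> h"
  have Cs: "- C n \<in> sets \<mu>" for n
    using sets.compl_sets[OF compact_sets_mu[OF C(1)]] by (simp add: Compl_eq_Diff_UNIV)
  have eq: "emeasure ?M (- C n) = (\<integral>\<^sup>+x. indicator (- C n) x * h x \<partial>\<mu>)" for n
    using Cs[of n] by (simp add: emeasure_density mult.commute)
  have "(INF n. emeasure ?M (- C n)) = emeasure ?M (\<Inter>n. - C n)"
  proof (rule INF_emeasure_decseq)
    show "range (\<lambda>n. - C n) \<subseteq> sets ?M" using Cs by auto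
    show "decseq (\<lambda>n. - C n)" using C(2) by (auto simp: decseq_def incseq_def)
    show "emeasure ?M (- C n) \<noteq> \<infinity>" for n
    proof -
      have "emeasure ?M (- C n) \<le> (\<integral>\<^sup>+x. h x \<partial>\<mu>)"
        unfolding eq by (intro nn_integral_mono) (auto simp: indicator_def)
      then show ?thesis using fin by (auto simp: top_unique)
    qed
  qed
  also have "(\<Inter>n. - C n) = {}"
    using C(3) by auto
  finally have "(INF n. emeasure ?M (- C n)) < \<delta>"
    using assms(3) by simp
  then obtain n where "emeasure ?M (- C n) < \<delta>"
    unfolding INF_less_iff by auto
  then show thesis
    using that[OF C(1)] unfolding eq by blast
qed

end

section \<open>The weight and averages over the neighbourhood V\<close>

locale weighted_haar_group = haar_group \<mu> \<Delta>
  for \<mu> :: "'g::{topological_group_add,t2_space} measure" and \<Delta> :: "'g \<Rightarrow> real" +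
  fixes w :: "'g \<Rightarrow> real" and V :: "'g set"
  assumes weight: "admissible_weight \<mu> \<Delta> w"
    and V_borel: "V \<in> sets borel" and V_uminus: "uminus ` V = V"
    and V_compact: "compact (closure V)" and V_nhd: "0 \<in> interior V"
begin

lemma V_sets [measurable]: "V \<in> sets \<mu>"
  using V_borel by (simp add: sets_mu)

lemma uminus_V_iff: "- x \<in> V \<longleftrightarrow> x \<in> V"
  using V_uminus by (metis image_eqI minus_minus)

lemma V_pos: "0 < emeasure \<mu> V"
proof -
  have "0 < emeasure \<mu> (interior V)"
    using V_nhd by (intro emeasure_open_pos) auto
  also have "\<dots> \<le> emeasure \<mu> V"
    by (intro emeasure_mono interior_subset V_sets)
  finally show ?thesis .
qed

lemma V_finite: "emeasure \<mu> V < \<infinity>"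
proof -
  have "emeasure \<mu> V \<le> emeasure \<mu> (closure V)"
    by (intro emeasure_mono closure_subset compact_sets_mu V_compact)
  also have "\<dots> < \<infinity>"
    by (rule emeasure_compact[OF V_compact])
  finally show ?thesis .
qed

lemma L2norm_left_transl:
  assumes "f \<in> L2 \<mu>"
  shows "L2norm \<mu> (left_transl x f) = L2norm \<mu> f"
proof -
  have "(\<lambda>y. (cmod (f y))\<^sup>2) \<in> borel_measurable \<mu>"
    using assms by (auto simp: L2_def)
  from integral_left[OF this, of "- x"] show ?thesis
    by (simp add: L2norm_def left_transl_def)
qed

lemma L2opnorm_left_transl_ge_1: "1 \<le> L2opnorm \<mu> (left_transl x)"
proof -
  have mV: "0 < measure \<mu> V"
    using V_pos V_finite by (simp add: measure_def enn2real_positive_iff)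
  define f where "f = (\<lambda>y. complex_of_real (indicator V y / sqrt (measure \<mu> V)))"
  have sq: "(cmod (f y))\<^sup>2 = indicator V y / measure \<mu> V" for y
    using mV by (simp add: f_def norm_divide power_divide indicator_def)
  have fm: "f \<in> borel_measurable \<mu>"
    unfolding f_def by measurable
  have int: "integrable \<mu> (\<lambda>y. (cmod (f y))\<^sup>2)"
    unfolding sq using V_finite by (intro integrable_divide integrable_real_indicator) auto
  have f: "f \<in> L2 \<mu>"
    using fm int by (simp add: L2_def)
  have n: "L2norm \<mu> f = 1"
    unfolding L2norm_def sq using mV by simp
  have "L2norm \<mu> (left_transl x f) \<le> (SUP f\<in>{f \<in> L2 \<mu>. L2norm \<mu> f \<le> 1}. L2norm \<mu> (left_transl x f))"
  proof (rule cSUP_upper)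
    show "f \<in> {f \<in> L2 \<mu>. L2norm \<mu> f \<le> 1}" using f n by simp
    \<comment> \<open>A real \<open>SUP\<close> is an upper bound only for a bounded family; the
      isometry property of left translation supplies the bound 1.\<close>
    show "bdd_above ((\<lambda>f. L2norm \<mu> (left_transl x f)) ` {f \<in> L2 \<mu>. L2norm \<mu> f \<le> 1})"
      by (rule bdd_aboveI[of _ 1]) (auto simp: L2norm_left_transl)
  qed
  then show ?thesis
    unfolding L2opnorm_def using L2norm_left_transl[OF f, of x] n by simp
qed

text \<open>The first bound comes from the operator norm u, which is at least 1, the second from the
  symmetry w(x) = \<Delta>(x^-1) w(x^-1). Together they turn integrability against w into
  integrability for left Haar measure dx and for right Haar measure \<Delta>(x^-1) dx.\<close>

lemma weight_lower_bound:
  obtains c where "0 < c" "\<And>x. c \<le> w x" "\<And>x. c * \<Delta> (- x) \<le> w x"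
proof -
  obtain C where C: "0 < C" "\<And>x. C * Max {L2opnorm \<mu> (left_transl x), L2opnorm \<mu> (left_transl (- x)),
      \<Delta> (- x) * L2opnorm \<mu> (right_transl (- x)), \<Delta> (- x) * (\<Delta> (- (- x)) * L2opnorm \<mu> (right_transl (- (- x))))} \<le> w x"
    using weight unfolding admissible_weight_def Let_def by blast
  have sym: "w x = \<Delta> (- x) * w (- x)" for x
    using weight unfolding admissible_weight_def by blast
  have 1: "C \<le> w x" for x
  proof -
    have "1 \<le> Max {L2opnorm \<mu> (left_transl x), L2opnorm \<mu> (left_transl (- x)),
      \<Delta> (- x) * L2opnorm \<mu> (right_transl (- x)), \<Delta> (- x) * (\<Delta> (- (- x)) * L2opnorm \<mu> (right_transl (- (- x))))}"
      by (rule order_trans[OF L2opnorm_left_transl_ge_1[of x] Max_ge]) auto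
    then have "C * 1 \<le> C * Max {L2opnorm \<mu> (left_transl x), L2opnorm \<mu> (left_transl (- x)),
      \<Delta> (- x) * L2opnorm \<mu> (right_transl (- x)), \<Delta> (- x) * (\<Delta> (- (- x)) * L2opnorm \<mu> (right_transl (- (- x))))}"
      using C(1) by (intro mult_left_mono) auto
    then show ?thesis
      using C(2)[of x] by linarith
  qed
  have "C * \<Delta> (- x) \<le> w x" for x
    using sym[of x] mult_left_mono[OF 1[of "- x"] less_imp_le[OF Delta_pos[of "- x"]]] by (simp add: mult.commute)
  with C(1) 1 show thesis
    by (rule that)
qed

text \<open>The right Haar measure of V, normalized as \<Delta>(s^-1) ds.\<close>

definition \<kappa> :: ennreal where "\<kappa> = (\<integral>\<^sup>+s. ennreal (\<Delta> (- s)) * indicator V s \<partial>\<mu>)"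

lemma kappa_pos: "0 < \<kappa>"
proof (rule ccontr)
  assume "\<not> 0 < \<kappa>"
  then have "\<kappa> = 0" by simp
  then have "AE s in \<mu>. ennreal (\<Delta> (- s)) * indicator V s = 0"
    unfolding \<kappa>_def by (subst (asm) nn_integral_0_iff_AE) auto
  then have "AE s in \<mu>. s \<notin> V"
  proof eventually_elim
    case (elim s)
    then show ?case
      using Delta_pos[of "- s"] by (auto simp: indicator_def ennreal_eq_0_iff split: if_splits)
  qed
  then have "emeasure \<mu> V = 0"
    using AE_iff_measurable[of V \<mu> "\<lambda>s. s \<notin> V"] by auto
  then show False
    using V_pos by simp
qed

lemma kappa_finite: "\<kappa> < \<infinity>"
proof -
  obtain R where R: "0 < R" "\<And>x. x \<in> closure V \<Longrightarrow> \<Delta> (- x) \<le> R"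
    using Delta_bounded_on_compact[OF V_compact] by blast
  have "\<kappa> \<le> (\<integral>\<^sup>+s. ennreal R * indicator V s \<partial>\<mu>)"
    unfolding \<kappa>_def using R(2) closure_subset[of V]
    by (intro nn_integral_mono) (auto simp: indicator_def intro!: ennreal_leI)
  also have "\<dots> = ennreal R * emeasure \<mu> V"
    by (intro nn_integral_cmult_indicator V_sets)
  also have "\<dots> < \<infinity>"
    using V_finite by (simp add: ennreal_mult_less_top)
  finally show ?thesis .
qed

text \<open>Right invariance of \<Delta>(s^-1) ds: replacing s by sz turns z s^-1 into s^-1, and V
  is symmetric.\<close>

lemma kappa_translate: "(\<integral>\<^sup>+s. ennreal (\<Delta> (- s)) * indicator V (z - s) \<partial>\<mu>) = \<kappa>"
proof -
  have m: "(\<lambda>s. ennreal (\<Delta> (- s)) * indicator V (z - s)) \<in> borel_measurable \<mu>"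
    by (intro borel_measurable_times_ennreal Delta_measurable measurable_compose_translations) measurable
  have pt: "ennreal (\<Delta> (- (s + z))) * indicator V (z - (s + z)) = ennreal (\<Delta> (- z)) * (ennreal (\<Delta> (- s)) * indicator V s)" for s
  proof -
    have "\<Delta> (- (s + z)) = \<Delta> (- z) * \<Delta> (- s)"
      unfolding minus_add by (rule Delta_add)
    moreover have "z - (s + z) = - s"
      by (simp add: diff_conv_add_uminus minus_add add.assoc[symmetric] del: add_uminus_conv_diff)
    moreover have "indicator V (- s) = (indicator V s :: ennreal)"
      by (simp add: indicator_def uminus_V_iff)
    ultimately show ?thesis
      by (simp add: ennreal_mult Delta_pos less_imp_le mult.assoc)
  qed
  have "ennreal (\<Delta> (- z)) * (\<integral>\<^sup>+s. ennreal (\<Delta> (- s)) * indicator V (z - s) \<partial>\<mu>) = ennreal (\<Delta> (- z)) * \<kappa>"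
    unfolding nn_integral_right[OF m, symmetric] pt \<kappa>_def
    by (intro nn_integral_cmult) measurable
  then have "(\<integral>\<^sup>+s. ennreal (\<Delta> (- s)) * indicator V (z - s) \<partial>\<mu>) * ennreal (\<Delta> (- z)) = \<kappa> * ennreal (\<Delta> (- z))"
    by (simp only: mult.commute)
  then show ?thesis
    by (rule ennreal_mult_cancel_right_pos) (auto simp: Delta_pos)
qed

text \<open>The integral of \<open>G\<close> over the translate Vz for right Haar measure. Unlike an
  almost-everywhere bound it has a definite value at every z, and its sum over translates by
  \<gamma> can be computed under the integral.\<close>

definition smear :: "('g \<Rightarrow> ennreal) \<Rightarrow> 'g \<Rightarrow> ennreal" where
  "smear G z = (\<integral>\<^sup>+s. G s * ennreal (\<Delta> (- s)) * indicator V (z - s) \<partial>\<mu>)"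

lemma smear_le:
  assumes "G \<in> borel_measurable \<mu>"
  shows "smear G z \<le> (\<integral>\<^sup>+s. G s * ennreal (\<Delta> (- s)) \<partial>\<mu>)"
  unfolding smear_def by (intro nn_integral_mono) (auto simp: indicator_def)

lemma diff_swap:
  fixes a b k :: "'g \<Rightarrow> ennreal"
  assumes "a \<in> borel_measurable \<mu>" "b \<in> borel_measurable \<mu>" "k \<in> borel_measurable \<mu>"
  shows "(\<lambda>x. \<integral>\<^sup>+y. b y * k (x - y) \<partial>\<mu>) \<in> borel_measurable \<mu>"
    and "(\<integral>\<^sup>+x. a x * (\<integral>\<^sup>+y. b y * k (x - y) \<partial>\<mu>) \<partial>\<mu>) = (\<integral>\<^sup>+y. b y * (\<integral>\<^sup>+x. a x * k (x - y) \<partial>\<mu>) \<partial>\<mu>)"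
  by (rule convolution_swap[OF assms]; simp add: continuous_group_maps AE_diff AE_diff_right)+

lemma uminus_add_swap:
  fixes a b k :: "'g \<Rightarrow> ennreal"
  assumes "a \<in> borel_measurable \<mu>" "b \<in> borel_measurable \<mu>" "k \<in> borel_measurable \<mu>"
  shows "(\<lambda>x. \<integral>\<^sup>+y. b y * k (- y + x) \<partial>\<mu>) \<in> borel_measurable \<mu>"
    and "(\<integral>\<^sup>+x. a x * (\<integral>\<^sup>+y. b y * k (- y + x) \<partial>\<mu>) \<partial>\<mu>) = (\<integral>\<^sup>+y. b y * (\<integral>\<^sup>+x. a x * k (- y + x) \<partial>\<mu>) \<partial>\<mu>)"
  by (rule convolution_swap[OF assms]; simp add: continuous_group_maps AE_uminus_add AE_left)+

lemma add_swap:
  fixes a b k :: "'g \<Rightarrow> ennreal"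
  assumes "a \<in> borel_measurable \<mu>" "b \<in> borel_measurable \<mu>" "k \<in> borel_measurable \<mu>"
  shows "(\<lambda>x. \<integral>\<^sup>+y. b y * k (y + x) \<partial>\<mu>) \<in> borel_measurable \<mu>"
    and "(\<integral>\<^sup>+x. a x * (\<integral>\<^sup>+y. b y * k (y + x) \<partial>\<mu>) \<partial>\<mu>) = (\<integral>\<^sup>+y. b y * (\<integral>\<^sup>+x. a x * k (y + x) \<partial>\<mu>) \<partial>\<mu>)"
  by (rule convolution_swap[OF assms]; simp add: continuous_group_maps AE_right AE_left)+

text \<open>Replaces the uncountable family of almost-everywhere bounds \<open>g(vs) \<le> G(s)\<close>, \<open>v \<in> V\<close>, by a single
  one: integrate over \<open>s\<close> against \<open>\<Delta>(s\<inverse>) ds\<close>, which is right invariant.\<close>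

lemma smear_dominates:
  fixes g G :: "'g \<Rightarrow> ennreal"
  assumes g [measurable]: "g \<in> borel_measurable \<mu>" and G [measurable]: "G \<in> borel_measurable \<mu>"
    and dom: "\<And>s. AE v in \<mu>. v \<in> V \<longrightarrow> g (v + s) \<le> G s"
    and fin: "(\<integral>\<^sup>+s. G s * ennreal (\<Delta> (- s)) \<partial>\<mu>) < \<infinity>"
  shows "AE z in \<mu>. \<kappa> * g z \<le> smear G z"
proof (rule AE_le_if_nn_integral_le)
  show "(\<lambda>z. \<kappa> * g z) \<in> borel_measurable \<mu>" by measurable
  have GD [measurable]: "(\<lambda>s. G s * ennreal (\<Delta> (- s))) \<in> borel_measurable \<mu>" by measurable
  have iV [measurable]: "(indicator V :: 'g \<Rightarrow> ennreal) \<in> borel_measurable \<mu>" by measurable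
  show "smear G \<in> borel_measurable \<mu>"
    unfolding smear_def[abs_def] by (rule diff_swap(1)[OF GD GD iV])
  show "smear G z \<le> (\<integral>\<^sup>+s. G s * ennreal (\<Delta> (- s)) \<partial>\<mu>)" for z
    by (rule smear_le[OF G])
  show "(\<integral>\<^sup>+s. G s * ennreal (\<Delta> (- s)) \<partial>\<mu>) < \<infinity>"
    by (rule fin)
  fix A assume A [measurable]: "A \<in> sets \<mu>"
  have ag [measurable]: "(\<lambda>z. indicator A z * g z) \<in> borel_measurable \<mu>" by measurable
  have a [measurable]: "(indicator A :: 'g \<Rightarrow> ennreal) \<in> borel_measurable \<mu>" by measurable
  have "(\<integral>\<^sup>+z. indicator A z * (\<kappa> * g z) \<partial>\<mu>) = (\<integral>\<^sup>+z. (indicator A z * g z) * (\<integral>\<^sup>+s. ennreal (\<Delta> (- s)) * indicator V (z - s) \<partial>\<mu>) \<partial>\<mu>)"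
    unfolding kappa_translate by (simp add: mult_ac)
  also have "\<dots> = (\<integral>\<^sup>+s. ennreal (\<Delta> (- s)) * (\<integral>\<^sup>+z. (indicator A z * g z) * indicator V (z - s) \<partial>\<mu>) \<partial>\<mu>)"
    by (rule diff_swap(2)[OF ag Delta_measurable iV])
  also have "\<dots> \<le> (\<integral>\<^sup>+s. ennreal (\<Delta> (- s)) * (\<integral>\<^sup>+z. G s * (indicator A z * indicator V (z - s)) \<partial>\<mu>) \<partial>\<mu>)"
  proof (rule nn_integral_mono, rule mult_left_mono, rule nn_integral_mono_AE)
    fix s
    \<comment> \<open>The bound is used with v = z s^-1. Its exceptional set depends on s, which
      does no harm inside the integral over z.\<close>
    have "AE z in \<mu>. z - s \<in> V \<longrightarrow> g ((z - s) + s) \<le> G s"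
      by (rule AE_diff_right[OF dom])
    then show "AE z in \<mu>. indicator A z * g z * indicator V (z - s) \<le> G s * (indicator A z * indicator V (z - s))"
      by eventually_elim (auto simp: indicator_def)
  qed simp
  also have "\<dots> = (\<integral>\<^sup>+s. (G s * ennreal (\<Delta> (- s))) * (\<integral>\<^sup>+z. indicator A z * indicator V (z - s) \<partial>\<mu>) \<partial>\<mu>)"
  proof (rule nn_integral_cong)
    fix s
    have "(\<integral>\<^sup>+z. G s * (indicator A z * indicator V (z - s)) \<partial>\<mu>) = G s * (\<integral>\<^sup>+z. indicator A z * indicator V (z - s) \<partial>\<mu>)"
      by (intro nn_integral_cmult borel_measurable_times_ennreal a measurable_compose_translations iV)
    then show "ennreal (\<Delta> (- s)) * (\<integral>\<^sup>+z. G s * (indicator A z * indicator V (z - s)) \<partial>\<mu>)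
      = (G s * ennreal (\<Delta> (- s))) * (\<integral>\<^sup>+z. indicator A z * indicator V (z - s) \<partial>\<mu>)"
      by (simp only: mult_ac)
  qed
  also have "\<dots> = (\<integral>\<^sup>+z. indicator A z * smear G z \<partial>\<mu>)"
    unfolding smear_def by (rule diff_swap(2)[OF a GD iV, symmetric])
  finally show "(\<integral>\<^sup>+z. indicator A z * (\<kappa> * g z) \<partial>\<mu>) \<le> (\<integral>\<^sup>+z. indicator A z * smear G z \<partial>\<mu>)" .
qed

text \<open>The inner integral is the left Haar measure of the right translate Vs, whose factor
  \<Delta>(s) cancels the density \<Delta>(s^-1).\<close>

lemma nn_integral_smear:
  assumes G [measurable]: "G \<in> borel_measurable \<mu>"
  shows "(\<integral>\<^sup>+z. smear G z \<partial>\<mu>) = (\<integral>\<^sup>+s. G s \<partial>\<mu>) * emeasure \<mu> V"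
proof -
  have GD: "(\<lambda>s. G s * ennreal (\<Delta> (- s))) \<in> borel_measurable \<mu>" by measurable
  have iV: "(indicator V :: 'g \<Rightarrow> ennreal) \<in> borel_measurable \<mu>" by measurable
  have "(\<integral>\<^sup>+z. smear G z \<partial>\<mu>) = (\<integral>\<^sup>+z. 1 * (\<integral>\<^sup>+s. G s * ennreal (\<Delta> (- s)) * indicator V (z - s) \<partial>\<mu>) \<partial>\<mu>)"
    by (simp add: smear_def)
  also have "\<dots> = (\<integral>\<^sup>+s. G s * ennreal (\<Delta> (- s)) * (\<integral>\<^sup>+z. 1 * indicator V (z - s) \<partial>\<mu>) \<partial>\<mu>)"
    by (rule diff_swap(2)[OF _ GD iV]) simp
  also have "\<dots> = (\<integral>\<^sup>+s. G s * emeasure \<mu> V \<partial>\<mu>)"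
  proof (rule nn_integral_cong)
    fix s
    have "(\<integral>\<^sup>+z. indicator V (z - s) \<partial>\<mu>) = ennreal (\<Delta> s) * emeasure \<mu> V"
      using nn_integral_right[OF iV, of "- s"] by simp
    moreover have "ennreal (\<Delta> (- s)) * ennreal (\<Delta> s) = 1"
      using Delta_uminus(2)[of s] by (simp add: ennreal_mult[symmetric] Delta_pos less_imp_le)
    ultimately show "G s * ennreal (\<Delta> (- s)) * (\<integral>\<^sup>+z. 1 * indicator V (z - s) \<partial>\<mu>) = G s * emeasure \<mu> V"
      by (simp add: mult.assoc[symmetric]) (simp add: mult.assoc)
  qed
  also have "\<dots> = (\<integral>\<^sup>+s. G s \<partial>\<mu>) * emeasure \<mu> V"
    by (rule nn_integral_multc[OF G])
  finally show ?thesis .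
qed

text \<open>By symmetry of V the inner integral is now over a left translate of V, so no modular
  factor arises and \<Delta>(s^-1) survives. Integrability after inversion thus calls for the second
  bound of \<open>weight_lower_bound\<close>.\<close>

lemma nn_integral_smear_uminus:
  assumes G [measurable]: "G \<in> borel_measurable \<mu>"
  shows "(\<integral>\<^sup>+z. smear G (- z) \<partial>\<mu>) = (\<integral>\<^sup>+s. G s * ennreal (\<Delta> (- s)) \<partial>\<mu>) * emeasure \<mu> V"
proof -
  have GD: "(\<lambda>s. G s * ennreal (\<Delta> (- s))) \<in> borel_measurable \<mu>" by measurable
  have iV: "(indicator V :: 'g \<Rightarrow> ennreal) \<in> borel_measurable \<mu>" by measurable
  have "indicator V (- z - s) = (indicator V (s + z) :: ennreal)" for z s
    using uminus_V_iff[of "s + z"] by (simp add: indicator_def minus_add)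
  then have "(\<integral>\<^sup>+z. smear G (- z) \<partial>\<mu>) = (\<integral>\<^sup>+z. 1 * (\<integral>\<^sup>+s. G s * ennreal (\<Delta> (- s)) * indicator V (s + z) \<partial>\<mu>) \<partial>\<mu>)"
    by (simp add: smear_def)
  also have "\<dots> = (\<integral>\<^sup>+s. G s * ennreal (\<Delta> (- s)) * (\<integral>\<^sup>+z. 1 * indicator V (s + z) \<partial>\<mu>) \<partial>\<mu>)"
    by (rule add_swap(2)[OF _ GD iV]) simp
  also have "\<dots> = (\<integral>\<^sup>+s. G s * ennreal (\<Delta> (- s)) * emeasure \<mu> V \<partial>\<mu>)"
    using nn_integral_left[OF iV] by simp
  also have "\<dots> = (\<integral>\<^sup>+s. G s * ennreal (\<Delta> (- s)) \<partial>\<mu>) * emeasure \<mu> V"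
    by (rule nn_integral_multc[OF GD])
  finally show ?thesis .
qed

text \<open>Double counting of the pairs (x, y) with x^-1 y in V: by left invariance and symmetry
  all sections in either variable have the measure of V, and on a section \<open>k\<close> is at
  most \<open>H x\<close>. It plays for \<open>locmax\<close> the part that \<open>smear\<close>
  plays for \<open>locmaxR\<close>.\<close>

lemma nn_integral_le_left_dominated:
  fixes k H :: "'g \<Rightarrow> ennreal"
  assumes k [measurable]: "k \<in> borel_measurable \<mu>" and H [measurable]: "H \<in> borel_measurable \<mu>"
    and dom: "\<And>s. AE v in \<mu>. v \<in> V \<longrightarrow> k (s + v) \<le> H s"
  shows "(\<integral>\<^sup>+y. k y \<partial>\<mu>) * emeasure \<mu> V \<le> (\<integral>\<^sup>+y. H y \<partial>\<mu>) * emeasure \<mu> V"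
proof -
  have iV: "(indicator V :: 'g \<Rightarrow> ennreal) \<in> borel_measurable \<mu>" by measurable
  have l: "(\<integral>\<^sup>+x. 1 * indicator V (- x + y) \<partial>\<mu>) = emeasure \<mu> V" for y
  proof -
    have "indicator V (- x + y) = (indicator V (- y + x) :: ennreal)" for x
      using uminus_V_iff[of "- y + x"] by (simp add: indicator_def minus_add)
    then show ?thesis
      using nn_integral_left[OF iV, of "- y"] by simp
  qed
  have "(\<integral>\<^sup>+y. k y \<partial>\<mu>) * emeasure \<mu> V = (\<integral>\<^sup>+y. k y * (\<integral>\<^sup>+x. 1 * indicator V (- x + y) \<partial>\<mu>) \<partial>\<mu>)"
    unfolding l by (rule nn_integral_multc[OF k, symmetric])
  also have "\<dots> = (\<integral>\<^sup>+x. 1 * (\<integral>\<^sup>+y. k y * indicator V (- x + y) \<partial>\<mu>) \<partial>\<mu>)"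
    by (rule uminus_add_swap(2)[OF k _ iV]) simp
  also have "\<dots> \<le> (\<integral>\<^sup>+x. H x * emeasure \<mu> V \<partial>\<mu>)"
  proof (rule nn_integral_mono)
    fix x
    have "AE y in \<mu>. - x + y \<in> V \<longrightarrow> k (x + (- x + y)) \<le> H x"
      by (rule AE_left[OF dom])
    then have "(\<integral>\<^sup>+y. k y * indicator V (- x + y) \<partial>\<mu>) \<le> (\<integral>\<^sup>+y. H x * indicator V (- x + y) \<partial>\<mu>)"
      by (intro nn_integral_mono_AE) (auto simp: indicator_def add.assoc[symmetric])
    also have "\<dots> = H x * (\<integral>\<^sup>+y. indicator V (- x + y) \<partial>\<mu>)"
      by (intro nn_integral_cmult measurable_compose_translations iV)
    also have "(\<integral>\<^sup>+y. indicator V (- x + y) \<partial>\<mu>) = emeasure \<mu> V"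
      using nn_integral_left[OF iV, of "- x"] by simp
    finally show "1 * (\<integral>\<^sup>+y. k y * indicator V (- x + y) \<partial>\<mu>) \<le> H x * emeasure \<mu> V"
      by simp
  qed
  also have "\<dots> = (\<integral>\<^sup>+y. H y \<partial>\<mu>) * emeasure \<mu> V"
    by (rule nn_integral_multc[OF H])
  finally show ?thesis .
qed

text \<open>For fixed s the terms that do not vanish have \<gamma> in the translate of V by x s^-1,
  so there are at most n of them. If s lay in \<open>U\<close>, such a \<gamma> would put
  \<gamma>^-1 x into the sum of V and \<open>U\<close>, which \<open>far\<close> excludes; hence
  only s outside \<open>U\<close> contribute.\<close>

lemma smear_tail_sum:
  assumes G [measurable]: "G \<in> borel_measurable \<mu>" and "finite F" and F: "F \<subseteq> \<Gamma>"
    and sep: "\<And>x. finite (\<Gamma> \<inter> (\<lambda>v. x + v) ` V) \<and> card (\<Gamma> \<inter> (\<lambda>v. x + v) ` V) \<le> n"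
    and U [measurable]: "U \<in> sets \<mu>"
    and far: "\<And>\<gamma>. \<gamma> \<in> F \<Longrightarrow> - \<gamma> + x \<notin> set_sum (closure V) U"
  shows "(\<Sum>\<gamma>\<in>F. smear G (- \<gamma> + x)) \<le> of_nat n * (\<integral>\<^sup>+s. indicator (- U) s * (G s * ennreal (\<Delta> (- s))) \<partial>\<mu>)"
proof -
  have iV: "(indicator V :: 'g \<Rightarrow> ennreal) \<in> borel_measurable \<mu>" by measurable
  have GD [measurable]: "(\<lambda>s. G s * ennreal (\<Delta> (- s))) \<in> borel_measurable \<mu>" by measurable
  have U' [measurable]: "- U \<in> sets \<mu>"
    using sets.compl_sets[OF U] by (simp add: Compl_eq_Diff_UNIV)
  have "(\<Sum>\<gamma>\<in>F. smear G (- \<gamma> + x)) = (\<integral>\<^sup>+s. (\<Sum>\<gamma>\<in>F. G s * ennreal (\<Delta> (- s)) * indicator V (- \<gamma> + x - s)) \<partial>\<mu>)"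
    unfolding smear_def
    by (intro nn_integral_sum[symmetric] borel_measurable_times_ennreal[OF GD] measurable_compose_translations iV)
  also have "\<dots> \<le> (\<integral>\<^sup>+s. of_nat n * (indicator (- U) s * (G s * ennreal (\<Delta> (- s)))) \<partial>\<mu>)"
  proof (rule nn_integral_mono)
    fix s
    let ?F = "{\<gamma>\<in>F. - \<gamma> + x - s \<in> V}"
    have "(\<Sum>\<gamma>\<in>F. G s * ennreal (\<Delta> (- s)) * indicator V (- \<gamma> + x - s)) = G s * ennreal (\<Delta> (- s)) * of_nat (card ?F)"
      using \<open>finite F\<close> by (simp add: sum_distrib_left[symmetric] indicator_def sum.If_cases Int_def)
    also have "\<dots> \<le> of_nat n * (indicator (- U) s * (G s * ennreal (\<Delta> (- s))))"
    proof (cases "s \<in> U")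
      case True
      have "- \<gamma> + x \<in> set_sum (closure V) U" if "\<gamma> \<in> ?F" for \<gamma>
        using set_sumI[of "- \<gamma> + x - s" "closure V" s U] that True closure_subset[of V] by auto
      then have "?F = {}"
        using far by blast
      then show ?thesis
        by (metis card.empty mult_zero_right of_nat_0 zero_le)
    next
      case False
      have "?F \<subseteq> \<Gamma> \<inter> (\<lambda>v. (x - s) + v) ` V"
      proof
        fix \<gamma> assume g: "\<gamma> \<in> ?F"
        then have "- (- \<gamma> + x - s) \<in> V"
          using uminus_V_iff by blast
        moreover have "\<gamma> = (x - s) + - (- \<gamma> + x - s)"
        proof -
          have "(x - s) + - (- \<gamma> + x - s) = (x - s) + (s - (- \<gamma> + x))"
            by (simp only: minus_diff_eq)
          also have "\<dots> = x - (- \<gamma> + x)"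
            by (simp only: diff_conv_add_uminus add.assoc) (simp only: minus_add_cancel)
          also have "\<dots> = \<gamma>"
            by (simp only: diff_conv_add_uminus minus_add minus_minus add_minus_cancel)
          finally show ?thesis ..
        qed
        ultimately have "\<gamma> \<in> (\<lambda>v. (x - s) + v) ` V"
          by (metis imageI)
        then show "\<gamma> \<in> \<Gamma> \<inter> (\<lambda>v. (x - s) + v) ` V"
          using g F by blast
      qed
      then have "card ?F \<le> n"
        using sep[of "x - s"] card_mono order_trans by blast
      then have "(of_nat (card ?F) :: ennreal) \<le> of_nat n"
        by simp
      then have "G s * ennreal (\<Delta> (- s)) * of_nat (card ?F) \<le> G s * ennreal (\<Delta> (- s)) * of_nat n"
        by (intro mult_left_mono) auto
      then show ?thesis
        using False by (simp add: mult.commute)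
    qed
    finally show "(\<Sum>\<gamma>\<in>F. G s * ennreal (\<Delta> (- s)) * indicator V (- \<gamma> + x - s)) \<le> of_nat n * (indicator (- U) s * (G s * ennreal (\<Delta> (- s))))" .
  qed
  also have "\<dots> = of_nat n * (\<integral>\<^sup>+s. indicator (- U) s * (G s * ennreal (\<Delta> (- s))) \<partial>\<mu>)"
    by (intro nn_integral_cmult) measurable
  finally show ?thesis .
qed

section \<open>Separated index sets\<close>

lemma compact_cover_V:
  assumes "compact U"
  obtains I where "finite I" "U \<subseteq> (\<Union>x\<in>I. (\<lambda>v. x + v) ` V)"
proof -
  have "U \<subseteq> (\<Union>x\<in>U. (\<lambda>v. x + v) ` interior V)"
  proof
    fix x assume "x \<in> U"
    moreover have "x \<in> (\<lambda>v. x + v) ` interior V"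
      using V_nhd by (metis add.right_neutral image_eqI)
    ultimately show "x \<in> (\<Union>x\<in>U. (\<lambda>v. x + v) ` interior V)" by (rule UN_I)
  qed
  from compactE_image[OF assms _ this, OF open_left_translation[OF open_interior]]
  obtain I where I: "I \<subseteq> U" "finite I" "U \<subseteq> (\<Union>x\<in>I. (\<lambda>v. x + v) ` interior V)"
    by blast
  moreover have "(\<Union>x\<in>I. (\<lambda>v. x + v) ` interior V) \<subseteq> (\<Union>x\<in>I. (\<lambda>v. x + v) ` V)"
    using interior_subset by (intro UN_mono image_mono) auto
  ultimately show thesis
    using that by (meson order_trans)
qed

text \<open>Bounded overlap of the sets \<gamma>U: those containing y have \<gamma> in y U^-1, which
  finitely many translates of V cover, each holding at most n points of \<Gamma>.\<close>

lemma separated_count: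
  assumes sep: "\<And>x. finite (\<Gamma> \<inter> (\<lambda>v. x + v) ` V) \<and> card (\<Gamma> \<inter> (\<lambda>v. x + v) ` V) \<le> n"
    and "compact U"
  obtains N where "\<And>y. finite {\<gamma>\<in>\<Gamma>. - \<gamma> + y \<in> U}" "\<And>y. card {\<gamma>\<in>\<Gamma>. - \<gamma> + y \<in> U} \<le> N"
proof -
  obtain I where I: "finite I" "uminus ` U \<subseteq> (\<Union>x\<in>I. (\<lambda>v. x + v) ` V)"
    using compact_cover_V[OF compact_uminus[OF assms(2)]] by blast
  have sub: "{\<gamma>\<in>\<Gamma>. - \<gamma> + y \<in> U} \<subseteq> (\<Union>x\<in>I. \<Gamma> \<inter> (\<lambda>v. (y + x) + v) ` V)" for y
  proof
    fix \<gamma> assume g: "\<gamma> \<in> {\<gamma>\<in>\<Gamma>. - \<gamma> + y \<in> U}"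
    then have "- (- \<gamma> + y) \<in> (\<Union>x\<in>I. (\<lambda>v. x + v) ` V)"
      using I(2) by blast
    then obtain x v where xv: "x \<in> I" "v \<in> V" "- (- \<gamma> + y) = x + v"
      by blast
    have "\<gamma> = y + (- (- \<gamma> + y))"
      by (simp only: minus_add minus_minus add_minus_cancel)
    then have "\<gamma> = (y + x) + v"
      unfolding xv(3) by (simp only: add.assoc)
    then show "\<gamma> \<in> (\<Union>x\<in>I. \<Gamma> \<inter> (\<lambda>v. (y + x) + v) ` V)"
      using xv g by blast
  qed
  have fin: "finite (\<Union>x\<in>I. \<Gamma> \<inter> (\<lambda>v. (y + x) + v) ` V)" for y
    using I(1) sep by (intro finite_UN_I) auto
  show thesis
  proof
    show "finite {\<gamma>\<in>\<Gamma>. - \<gamma> + y \<in> U}" for y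
      by (rule finite_subset[OF sub fin])
    show "card {\<gamma>\<in>\<Gamma>. - \<gamma> + y \<in> U} \<le> card I * n" for y
    proof -
      have "card {\<gamma>\<in>\<Gamma>. - \<gamma> + y \<in> U} \<le> card (\<Union>x\<in>I. \<Gamma> \<inter> (\<lambda>v. (y + x) + v) ` V)"
        by (rule card_mono[OF fin sub])
      also have "\<dots> \<le> (\<Sum>x\<in>I. card (\<Gamma> \<inter> (\<lambda>v. (y + x) + v) ` V))"
        by (rule card_UN_le[OF I(1)])
      also have "\<dots> \<le> (\<Sum>x\<in>I. n)"
        using sep by (intro sum_mono) auto
      finally show ?thesis by simp
    qed
  qed
qed

text \<open>Each set of a compact exhaustion is covered by finitely many translates of V.
  Countability is what later permits monotone convergence over \<Gamma>.\<close>

lemma separated_countable: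
  assumes sep: "\<And>x. finite (\<Gamma> \<inter> (\<lambda>v. x + v) ` V) \<and> card (\<Gamma> \<inter> (\<lambda>v. x + v) ` V) \<le> n"
  shows "countable \<Gamma>"
proof -
  obtain C :: "nat \<Rightarrow> 'g set" where C: "\<And>n. compact (C n)" "incseq C" "(\<Union>n. C n) = UNIV"
    using compact_exhaustion by blast
  have "finite (\<Gamma> \<inter> C i)" for i
  proof -
    obtain I where I: "finite I" "C i \<subseteq> (\<Union>x\<in>I. (\<lambda>v. x + v) ` V)"
      using compact_cover_V[OF C(1)] by blast
    have "finite (\<Union>x\<in>I. \<Gamma> \<inter> (\<lambda>v. x + v) ` V)"
      using I(1) sep by (intro finite_UN_I) auto
    then show ?thesis
      by (rule finite_subset[rotated]) (use I(2) in blast)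
  qed
  then have "countable (\<Union>i. \<Gamma> \<inter> C i)"
    by (intro countable_UN) (auto intro: countable_finite)
  also have "(\<Union>i. \<Gamma> \<inter> C i) = \<Gamma>"
    using C(3) by blast
  finally show ?thesis .
qed

end

section \<open>Square-integrable functions\<close>

lemma cnj_measurable [measurable]: "cnj \<in> borel_measurable borel"
  by (intro borel_measurable_continuous_onI continuous_intros)

lemma L2_measurable: "f \<in> L2 M \<Longrightarrow> f \<in> borel_measurable M"
  and L2_integrable: "f \<in> L2 M \<Longrightarrow> integrable M (\<lambda>x. (cmod (f x))\<^sup>2)"
  by (simp_all add: L2_def)

lemma L2I_bounded:
  assumes "f \<in> borel_measurable M" "g \<in> L2 M" "AE x in M. cmod (f x) \<le> b * cmod (g x)"
  shows "f \<in> L2 M"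
proof -
  have "integrable M (\<lambda>x. (cmod (f x))\<^sup>2)"
  proof (rule Bochner_Integration.integrable_bound)
    show "integrable M (\<lambda>x. b\<^sup>2 * (cmod (g x))\<^sup>2)"
      using L2_integrable[OF assms(2)] by simp
    show "(\<lambda>x. (cmod (f x))\<^sup>2) \<in> borel_measurable M"
      using assms(1) by measurable
    show "AE x in M. norm ((cmod (f x))\<^sup>2) \<le> norm (b\<^sup>2 * (cmod (g x))\<^sup>2)"
      using assms(3)
    proof eventually_elim
      case (elim x)
      then have "(cmod (f x))\<^sup>2 \<le> (b * cmod (g x))\<^sup>2"
        by (intro power_mono) auto
      then show ?case
        by (simp add: power_mult_distrib)
    qed
  qed
  then show ?thesis
    using assms(1) by (simp add: L2_def)
qed

lemma L2_cong_AE: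
  assumes "f \<in> borel_measurable M" "g \<in> L2 M" "AE x in M. f x = g x"
  shows "f \<in> L2 M"
  by (rule L2I_bounded[OF assms(1,2), of 1]) (use assms(3) in auto)

lemma L2_zero: "(\<lambda>x. 0) \<in> L2 M"
  by (simp add: L2_def)

lemma L2_cmult: "f \<in> L2 M \<Longrightarrow> (\<lambda>x. c * f x) \<in> L2 M"
  by (auto simp: L2_def norm_mult power_mult_distrib)

lemma L2_add:
  assumes f: "f \<in> L2 M" and g: "g \<in> L2 M"
  shows "(\<lambda>x. f x + g x) \<in> L2 M"
proof -
  have m: "(\<lambda>x. f x + g x) \<in> borel_measurable M"
    using L2_measurable[OF f] L2_measurable[OF g] by measurable
  have "integrable M (\<lambda>x. (cmod (f x + g x))\<^sup>2)"
  proof (rule Bochner_Integration.integrable_bound)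
    show "integrable M (\<lambda>x. 2 * (cmod (f x))\<^sup>2 + 2 * (cmod (g x))\<^sup>2)"
      using L2_integrable[OF f] L2_integrable[OF g] by simp
    show "(\<lambda>x. (cmod (f x + g x))\<^sup>2) \<in> borel_measurable M"
      using m by measurable
    show "AE x in M. norm ((cmod (f x + g x))\<^sup>2) \<le> norm (2 * (cmod (f x))\<^sup>2 + 2 * (cmod (g x))\<^sup>2)"
    proof (rule AE_I2)
      fix x
      have "(cmod (f x + g x))\<^sup>2 \<le> (cmod (f x) + cmod (g x))\<^sup>2"
        by (intro power_mono norm_triangle_ineq) simp
      also have "\<dots> \<le> 2 * (cmod (f x))\<^sup>2 + 2 * (cmod (g x))\<^sup>2"
        using sum_squares_bound[of "cmod (f x)" "cmod (g x)"] by (simp add: power2_sum)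
      finally show "norm ((cmod (f x + g x))\<^sup>2) \<le> norm (2 * (cmod (f x))\<^sup>2 + 2 * (cmod (g x))\<^sup>2)"
        by simp
    qed
  qed
  then show ?thesis
    using m by (simp add: L2_def)
qed

lemma L2_diff:
  assumes "f \<in> L2 M" "g \<in> L2 M"
  shows "(\<lambda>x. f x - g x) \<in> L2 M"
  using L2_add[OF assms(1) L2_cmult[OF assms(2), of "-1"]] by simp

lemma L2_sum: "(\<And>i. i \<in> I \<Longrightarrow> f i \<in> L2 M) \<Longrightarrow> (\<lambda>x. \<Sum>i\<in>I. f i x) \<in> L2 M"
  by (induction I rule: infinite_finite_induct) (auto simp: L2_zero L2_add)

lemma L2norm_nonneg: "0 \<le> L2norm M f"
  by (simp add: L2norm_def)

lemma L2norm_square: "(L2norm M f)\<^sup>2 = (\<integral>x. (cmod (f x))\<^sup>2 \<partial>M)"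
  by (simp add: L2norm_def)

lemma nn_integral_L2norm:
  assumes "f \<in> L2 M"
  shows "(\<integral>\<^sup>+x. ennreal ((cmod (f x))\<^sup>2) \<partial>M) = ennreal ((L2norm M f)\<^sup>2)"
  unfolding L2norm_square by (rule nn_integral_eq_integral[OF L2_integrable[OF assms]]) simp

lemma L2inner_cong_AE:
  assumes "f \<in> borel_measurable M" "g \<in> borel_measurable M" "h \<in> borel_measurable M" "AE x in M. f x = g x"
  shows "L2inner M f h = L2inner M g h"
  unfolding L2inner_def
proof (rule integral_cong_AE)
  show "(\<lambda>x. f x * cnj (h x)) \<in> borel_measurable M" "(\<lambda>x. g x * cnj (h x)) \<in> borel_measurable M"
    using assms(1-3) by measurable
qed (use assms(4) in auto)

lemma L2_abs_product_integrable:
  assumes f: "f \<in> L2 M" and g: "g \<in> L2 M"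
  shows "integrable M (\<lambda>x. cmod (f x) * cmod (g x))"
proof (rule Bochner_Integration.integrable_bound)
  show "integrable M (\<lambda>x. (cmod (f x))\<^sup>2 + (cmod (g x))\<^sup>2)"
    using L2_integrable[OF f] L2_integrable[OF g] by simp
  show "(\<lambda>x. cmod (f x) * cmod (g x)) \<in> borel_measurable M"
    using L2_measurable[OF f] L2_measurable[OF g] by measurable
  show "AE x in M. norm (cmod (f x) * cmod (g x)) \<le> norm ((cmod (f x))\<^sup>2 + (cmod (g x))\<^sup>2)"
  proof (rule AE_I2)
    fix x
    have "2 * (cmod (f x) * cmod (g x)) \<le> (cmod (f x))\<^sup>2 + (cmod (g x))\<^sup>2"
      using sum_squares_bound[of "cmod (f x)" "cmod (g x)"] by simp
    moreover have "0 \<le> cmod (f x) * cmod (g x)"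
      by simp
    ultimately show "norm (cmod (f x) * cmod (g x)) \<le> norm ((cmod (f x))\<^sup>2 + (cmod (g x))\<^sup>2)"
      unfolding real_norm_def by linarith
  qed
qed

lemma L2_product_integrable:
  assumes f: "f \<in> L2 M" and g: "g \<in> L2 M"
  shows "integrable M (\<lambda>x. f x * cnj (g x))"
proof (rule Bochner_Integration.integrable_bound[OF L2_abs_product_integrable[OF f g]])
  show "(\<lambda>x. f x * cnj (g x)) \<in> borel_measurable M"
    using L2_measurable[OF f] L2_measurable[OF g] by measurable
qed (auto simp: norm_mult)

lemma L2_Cauchy_Schwarz:
  assumes f: "f \<in> L2 M" and g: "g \<in> L2 M"
  shows "cmod (L2inner M f g) \<le> L2norm M f * L2norm M g"
proof -
  have [measurable]: "f \<in> borel_measurable M" "g \<in> borel_measurable M"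
    using f g L2_measurable by blast+
  let ?I = "\<integral>x. cmod (f x) * cmod (g x) \<partial>M"
  have I0: "0 \<le> ?I"
    by (intro integral_nonneg_AE) auto
  have "ennreal ?I = (\<integral>\<^sup>+x. ennreal (cmod (f x) * cmod (g x)) \<partial>M)"
    by (intro nn_integral_eq_integral[symmetric] L2_abs_product_integrable f g) auto
  also have "\<dots> = (\<integral>\<^sup>+x. ennreal (cmod (f x)) * ennreal (cmod (g x)) \<partial>M)"
    by (simp add: ennreal_mult)
  finally have "(ennreal ?I)\<^sup>2 \<le> (\<integral>\<^sup>+x. (ennreal (cmod (f x)))\<^sup>2 \<partial>M) * (\<integral>\<^sup>+x. (ennreal (cmod (g x)))\<^sup>2 \<partial>M)"
    using Cauchy_Schwarz_nn_integral[of "\<lambda>x. ennreal (cmod (f x))" M "\<lambda>x. ennreal (cmod (g x))"] by simp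
  also have "\<dots> = ennreal ((L2norm M f)\<^sup>2) * ennreal ((L2norm M g)\<^sup>2)"
    using nn_integral_L2norm[OF f] nn_integral_L2norm[OF g] by (simp add: ennreal_power)
  finally have "ennreal (?I\<^sup>2) \<le> ennreal ((L2norm M f)\<^sup>2 * (L2norm M g)\<^sup>2)"
    using I0 by (simp add: ennreal_power ennreal_mult)
  then have "?I\<^sup>2 \<le> (L2norm M f * L2norm M g)\<^sup>2"
    by (simp add: power_mult_distrib)
  then have "?I \<le> L2norm M f * L2norm M g"
    by (rule power2_le_imp_le) (simp add: L2norm_nonneg)
  moreover have "cmod (L2inner M f g) \<le> ?I"
    using integral_norm_bound[of M "\<lambda>x. f x * cnj (g x)"] by (simp add: L2inner_def norm_mult)
  ultimately show ?thesis by linarith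
qed

lemma L2inner_add_left:
  assumes "f \<in> L2 M" "g \<in> L2 M" "h \<in> L2 M"
  shows "L2inner M (\<lambda>x. f x + g x) h = L2inner M f h + L2inner M g h"
  unfolding L2inner_def distrib_right
  by (intro Bochner_Integration.integral_add L2_product_integrable assms)

lemma L2inner_diff_left:
  assumes "f \<in> L2 M" "g \<in> L2 M" "h \<in> L2 M"
  shows "L2inner M (\<lambda>x. f x - g x) h = L2inner M f h - L2inner M g h"
  unfolding L2inner_def left_diff_distrib
  by (intro Bochner_Integration.integral_diff L2_product_integrable assms)

lemma L2inner_cmult_left: "L2inner M (\<lambda>x. c * f x) h = c * L2inner M f h"
  unfolding L2inner_def mult.assoc by simp

lemma L2inner_cmult_right: "L2inner M f (\<lambda>x. c * h x) = cnj c * L2inner M f h"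
  unfolding L2inner_def by (simp add: mult.left_commute)

lemma L2inner_commute: "L2inner M g f = cnj (L2inner M f g)"
  unfolding L2inner_def Bochner_Integration.integral_cnj[symmetric] by (simp add: mult.commute)

lemma L2inner_self: "L2inner M f f = complex_of_real ((L2norm M f)\<^sup>2)"
  unfolding L2inner_def L2norm_square complex_norm_square[symmetric] by (rule integral_complex_of_real)

lemma L2inner_sum_left:
  assumes "\<And>i. i \<in> I \<Longrightarrow> f i \<in> L2 M" "h \<in> L2 M"
  shows "L2inner M (\<lambda>x. \<Sum>i\<in>I. f i x) h = (\<Sum>i\<in>I. L2inner M (f i) h)"
  unfolding L2inner_def sum_distrib_right
  by (intro Bochner_Integration.integral_sum L2_product_integrable assms)

text \<open>Orthonormality is asked for on \<open>I\<close> only, because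
  \<open>diagonalizes\<close> constrains \<open>phi k\<close> only where the eigenvalue is
  positive.\<close>

lemma L2_orthonormal_sum:
  assumes "finite I" and phi: "\<And>k. k \<in> I \<Longrightarrow> phi k \<in> L2 M"
    and on: "\<And>k l. k \<in> I \<Longrightarrow> l \<in> I \<Longrightarrow> L2inner M (phi k) (phi l) = (if k = l then 1 else 0)"
  shows "(L2norm M (\<lambda>x. \<Sum>k\<in>I. a k * phi k x))\<^sup>2 = (\<Sum>k\<in>I. (cmod (a k))\<^sup>2)"
    and "f \<in> L2 M \<Longrightarrow> L2inner M f (\<lambda>x. \<Sum>k\<in>I. a k * phi k x) = (\<Sum>k\<in>I. cnj (a k) * L2inner M f (phi k))"
proof -
  let ?s = "\<lambda>x. \<Sum>k\<in>I. a k * phi k x"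
  have s: "?s \<in> L2 M"
    by (intro L2_sum L2_cmult phi)
  show r: "L2inner M f ?s = (\<Sum>k\<in>I. cnj (a k) * L2inner M f (phi k))" if f: "f \<in> L2 M" for f
  proof -
    have "L2inner M f ?s = cnj (L2inner M ?s f)"
      by (rule L2inner_commute)
    also have "L2inner M ?s f = (\<Sum>k\<in>I. a k * L2inner M (phi k) f)"
      by (subst L2inner_sum_left) (auto simp: L2inner_cmult_left intro: L2_cmult phi f)
    also have "cnj \<dots> = (\<Sum>k\<in>I. cnj (a k) * L2inner M f (phi k))"
      using L2inner_commute[of M f] by simp
    finally show ?thesis .
  qed
  have "L2inner M (phi k) ?s = cnj (a k)" if "k \<in> I" for k
    using r[OF phi[OF that]] that on \<open>finite I\<close> by (simp add: if_distrib cong: if_cong)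
  moreover have "L2inner M ?s ?s = (\<Sum>k\<in>I. a k * L2inner M (phi k) ?s)"
    by (subst L2inner_sum_left) (auto simp: L2inner_cmult_left intro: L2_cmult phi s)
  ultimately have "complex_of_real ((L2norm M ?s)\<^sup>2) = (\<Sum>k\<in>I. a k * cnj (a k))"
    by (simp add: L2inner_self)
  also have "\<dots> = complex_of_real (\<Sum>k\<in>I. (cmod (a k))\<^sup>2)"
    unfolding of_real_sum complex_norm_square ..
  finally show "(L2norm M ?s)\<^sup>2 = (\<Sum>k\<in>I. (cmod (a k))\<^sup>2)"
    by (simp only: of_real_eq_iff)
qed

text \<open>For the projection s of f onto the span, both the inner product of f with s and the
  squared norm of s equal the sum in question; Cauchy-Schwarz and division by the norm of s
  finish.\<close>

lemma L2_Bessel: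
  assumes "finite I" and phi: "\<And>k. k \<in> I \<Longrightarrow> phi k \<in> L2 M"
    and on: "\<And>k l. k \<in> I \<Longrightarrow> l \<in> I \<Longrightarrow> L2inner M (phi k) (phi l) = (if k = l then 1 else 0)"
    and f: "f \<in> L2 M"
  shows "(\<Sum>k\<in>I. (cmod (L2inner M f (phi k)))\<^sup>2) \<le> (L2norm M f)\<^sup>2"
proof -
  let ?s = "\<lambda>x. \<Sum>k\<in>I. L2inner M f (phi k) * phi k x"
  let ?S = "\<Sum>k\<in>I. (cmod (L2inner M f (phi k)))\<^sup>2"
  have s: "?s \<in> L2 M"
    by (intro L2_sum L2_cmult phi)
  have "L2inner M f ?s = complex_of_real ?S"
  proof -
    have "cnj z * z = complex_of_real ((cmod z)\<^sup>2)" for z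
      unfolding complex_norm_square by (rule mult.commute)
    moreover have "L2inner M f ?s = (\<Sum>k\<in>I. cnj (L2inner M f (phi k)) * L2inner M f (phi k))"
      by (rule L2_orthonormal_sum(2)[where phi = phi and a = "\<lambda>k. L2inner M f (phi k)", OF \<open>finite I\<close>])
        (use assms in auto)
    ultimately show ?thesis
      by (simp only: of_real_sum)
  qed
  then have "?S \<le> L2norm M f * L2norm M ?s"
    using L2_Cauchy_Schwarz[OF f s] by (simp only: norm_of_real abs_le_iff)
  moreover have n: "(L2norm M ?s)\<^sup>2 = ?S"
    by (rule L2_orthonormal_sum(1)[where phi = phi and a = "\<lambda>k. L2inner M f (phi k)", OF \<open>finite I\<close>])
      (use assms in auto)
  ultimately have "L2norm M ?s * L2norm M ?s \<le> L2norm M f * L2norm M ?s"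
    by (simp add: power2_eq_square)
  then have "L2norm M ?s \<le> L2norm M f"
    using L2norm_nonneg[of M ?s] L2norm_nonneg[of M f] by (cases "L2norm M ?s = 0") auto
  then show ?thesis
    unfolding n[symmetric] using L2norm_nonneg by (intro power_mono)
qed

lemma L2inner_tendsto:
  assumes F: "\<And>n. F n \<in> L2 M" and f: "f \<in> L2 M" and h: "h \<in> L2 M"
    and lim: "(\<lambda>n. L2norm M (\<lambda>x. f x - F n x)) \<longlonglongrightarrow> 0"
  shows "(\<lambda>n. L2inner M (F n) h) \<longlonglongrightarrow> L2inner M f h"
proof -
  have "(\<lambda>n. L2inner M f h - L2inner M (F n) h) \<longlonglongrightarrow> 0"
  proof (rule Lim_null_comparison)
    show "\<forall>\<^sub>F n in sequentially. norm (L2inner M f h - L2inner M (F n) h) \<le> L2norm M (\<lambda>x. f x - F n x) * L2norm M h"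
      using L2_Cauchy_Schwarz[OF L2_diff[OF f F] h] L2inner_diff_left[OF f F h] by simp
    show "(\<lambda>n. L2norm M (\<lambda>x. f x - F n x) * L2norm M h) \<longlonglongrightarrow> 0"
      using tendsto_mult_right[OF lim, of "L2norm M h"] by simp
  qed
  then have "(\<lambda>n. L2inner M f h - (L2inner M f h - L2inner M (F n) h)) \<longlonglongrightarrow> L2inner M f h - 0"
    by (intro tendsto_diff tendsto_const)
  then show ?thesis by simp
qed

section \<open>The reproducing projection\<close>

lemma ennreal_le_divide_of_mult_le:
  fixes a b c :: ennreal
  assumes "c * a \<le> b" "0 < c" "c < top"
  shows "a \<le> b / c"
proof -
  have "a = c * a / c"
    using assms(2,3) by (simp add: ennreal_mult_divide_eq mult.commute)
  also have "\<dots> \<le> b / c"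
    by (rule divide_right_mono_ennreal[OF assms(1)])
  finally show ?thesis .
qed

text \<open>Makes a bound on the square, as Cauchy-Schwarz yields it, into a bound on x itself
  without square roots in \<open>ennreal\<close>.\<close>

lemma ennreal_le_one_plus_square: "(x::ennreal) \<le> 1 + x\<^sup>2"
proof (cases "x \<le> 1")
  case True
  then show ?thesis by (rule order_trans) simp
next
  case False
  then have "x * 1 \<le> x * x"
    by (intro mult_left_mono) auto
  then show ?thesis
    by (simp add: power2_eq_square add_increasing)
qed

context weighted_haar_group
begin

text \<open>The two lower bounds on w make the local maximum integrable for both Haar measures; the
  right one is the finiteness hypothesis of \<open>smear_dominates\<close>.\<close>

lemma WR_dominates:
  assumes "g \<in> WR_Linf_L1w \<mu> V w"
  shows "locmaxR \<mu> V g \<in> borel_measurable \<mu>"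
    and "(\<integral>\<^sup>+s. locmaxR \<mu> V g s \<partial>\<mu>) < \<infinity>"
    and "(\<integral>\<^sup>+s. locmaxR \<mu> V g s * ennreal (\<Delta> (- s)) \<partial>\<mu>) < \<infinity>"
    and "AE z in \<mu>. \<kappa> * ennreal (cmod (g z)) \<le> smear (locmaxR \<mu> V g) z"
proof -
  obtain c where c: "0 < c" "\<And>x. c \<le> w x" "\<And>x. c * \<Delta> (- x) \<le> w x"
    using weight_lower_bound by blast
  have gm [measurable]: "g \<in> borel_measurable \<mu>" and fin: "(\<integral>\<^sup>+x. locmaxR \<mu> V g x * ennreal (w x) \<partial>\<mu>) < \<infinity>"
    using assms by (auto simp: WR_Linf_L1w_def)
  show G [measurable]: "locmaxR \<mu> V g \<in> borel_measurable \<mu>"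
    using assms by (simp add: WR_Linf_L1w_def)
  have "ennreal c * (\<integral>\<^sup>+s. locmaxR \<mu> V g s \<partial>\<mu>) = (\<integral>\<^sup>+s. ennreal c * locmaxR \<mu> V g s \<partial>\<mu>)"
    by (intro nn_integral_cmult[symmetric]) measurable
  also have "\<dots> \<le> (\<integral>\<^sup>+x. locmaxR \<mu> V g x * ennreal (w x) \<partial>\<mu>)"
    unfolding mult.commute[of "ennreal c"] using c by (intro nn_integral_mono mult_left_mono ennreal_leI) auto
  finally have "ennreal c * (\<integral>\<^sup>+s. locmaxR \<mu> V g s \<partial>\<mu>) < \<infinity>"
    using fin by (rule order_le_less_trans)
  then show "(\<integral>\<^sup>+s. locmaxR \<mu> V g s \<partial>\<mu>) < \<infinity>"
    using c(1) by (auto simp: ennreal_mult_less_top)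
  have "ennreal c * (\<integral>\<^sup>+s. locmaxR \<mu> V g s * ennreal (\<Delta> (- s)) \<partial>\<mu>) = (\<integral>\<^sup>+s. ennreal c * (locmaxR \<mu> V g s * ennreal (\<Delta> (- s))) \<partial>\<mu>)"
    by (intro nn_integral_cmult[symmetric]) measurable
  also have "\<dots> = (\<integral>\<^sup>+s. locmaxR \<mu> V g s * ennreal (c * \<Delta> (- s)) \<partial>\<mu>)"
    using c(1) by (simp add: ennreal_mult' mult_ac)
  also have "\<dots> \<le> (\<integral>\<^sup>+x. locmaxR \<mu> V g x * ennreal (w x) \<partial>\<mu>)"
    using c by (intro nn_integral_mono mult_left_mono ennreal_leI) auto
  finally have "ennreal c * (\<integral>\<^sup>+s. locmaxR \<mu> V g s * ennreal (\<Delta> (- s)) \<partial>\<mu>) < \<infinity>"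
    using fin by (rule order_le_less_trans)
  then show fin1: "(\<integral>\<^sup>+s. locmaxR \<mu> V g s * ennreal (\<Delta> (- s)) \<partial>\<mu>) < \<infinity>"
    using c(1) by (auto simp: ennreal_mult_less_top)
  show "AE z in \<mu>. \<kappa> * ennreal (cmod (g z)) \<le> smear (locmaxR \<mu> V g) z"
  proof (rule smear_dominates[OF _ G _ fin1])
    show "(\<lambda>z. ennreal (cmod (g z))) \<in> borel_measurable \<mu>" by measurable
    show "AE v in \<mu>. v \<in> V \<longrightarrow> ennreal (cmod (g (v + s))) \<le> locmaxR \<mu> V g s" for s
      unfolding locmaxR_def by (rule AE_le_Inf_AE_bounds)
  qed
qed

text \<open>All three facts are read off from the majorant \<open>smear\<close>: its integral, its
  integral after inversion and its uniform bound, each divided by \<open>\<kappa>\<close>.\<close>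

lemma WR_integrals_finite:
  assumes g: "g \<in> WR_Linf_L1w \<mu> V w"
  shows "(\<integral>\<^sup>+z. ennreal (cmod (g z)) \<partial>\<mu>) < \<infinity>"
    and "(\<integral>\<^sup>+z. ennreal (cmod (g (- z))) \<partial>\<mu>) < \<infinity>"
    and "\<exists>M::real. AE z in \<mu>. cmod (g z) \<le> M"
proof -
  note G = WR_dominates[OF g]
  have gm [measurable]: "g \<in> borel_measurable \<mu>"
    using g by (auto simp: WR_Linf_L1w_def)
  have "\<kappa> * (\<integral>\<^sup>+z. ennreal (cmod (g z)) \<partial>\<mu>) = (\<integral>\<^sup>+z. \<kappa> * ennreal (cmod (g z)) \<partial>\<mu>)"
    by (intro nn_integral_cmult[symmetric]) measurable
  also have "\<dots> \<le> (\<integral>\<^sup>+z. smear (locmaxR \<mu> V g) z \<partial>\<mu>)"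
    by (rule nn_integral_mono_AE[OF G(4)])
  also have "\<dots> < \<infinity>"
    unfolding nn_integral_smear[OF G(1)] using G(2) V_finite by (simp add: ennreal_mult_less_top)
  finally show "(\<integral>\<^sup>+z. ennreal (cmod (g z)) \<partial>\<mu>) < \<infinity>"
    using kappa_pos by (auto simp: ennreal_mult_less_top)
  have "\<kappa> * (\<integral>\<^sup>+z. ennreal (cmod (g (- z))) \<partial>\<mu>) = (\<integral>\<^sup>+z. \<kappa> * ennreal (cmod (g (- z))) \<partial>\<mu>)"
    by (intro nn_integral_cmult[symmetric] measurable_compose_translations(4)[of "\<lambda>z. ennreal (cmod (g z))"]) measurable
  also have "\<dots> \<le> (\<integral>\<^sup>+z. smear (locmaxR \<mu> V g) (- z) \<partial>\<mu>)"
    by (rule nn_integral_mono_AE[OF AE_uminus[OF G(4)]])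
  also have "\<dots> < \<infinity>"
    unfolding nn_integral_smear_uminus[OF G(1)] using G(3) V_finite by (simp add: ennreal_mult_less_top)
  finally show "(\<integral>\<^sup>+z. ennreal (cmod (g (- z))) \<partial>\<mu>) < \<infinity>"
    using kappa_pos by (auto simp: ennreal_mult_less_top)
  let ?B = "(\<integral>\<^sup>+s. locmaxR \<mu> V g s * ennreal (\<Delta> (- s)) \<partial>\<mu>) / \<kappa>"
  have B: "?B < \<infinity>"
    using G(3) kappa_pos by (auto simp: ennreal_divide_eq_top_iff top.not_eq_extremum[symmetric])
  from G(4) have "AE z in \<mu>. cmod (g z) \<le> enn2real ?B"
  proof eventually_elim
    case (elim z)
    then have "\<kappa> * ennreal (cmod (g z)) \<le> (\<integral>\<^sup>+s. locmaxR \<mu> V g s * ennreal (\<Delta> (- s)) \<partial>\<mu>)"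
      using smear_le[OF G(1)] by (rule order_trans)
    then have "ennreal (cmod (g z)) \<le> ?B"
      using kappa_pos kappa_finite by (intro ennreal_le_divide_of_mult_le) auto
    then show ?case
      using B by (cases ?B) auto
  qed
  then show "\<exists>M::real. AE z in \<mu>. cmod (g z) \<le> M" by blast
qed

text \<open>The kernel bound is assumed on the amalgam space, the orthogonality on square-integrable
  functions; this inclusion lets both be used for the same f. Cauchy-Schwarz on a translate of V
  gives a bound uniform in the translate, and w is bounded below.\<close>

lemma L2_subset_amalgam:
  assumes f: "f \<in> L2 \<mu>"
  shows "f \<in> W_L1_Linfw \<mu> V w"
proof -
  obtain c where c: "0 < c" "\<And>x. c \<le> w x" "\<And>x. c * \<Delta> (- x) \<le> w x"
    using weight_lower_bound by blast
  have fm [measurable]: "f \<in> borel_measurable \<mu>"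
    using f by (rule L2_measurable)
  have CS: "(\<integral>\<^sup>+y. indicator A y * ennreal (cmod (f y)) \<partial>\<mu>) \<le> 1 + emeasure \<mu> A * ennreal ((L2norm \<mu> f)\<^sup>2)"
    if A [measurable]: "A \<in> sets \<mu>" for A
  proof -
    have "(\<integral>\<^sup>+y. indicator A y * ennreal (cmod (f y)) \<partial>\<mu>)\<^sup>2 \<le> (\<integral>\<^sup>+y. (indicator A y)\<^sup>2 \<partial>\<mu>) * (\<integral>\<^sup>+y. (ennreal (cmod (f y)))\<^sup>2 \<partial>\<mu>)"
      by (rule Cauchy_Schwarz_nn_integral) measurable
    also have "(\<integral>\<^sup>+y. (indicator A y)\<^sup>2 \<partial>\<mu>) = (\<integral>\<^sup>+y. indicator A y \<partial>\<mu>)"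
      by (intro nn_integral_cong) (simp add: indicator_def)
    also have "\<dots> = emeasure \<mu> A"
      using A by simp
    also have "(\<integral>\<^sup>+y. (ennreal (cmod (f y)))\<^sup>2 \<partial>\<mu>) = ennreal ((L2norm \<mu> f)\<^sup>2)"
      using nn_integral_L2norm[OF f] by (simp add: ennreal_power)
    finally show ?thesis
      by (rule order_trans[OF ennreal_le_one_plus_square add_left_mono])
  qed
  have 1: "(\<integral>\<^sup>+y. indicator A y * ennreal (cmod (f y)) \<partial>\<mu>) < \<infinity>" if "compact A" for A
    by (rule order_le_less_trans[OF CS[OF compact_sets_mu[OF that]]])
      (use emeasure_compact[OF that] in \<open>simp add: ennreal_mult_less_top\<close>)
  let ?B = "1 + emeasure \<mu> V * ennreal ((L2norm \<mu> f)\<^sup>2)"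
  have "(\<integral>\<^sup>+y. indicator ((\<lambda>v. x + v) ` V) y * ennreal (cmod (f y)) \<partial>\<mu>) / ennreal (w x) \<le> ?B / ennreal c" for x
  proof -
    have s: "(\<lambda>v. x + v) ` V \<in> sets \<mu>"
      using measurable_sets[OF measurable_translations(1)[of "- x"] V_sets] by (simp add: left_translation_image)
    have "emeasure \<mu> ((\<lambda>v. x + v) ` V) = emeasure \<mu> V"
      by (simp add: left_translation_image emeasure_left)
    then have "(\<integral>\<^sup>+y. indicator ((\<lambda>v. x + v) ` V) y * ennreal (cmod (f y)) \<partial>\<mu>) \<le> ?B"
      using CS[OF s] by simp
    moreover have "inverse (ennreal (w x)) \<le> inverse (ennreal c)"
      using c(1) c(2)[of x] by (simp add: inverse_ennreal ennreal_leI le_imp_inverse_le)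
    ultimately show ?thesis
      unfolding divide_ennreal_def by (intro mult_mono) auto
  qed
  then have "W_L1_Linfw_norm \<mu> V w f \<le> ?B / ennreal c"
    unfolding W_L1_Linfw_norm_def by (intro Inf_lower) simp
  also have "\<dots> < \<infinity>"
    using c(1) V_finite by (simp add: ennreal_divide_eq_top_iff ennreal_mult_eq_top_iff top.not_eq_extremum[symmetric])
  finally show ?thesis
    using 1 by (simp add: W_L1_Linfw_def)
qed

end

section \<open>Orthogonality, the kernel bound and point evaluations on S\<close>

locale phase_space =
  fixes \<mu> :: "'g::{topological_group_add,t2_space} measure"
    and \<Delta> w :: "'g \<Rightarrow> real" and V :: "'g set"
    and S :: "('g \<Rightarrow> complex) set" and P :: "('g \<Rightarrow> complex) \<Rightarrow> ('g \<Rightarrow> complex)"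
  assumes setting: "phase_space_setting \<mu> \<Delta> w V S P"
begin

sublocale weighted_haar_group \<mu> \<Delta> w V
  using setting unfolding phase_space_setting_def by unfold_locales auto

lemma S_subspace: "closed_continuous_subspace \<mu> S"
  using setting unfolding phase_space_setting_def by (elim conjE)

lemma S_L2: "f \<in> S \<Longrightarrow> f \<in> L2 \<mu>"
  and S_continuous: "f \<in> S \<Longrightarrow> continuous_on UNIV f"
  and S_zero: "(\<lambda>x. 0) \<in> S"
  and S_add: "f \<in> S \<Longrightarrow> g \<in> S \<Longrightarrow> (\<lambda>x. f x + g x) \<in> S"
  and S_cmult: "f \<in> S \<Longrightarrow> (\<lambda>x. c * f x) \<in> S"
  using S_subspace unfolding closed_continuous_subspace_def by (elim conjE; blast)+

lemma S_diff: "f \<in> S \<Longrightarrow> g \<in> S \<Longrightarrow> (\<lambda>x. f x - g x) \<in> S"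
  using S_add[OF _ S_cmult[of g "-1"], of f] by simp

lemma S_sum: "(\<And>i. i \<in> I \<Longrightarrow> f i \<in> S) \<Longrightarrow> (\<lambda>x. \<Sum>i\<in>I. f i x) \<in> S"
  by (induction I rule: infinite_finite_induct) (auto simp: S_zero S_add)

lemma S_measurable: "f \<in> S \<Longrightarrow> f \<in> borel_measurable \<mu>"
  by (rule L2_measurable[OF S_L2])

lemma P_measurable: "f \<in> L2 \<mu> \<Longrightarrow> P f \<in> borel_measurable \<mu>"
  using setting L2_subset_amalgam[of f] unfolding phase_space_setting_def by (elim conjE) blast

lemma P_linear:
  assumes "f \<in> L2 \<mu>" "g \<in> L2 \<mu>"
  shows "AE x in \<mu>. P (\<lambda>y. a * f y + b * g y) x = a * P f x + b * P g x"
  using setting L2_subset_amalgam[OF assms(1)] L2_subset_amalgam[OF assms(2)]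
  unfolding phase_space_setting_def by (elim conjE) blast

lemma P_into_S: "f \<in> L2 \<mu> \<Longrightarrow> \<exists>g\<in>S. AE x in \<mu>. P f x = g x"
  and P_on_S: "f \<in> S \<Longrightarrow> AE x in \<mu>. P f x = f x"
  and P_orthogonal: "f \<in> L2 \<mu> \<Longrightarrow> h \<in> S \<Longrightarrow> L2inner \<mu> (\<lambda>x. f x - P f x) h = 0"
  using setting unfolding phase_space_setting_def by (elim conjE; blast)+

lemma P_L2: "f \<in> L2 \<mu> \<Longrightarrow> P f \<in> L2 \<mu>"
  using P_into_S[of f] L2_cong_AE[OF P_measurable S_L2] by blast

lemma P_inner:
  assumes "f \<in> L2 \<mu>" "h \<in> S"
  shows "L2inner \<mu> (P f) h = L2inner \<mu> f h"
  using P_orthogonal[OF assms] L2inner_diff_left[OF assms(1) P_L2[OF assms(1)] S_L2[OF assms(2)]] by simp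

text \<open>The integral of K comes from \<open>W_Linf_L1w\<close> by double counting; the integral
  of K(x^-1) and the essential bound come from \<open>WR_Linf_L1w\<close> by smearing.\<close>

lemma kernel:
  obtains K :: "'g \<Rightarrow> real" where "\<And>x. 0 \<le> K x" "(\<lambda>x. ennreal (K x)) \<in> borel_measurable \<mu>"
    "K \<in> borel_measurable \<mu>"
    "(\<integral>\<^sup>+x. ennreal (K x) \<partial>\<mu>) < \<infinity>" "(\<integral>\<^sup>+x. ennreal (K (- x)) \<partial>\<mu>) < \<infinity>"
    "\<exists>M. AE x in \<mu>. K x \<le> M"
    "\<And>f. f \<in> L2 \<mu> \<Longrightarrow> AE x in \<mu>. ennreal (cmod (P f x)) \<le> (\<integral>\<^sup>+y. ennreal (cmod (f y)) * ennreal (K (- y + x)) \<partial>\<mu>)"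
proof -
  have "\<exists>K::'g \<Rightarrow> real. (\<forall>x. K x \<ge> 0) \<and>
         (\<lambda>x. complex_of_real (K x)) \<in> W_Linf_L1w \<mu> V w \<and>
         (\<lambda>x. complex_of_real (K x)) \<in> WR_Linf_L1w \<mu> V w \<and>
         (\<forall>f\<in>W_L1_Linfw \<mu> V w. AE x in \<mu>.
            ennreal (cmod (P f x)) \<le> (\<integral>\<^sup>+y. ennreal (cmod (f y)) * ennreal (K (- y + x)) \<partial>\<mu>))"
    using setting unfolding phase_space_setting_def by (elim conjE)
  then obtain K :: "'g \<Rightarrow> real" where K: "\<And>x. K x \<ge> 0"
         "(\<lambda>x. complex_of_real (K x)) \<in> W_Linf_L1w \<mu> V w"
         "(\<lambda>x. complex_of_real (K x)) \<in> WR_Linf_L1w \<mu> V w"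
         "\<And>f. f\<in>W_L1_Linfw \<mu> V w \<Longrightarrow> AE x in \<mu>.
            ennreal (cmod (P f x)) \<le> (\<integral>\<^sup>+y. ennreal (cmod (f y)) * ennreal (K (- y + x)) \<partial>\<mu>)"
    by blast
  let ?K = "\<lambda>x. complex_of_real (K x)"
  have abs: "cmod (?K x) = K x" for x
    using K(1) by simp
  have Km: "?K \<in> borel_measurable \<mu>" and H [measurable]: "locmax \<mu> V ?K \<in> borel_measurable \<mu>"
    and fin: "(\<integral>\<^sup>+x. locmax \<mu> V ?K x * ennreal (w x) \<partial>\<mu>) < \<infinity>"
    using K(2) by (auto simp: W_Linf_L1w_def)
  have Kr [measurable]: "K \<in> borel_measurable \<mu>"
    using measurable_compose[OF Km borel_measurable_Re] by simp
  obtain c where c: "0 < c" "\<And>x. c \<le> w x" "\<And>x. c * \<Delta> (- x) \<le> w x"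
    using weight_lower_bound by blast
  have "ennreal c * (\<integral>\<^sup>+s. locmax \<mu> V ?K s \<partial>\<mu>) = (\<integral>\<^sup>+s. ennreal c * locmax \<mu> V ?K s \<partial>\<mu>)"
    by (intro nn_integral_cmult[symmetric]) measurable
  also have "\<dots> \<le> (\<integral>\<^sup>+x. locmax \<mu> V ?K x * ennreal (w x) \<partial>\<mu>)"
    unfolding mult.commute[of "ennreal c"] using c by (intro nn_integral_mono mult_left_mono ennreal_leI) auto
  finally have "ennreal c * (\<integral>\<^sup>+s. locmax \<mu> V ?K s \<partial>\<mu>) < \<infinity>"
    using fin by (rule order_le_less_trans)
  then have Hfin: "(\<integral>\<^sup>+s. locmax \<mu> V ?K s \<partial>\<mu>) < \<infinity>"
    using c(1) by (auto simp: ennreal_mult_less_top)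
  have "AE v in \<mu>. v \<in> V \<longrightarrow> ennreal (K (s + v)) \<le> locmax \<mu> V ?K s" for s
    unfolding locmax_def abs by (rule AE_le_Inf_AE_bounds)
  then have "(\<integral>\<^sup>+y. ennreal (K y) \<partial>\<mu>) * emeasure \<mu> V \<le> (\<integral>\<^sup>+s. locmax \<mu> V ?K s \<partial>\<mu>) * emeasure \<mu> V"
    by (intro nn_integral_le_left_dominated H) auto
  also have "\<dots> < \<infinity>"
    using Hfin V_finite by (simp add: ennreal_mult_less_top)
  finally have "(\<integral>\<^sup>+y. ennreal (K y) \<partial>\<mu>) < \<infinity>"
    using V_pos by (auto simp: ennreal_mult_less_top)
  moreover note WR_integrals_finite(2,3)[OF K(3), unfolded abs]
  ultimately show thesis
    using K(1) Kr K(4)[OF L2_subset_amalgam] by (intro that[of K]) auto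
qed

text \<open>Replacing y by xy removes x, so estimates involving K(y^-1 x) are uniform in x.\<close>

lemma reflected_translated_integral:
  fixes h :: "'g \<Rightarrow> ennreal"
  assumes "h \<in> borel_measurable \<mu>"
  shows "(\<integral>\<^sup>+y. h (- y + x) \<partial>\<mu>) = (\<integral>\<^sup>+y. h (- y) \<partial>\<mu>)"
  using nn_integral_left[OF measurable_compose_translations(6)[OF assms], of x x]
  by (simp add: minus_add add.assoc)

text \<open>Point evaluations are uniformly bounded on S, as for a reproducing kernel: f = Pf, and
  Cauchy-Schwarz is applied to the kernel bound. The control of eigenvalue sums rests on
  this.\<close>

lemma pointwise_bound:
  obtains D :: real where "0 \<le> D" "\<And>h x. h \<in> S \<Longrightarrow> (cmod (h x))\<^sup>2 \<le> D * (L2norm \<mu> h)\<^sup>2"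
proof -
  obtain K :: "'g \<Rightarrow> real" where K: "\<And>x. 0 \<le> K x" "(\<lambda>x. ennreal (K x)) \<in> borel_measurable \<mu>"
    "K \<in> borel_measurable \<mu>"
    "(\<integral>\<^sup>+x. ennreal (K x) \<partial>\<mu>) < \<infinity>" "(\<integral>\<^sup>+x. ennreal (K (- x)) \<partial>\<mu>) < \<infinity>"
    "\<exists>M. AE x in \<mu>. K x \<le> M"
    "\<And>f. f \<in> L2 \<mu> \<Longrightarrow> AE x in \<mu>. ennreal (cmod (P f x)) \<le> (\<integral>\<^sup>+y. ennreal (cmod (f y)) * ennreal (K (- y + x)) \<partial>\<mu>)"
    using kernel by blast
  note [measurable] = K(2)
  obtain M where M: "AE x in \<mu>. K x \<le> M"
    using K(6) by blast
  \<comment> \<open>Bounds the integral over y of K(y^-1 x)^2 for all x at once: one factor is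
    replaced by its essential bound, the other is integrated.\<close>
  define E where "E = ennreal (max 0 M) * (\<integral>\<^sup>+x. ennreal (K (- x)) \<partial>\<mu>)"
  have E: "E < top"
    unfolding E_def using K(5) by (simp add: ennreal_mult_less_top)
  have K2: "(\<integral>\<^sup>+y. (ennreal (K (- y + x)))\<^sup>2 \<partial>\<mu>) \<le> E" for x
  proof -
    have "AE y in \<mu>. (ennreal (K y))\<^sup>2 \<le> ennreal (max 0 M) * ennreal (K y)"
      using M unfolding power2_eq_square by eventually_elim (auto intro!: mult_right_mono ennreal_leI)
    then have "(\<integral>\<^sup>+y. (ennreal (K (- y + x)))\<^sup>2 \<partial>\<mu>) \<le> (\<integral>\<^sup>+y. ennreal (max 0 M) * ennreal (K (- y + x)) \<partial>\<mu>)"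
      by (intro nn_integral_mono_AE AE_uminus_add)
    also have "\<dots> = ennreal (max 0 M) * (\<integral>\<^sup>+y. ennreal (K (- y + x)) \<partial>\<mu>)"
      by (intro nn_integral_cmult measurable_compose_translations(6)[OF K(2)])
    also have "(\<integral>\<^sup>+y. ennreal (K (- y + x)) \<partial>\<mu>) = (\<integral>\<^sup>+x. ennreal (K (- x)) \<partial>\<mu>)"
      by (rule reflected_translated_integral[OF K(2)])
    finally show ?thesis
      unfolding E_def .
  qed
  have "(cmod (h x))\<^sup>2 \<le> enn2real E * (L2norm \<mu> h)\<^sup>2" if h: "h \<in> S" for h x
  proof -
    have hm [measurable]: "h \<in> borel_measurable \<mu>"
      by (rule S_measurable[OF h])
    have ae: "AE x in \<mu>. (cmod (h x))\<^sup>2 \<le> enn2real E * (L2norm \<mu> h)\<^sup>2"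
      using K(7)[OF S_L2[OF h]] P_on_S[OF h]
    proof eventually_elim
      case (elim x)
      have "(ennreal (cmod (h x)))\<^sup>2 \<le> (\<integral>\<^sup>+y. ennreal (cmod (h y)) * ennreal (K (- y + x)) \<partial>\<mu>)\<^sup>2"
        using elim by (intro power_mono) auto
      also have "\<dots> \<le> (\<integral>\<^sup>+y. (ennreal (cmod (h y)))\<^sup>2 \<partial>\<mu>) * (\<integral>\<^sup>+y. (ennreal (K (- y + x)))\<^sup>2 \<partial>\<mu>)"
        by (intro Cauchy_Schwarz_nn_integral measurable_compose_translations(6)[OF K(2)]) measurable
      also have "\<dots> \<le> ennreal ((L2norm \<mu> h)\<^sup>2) * E"
        using nn_integral_L2norm[OF S_L2[OF h]] K2 by (intro mult_mono) (auto simp: ennreal_power)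
      also have "\<dots> = ennreal (enn2real E * (L2norm \<mu> h)\<^sup>2)"
        using E by (cases E) (auto simp: ennreal_mult mult.commute)
      finally show ?case
        by (simp add: ennreal_power)
    qed
    \<comment> \<open>From almost every x to every x: \<open>h\<close> is continuous, so the
      exceptional set is open, and a nonempty open set has positive measure.\<close>
    let ?O = "{x. enn2real E * (L2norm \<mu> h)\<^sup>2 < (cmod (h x))\<^sup>2}"
    have "open ?O"
      by (intro open_Collect_less continuous_intros S_continuous[OF h])
    moreover have "emeasure \<mu> ?O = 0"
    proof -
      have "?O \<in> sets \<mu>"
        using \<open>open ?O\<close> by (simp add: sets_mu)
      then show ?thesis
        using AE_iff_measurable[of ?O \<mu> "\<lambda>x. (cmod (h x))\<^sup>2 \<le> enn2real E * (L2norm \<mu> h)\<^sup>2"] ae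
        by (simp add: not_le)
    qed
    ultimately have "?O = {}"
      using emeasure_open_pos[of ?O] by (metis less_irrefl)
    then show ?thesis
      by (metis (mono_tags, lifting) empty_iff mem_Collect_eq not_le)
  qed
  then show thesis
    by (intro that[of "enn2real E"]) auto
qed

text \<open>The bound for point evaluation is tested on the combination with coefficients cnj
  (\<open>phi k x\<close>): its value at x and its squared norm are both the sum s, so s^2 is at
  most D s.\<close>

lemma orthonormal_pointwise_bound:
  obtains D :: real where "0 \<le> D"
    "\<And>(I::nat set) phi x. finite I \<Longrightarrow> (\<And>k. k \<in> I \<Longrightarrow> phi k \<in> S) \<Longrightarrow>
      (\<And>k l. k \<in> I \<Longrightarrow> l \<in> I \<Longrightarrow> L2inner \<mu> (phi k) (phi l) = (if k = l then 1 else 0)) \<Longrightarrow>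
      (\<Sum>k\<in>I. (cmod (phi k x))\<^sup>2) \<le> D"
proof -
  obtain D :: real where D: "0 \<le> D" "\<And>h x. h \<in> S \<Longrightarrow> (cmod (h x))\<^sup>2 \<le> D * (L2norm \<mu> h)\<^sup>2"
    using pointwise_bound by blast
  have "(\<Sum>k\<in>I. (cmod (phi k x))\<^sup>2) \<le> D"
    if I: "finite I" "\<And>k. k \<in> I \<Longrightarrow> phi k \<in> S"
      "\<And>k l. k \<in> I \<Longrightarrow> l \<in> I \<Longrightarrow> L2inner \<mu> (phi k) (phi l) = (if k = l then 1 else 0)"
    for I :: "nat set" and phi x
  proof -
    define s where "s = (\<Sum>k\<in>I. (cmod (phi k x))\<^sup>2)"
    have s0: "0 \<le> s"
      unfolding s_def by (intro sum_nonneg) simp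
    let ?h = "\<lambda>y. \<Sum>k\<in>I. cnj (phi k x) * phi k y"
    have h: "?h \<in> S"
      by (intro S_sum S_cmult I)
    have "(L2norm \<mu> ?h)\<^sup>2 = (\<Sum>k\<in>I. (cmod (cnj (phi k x)))\<^sup>2)"
      by (rule L2_orthonormal_sum(1)[where phi = phi and a = "\<lambda>k. cnj (phi k x)", OF I(1)])
         (use I S_L2 in auto)
    then have n: "(L2norm \<mu> ?h)\<^sup>2 = s"
      by (simp add: s_def)
    have "?h x = complex_of_real s"
      unfolding s_def of_real_sum complex_norm_square by (simp add: mult.commute)
    then have "(cmod (?h x))\<^sup>2 = s\<^sup>2"
      by simp
    then have "s * s \<le> D * s"
      using D(2)[OF h, of x] n by (simp add: power2_eq_square)
    then have "s \<le> D"
      using s0 D(1) by (cases "s = 0") auto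
    then show ?thesis
      by (simp add: s_def)
  qed
  with D(1) show thesis
    by (rule that)
qed

end

section \<open>Localization of the symbols\<close>

locale phase_space_symbols = phase_space \<mu> \<Delta> w V S P
  for \<mu> :: "'g::{topological_group_add,t2_space} measure"
    and \<Delta> w :: "'g \<Rightarrow> real" and V :: "'g set"
    and S :: "('g \<Rightarrow> complex) set" and P :: "('g \<Rightarrow> complex) \<Rightarrow> ('g \<Rightarrow> complex)" +
  fixes \<Gamma> :: "'g set" and \<eta> :: "'g \<Rightarrow> 'g \<Rightarrow> real"
  assumes spread: "well_spread \<mu> V w \<Gamma> \<eta>"
    and meas: "\<gamma> \<in> \<Gamma> \<Longrightarrow> \<eta> \<gamma> \<in> borel_measurable \<mu>"
    and nonneg: "\<gamma> \<in> \<Gamma> \<Longrightarrow> \<eta> \<gamma> x \<ge> 0"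
    and approx1: "sum_approx_one \<mu> \<Gamma> \<eta>"
begin

lemma separated:
  obtains n :: nat where "\<And>x. finite (\<Gamma> \<inter> (\<lambda>v. x + v) ` V) \<and> card (\<Gamma> \<inter> (\<lambda>v. x + v) ` V) \<le> n"
  using spread unfolding well_spread_def by blast

lemma envelope:
  obtains g where "g \<in> WR_Linf_L1w \<mu> V w" "\<And>\<gamma> x. \<gamma> \<in> \<Gamma> \<Longrightarrow> \<eta> \<gamma> x \<le> cmod (g (- \<gamma> + x))"
proof -
  obtain g where g: "g \<in> WR_Linf_L1w \<mu> V w" "\<And>\<gamma> x. \<gamma> \<in> \<Gamma> \<Longrightarrow> \<bar>\<eta> \<gamma> x\<bar> \<le> cmod (g (- \<gamma> + x))"
    using spread unfolding well_spread_def by blast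
  show thesis
    using g by (intro that[of g]) (auto intro: order_trans[OF abs_ge_self])
qed

lemma countable_index: "countable \<Gamma>"
  using separated separated_countable by metis

lemma sum_bounds:
  obtains A B :: real where "0 < A" "A \<le> B"
    "\<And>F. finite F \<Longrightarrow> F \<subseteq> \<Gamma> \<Longrightarrow> AE x in \<mu>. (\<Sum>\<gamma>\<in>F. \<eta> \<gamma> x) \<le> B"
    "AE x in \<mu>. (\<lambda>\<gamma>. \<eta> \<gamma> x) summable_on \<Gamma> \<and> A \<le> (\<Sum>\<^sub>\<infinity>\<gamma>\<in>\<Gamma>. \<eta> \<gamma> x)"
proof -
  obtain A B where AB: "0 < A" "A \<le> B" and ae: "AE x in \<mu>. (\<lambda>\<gamma>. \<eta> \<gamma> x) summable_on \<Gamma> \<and>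
                     A \<le> (\<Sum>\<^sub>\<infinity>\<gamma>\<in>\<Gamma>. \<eta> \<gamma> x) \<and> (\<Sum>\<^sub>\<infinity>\<gamma>\<in>\<Gamma>. \<eta> \<gamma> x) \<le> B"
    using approx1 unfolding sum_approx_one_def by blast
  show thesis
  proof (rule that[OF AB])
    fix F assume F: "finite F" "F \<subseteq> \<Gamma>"
    from ae show "AE x in \<mu>. (\<Sum>\<gamma>\<in>F. \<eta> \<gamma> x) \<le> B"
    proof eventually_elim
      case (elim x)
      have "(\<Sum>\<gamma>\<in>F. \<eta> \<gamma> x) \<le> (\<Sum>\<^sub>\<infinity>\<gamma>\<in>\<Gamma>. \<eta> \<gamma> x)"
        using elim F nonneg by (intro finite_sum_le_infsum) auto
      then show ?case using elim by linarith
    qed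
  qed (use ae in eventually_elim, auto)
qed

lemma symbol_bounded:
  obtains B :: real where "0 < B" "\<And>\<gamma>. \<gamma> \<in> \<Gamma> \<Longrightarrow> AE x in \<mu>. \<eta> \<gamma> x \<le> B"
    "\<And>F. finite F \<Longrightarrow> F \<subseteq> \<Gamma> \<Longrightarrow> AE x in \<mu>. (\<Sum>\<gamma>\<in>F. \<eta> \<gamma> x) \<le> B"
proof -
  obtain A B :: real where AB: "0 < A" "A \<le> B"
    "\<And>F. finite F \<Longrightarrow> F \<subseteq> \<Gamma> \<Longrightarrow> AE x in \<mu>. (\<Sum>\<gamma>\<in>F. \<eta> \<gamma> x) \<le> B"
    using sum_bounds by metis
  have "AE x in \<mu>. \<eta> \<gamma> x \<le> B" if "\<gamma> \<in> \<Gamma>" for \<gamma>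
    using AB(3)[of "{\<gamma>}"] that by simp
  then show thesis
    using AB by (intro that[of B]) auto
qed

lemma symbol_integrable:
  assumes "\<gamma> \<in> \<Gamma>"
  shows "integrable \<mu> (\<eta> \<gamma>)"
proof -
  obtain g where g: "g \<in> WR_Linf_L1w \<mu> V w" "\<And>\<gamma> x. \<gamma> \<in> \<Gamma> \<Longrightarrow> \<eta> \<gamma> x \<le> cmod (g (- \<gamma> + x))"
    using envelope by blast
  have [measurable]: "g \<in> borel_measurable \<mu>"
    using g(1) by (auto simp: WR_Linf_L1w_def)
  have "(\<integral>\<^sup>+x. ennreal (\<eta> \<gamma> x) \<partial>\<mu>) \<le> (\<integral>\<^sup>+x. ennreal (cmod (g (- \<gamma> + x))) \<partial>\<mu>)"
    using g(2)[OF assms] by (intro nn_integral_mono ennreal_leI)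
  also have "\<dots> = (\<integral>\<^sup>+x. ennreal (cmod (g x)) \<partial>\<mu>)"
    by (intro nn_integral_left[of "\<lambda>x. ennreal (cmod (g x))"]) measurable
  also have "\<dots> < \<infinity>"
    by (rule WR_integrals_finite(1)[OF g(1)])
  finally show ?thesis
    using meas[OF assms] nonneg[OF assms] by (intro integrableI_nonneg) auto
qed

text \<open>If \<gamma>^-1 y is outside \<open>U\<close>, then for every x either y^-1 x or
  \<gamma>^-1 x is far out. In the first case the symbols add up to at most B while the tail of K is
  small; in the second the smeared envelope has a small tail while K need only be
  integrable.\<close>

lemma far_symbols_small:
  assumes "0 < \<theta>" and K: "(\<lambda>x. ennreal (K x)) \<in> borel_measurable \<mu>" "(\<integral>\<^sup>+x. ennreal (K x) \<partial>\<mu>) < \<infinity>"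
  obtains U where "compact U"
    "\<And>F y. finite F \<Longrightarrow> F \<subseteq> \<Gamma> \<Longrightarrow> (\<Sum>\<gamma>\<in>{\<gamma>\<in>F. - \<gamma> + y \<notin> U}. \<integral>\<^sup>+x. ennreal (\<eta> \<gamma> x) * ennreal (K (- y + x)) \<partial>\<mu>) \<le> ennreal \<theta>"
proof -
  obtain n :: nat where n: "\<And>x. finite (\<Gamma> \<inter> (\<lambda>v. x + v) ` V) \<and> card (\<Gamma> \<inter> (\<lambda>v. x + v) ` V) \<le> n"
    using separated by blast
  obtain g where g: "g \<in> WR_Linf_L1w \<mu> V w" "\<And>\<gamma> x. \<gamma> \<in> \<Gamma> \<Longrightarrow> \<eta> \<gamma> x \<le> cmod (g (- \<gamma> + x))"
    using envelope by blast
  obtain B :: real where B: "0 < B"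
    "\<And>F. finite F \<Longrightarrow> F \<subseteq> \<Gamma> \<Longrightarrow> AE x in \<mu>. (\<Sum>\<gamma>\<in>F. \<eta> \<gamma> x) \<le> B"
    using symbol_bounded by metis
  define G where "G = locmaxR \<mu> V g"
  note Gf = WR_dominates[OF g(1), folded G_def]
  note [measurable] = K(1) Gf(1)
  \<comment> \<open>The coefficient of \<open>\<delta>\<close> in the final estimate: B from x with
    y^-1 x outside \<open>Q\<close>, the other summand from x with y^-1 x inside. Dividing \<theta>
    by \<open>X' + 1\<close> then absorbs it.\<close>
  define X where "X = ennreal B + of_nat n / \<kappa> * (\<integral>\<^sup>+x. ennreal (K x) \<partial>\<mu>)"
  have "of_nat n / \<kappa> < top"
    using kappa_pos by (auto simp: ennreal_divide_eq_top_iff top.not_eq_extremum[symmetric])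
  then have "X < top"
    unfolding X_def using K(2) by (simp add: ennreal_mult_less_top)
  then obtain X' where X': "X = ennreal X'" "0 \<le> X'"
    by (cases X) auto
  define \<delta> where "\<delta> = \<theta> / (X' + 1)"
  have \<delta>: "0 < \<delta>" "\<delta> * X' \<le> \<theta>"
    using \<open>0 < \<theta>\<close> X'(2) by (auto simp: \<delta>_def field_simps)
  obtain Q where Q: "compact Q" "(\<integral>\<^sup>+x. indicator (- Q) x * ennreal (K x) \<partial>\<mu>) < ennreal \<delta>"
    using nn_integral_tail_small[OF K, of "ennreal \<delta>"] \<delta>(1) by auto
  have "(\<lambda>s. G s * ennreal (\<Delta> (- s))) \<in> borel_measurable \<mu>"
    by measurable
  from nn_integral_tail_small[OF this Gf(3), of "ennreal \<delta>"] \<delta>(1)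
  obtain U' where U': "compact U'" "(\<integral>\<^sup>+s. indicator (- U') s * (G s * ennreal (\<Delta> (- s))) \<partial>\<mu>) < ennreal \<delta>"
    by auto
  \<comment> \<open>Chosen so that \<gamma>^-1 x in the sum of V and \<open>U'\<close>, together
    with y^-1 x in \<open>Q\<close>, forces \<gamma>^-1 y into \<open>U\<close>.\<close>
  define U where "U = set_sum (set_sum (closure V) U') (uminus ` Q)"
  have QC [measurable]: "- Q \<in> sets \<mu>"
    using sets.compl_sets[OF compact_sets_mu[OF Q(1)]] by (simp add: Compl_eq_Diff_UNIV)
  show thesis
  proof
    show "compact U"
      unfolding U_def by (intro compact_set_sum compact_uminus V_compact U'(1) Q(1))
    fix F y assume F: "finite F" "F \<subseteq> \<Gamma>"
    define Fy where "Fy = {\<gamma>\<in>F. - \<gamma> + y \<notin> U}"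
    have Fy: "finite Fy" "Fy \<subseteq> \<Gamma>" "Fy \<subseteq> F"
      using F by (auto simp: Fy_def)
    have em: "(\<lambda>x. ennreal (\<eta> \<gamma> x)) \<in> borel_measurable \<mu>" if "\<gamma> \<in> Fy" for \<gamma>
      using meas[of \<gamma>] that Fy(2) by auto
    have "AE x in \<mu>. \<kappa> * ennreal (cmod (g (- \<gamma> + x))) \<le> smear G (- \<gamma> + x)" for \<gamma>
      by (rule AE_left[OF Gf(4)])
    then have dom: "AE x in \<mu>. \<forall>\<gamma>\<in>Fy. \<kappa> * ennreal (cmod (g (- \<gamma> + x))) \<le> smear G (- \<gamma> + x)"
      using Fy(1) by (simp add: AE_finite_all)
    have "(\<Sum>\<gamma>\<in>Fy. \<integral>\<^sup>+x. ennreal (\<eta> \<gamma> x) * ennreal (K (- y + x)) \<partial>\<mu>)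
      = (\<integral>\<^sup>+x. (\<Sum>\<gamma>\<in>Fy. ennreal (\<eta> \<gamma> x) * ennreal (K (- y + x))) \<partial>\<mu>)"
      by (intro nn_integral_sum[symmetric] borel_measurable_times_ennreal em measurable_compose_translations(1)[OF K(1)])
    also have "\<dots> \<le> (\<integral>\<^sup>+x. ennreal B * (indicator (- Q) (- y + x) * ennreal (K (- y + x)))
        + of_nat n * ennreal \<delta> / \<kappa> * ennreal (K (- y + x)) \<partial>\<mu>)"
    proof (rule nn_integral_mono_AE)
      from dom B(2)[OF Fy(1,2)]
      show "AE x in \<mu>. (\<Sum>\<gamma>\<in>Fy. ennreal (\<eta> \<gamma> x) * ennreal (K (- y + x)))
        \<le> ennreal B * (indicator (- Q) (- y + x) * ennreal (K (- y + x)))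
          + of_nat n * ennreal \<delta> / \<kappa> * ennreal (K (- y + x))"
      proof eventually_elim
        case (elim x)
        have "(\<Sum>\<gamma>\<in>Fy. ennreal (\<eta> \<gamma> x)) \<le> ennreal B * indicator (- Q) (- y + x) + of_nat n * ennreal \<delta> / \<kappa>"
        proof (cases "- y + x \<in> Q")
          case False
          have "(\<Sum>\<gamma>\<in>Fy. ennreal (\<eta> \<gamma> x)) = ennreal (\<Sum>\<gamma>\<in>Fy. \<eta> \<gamma> x)"
            using nonneg Fy(2) by (intro sum_ennreal) auto
          also have "\<dots> \<le> ennreal B"
            using elim(2) by (rule ennreal_leI)
          finally show ?thesis
            using False by (simp add: add_increasing2)
        next
          case True
          have far: "- \<gamma> + x \<notin> set_sum (closure V) U'" if "\<gamma> \<in> Fy" for \<gamma>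
          proof
            assume "- \<gamma> + x \<in> set_sum (closure V) U'"
            then have "(- \<gamma> + x) + - (- y + x) \<in> U"
              unfolding U_def by (rule set_sumI) (use True in auto)
            also have "(- \<gamma> + x) + - (- y + x) = - \<gamma> + y"
              by (simp only: minus_add minus_minus add.assoc add_minus_cancel)
            finally show False
              using that by (simp add: Fy_def)
          qed
          have "\<kappa> * (\<Sum>\<gamma>\<in>Fy. ennreal (\<eta> \<gamma> x)) = (\<Sum>\<gamma>\<in>Fy. \<kappa> * ennreal (\<eta> \<gamma> x))"
            by (rule sum_distrib_left)
          also have "\<dots> \<le> (\<Sum>\<gamma>\<in>Fy. smear G (- \<gamma> + x))"
          proof (rule sum_mono)
            fix \<gamma> assume \<gamma>: "\<gamma> \<in> Fy"
            have "\<kappa> * ennreal (\<eta> \<gamma> x) \<le> \<kappa> * ennreal (cmod (g (- \<gamma> + x)))"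
              using g(2)[of \<gamma> x] \<gamma> Fy(2) by (intro mult_left_mono ennreal_leI) auto
            also have "\<dots> \<le> smear G (- \<gamma> + x)"
              using elim(1) \<gamma> by blast
            finally show "\<kappa> * ennreal (\<eta> \<gamma> x) \<le> smear G (- \<gamma> + x)" .
          qed
          also have "\<dots> \<le> of_nat n * (\<integral>\<^sup>+s. indicator (- U') s * (G s * ennreal (\<Delta> (- s))) \<partial>\<mu>)"
            by (rule smear_tail_sum[OF Gf(1) Fy(1,2) n compact_sets_mu[OF U'(1)] far])
          also have "\<dots> \<le> of_nat n * ennreal \<delta>"
            using U'(2) by (intro mult_left_mono) auto
          finally have "(\<Sum>\<gamma>\<in>Fy. ennreal (\<eta> \<gamma> x)) \<le> of_nat n * ennreal \<delta> / \<kappa>"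
            using kappa_pos kappa_finite by (intro ennreal_le_divide_of_mult_le) auto
          then show ?thesis
            using True by simp
        qed
        then have "(\<Sum>\<gamma>\<in>Fy. ennreal (\<eta> \<gamma> x)) * ennreal (K (- y + x))
          \<le> (ennreal B * indicator (- Q) (- y + x) + of_nat n * ennreal \<delta> / \<kappa>) * ennreal (K (- y + x))"
          by (intro mult_right_mono) auto
        then show ?case
          by (simp add: sum_distrib_right distrib_right mult.assoc)
      qed
    qed
    also have "\<dots> = (\<integral>\<^sup>+x. ennreal B * (indicator (- Q) x * ennreal (K x))
        + of_nat n * ennreal \<delta> / \<kappa> * ennreal (K x) \<partial>\<mu>)"
      by (rule nn_integral_left[of "\<lambda>x. ennreal B * (indicator (- Q) x * ennreal (K x))
        + of_nat n * ennreal \<delta> / \<kappa> * ennreal (K x)"]) measurable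
    also have "\<dots> = ennreal B * (\<integral>\<^sup>+x. indicator (- Q) x * ennreal (K x) \<partial>\<mu>)
        + of_nat n * ennreal \<delta> / \<kappa> * (\<integral>\<^sup>+x. ennreal (K x) \<partial>\<mu>)"
      by (subst nn_integral_add) (auto simp: nn_integral_cmult)
    also have "\<dots> \<le> ennreal B * ennreal \<delta> + of_nat n * ennreal \<delta> / \<kappa> * (\<integral>\<^sup>+x. ennreal (K x) \<partial>\<mu>)"
      using Q(2) by (intro add_right_mono mult_left_mono) auto
    also have "\<dots> = ennreal \<delta> * X"
      unfolding X_def by (simp add: distrib_left divide_ennreal_def mult_ac)
    also have "\<dots> = ennreal (\<delta> * X')"
      using X' \<delta>(1) by (simp add: ennreal_mult)
    also have "\<dots> \<le> ennreal \<theta>"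
      using \<delta>(2) by (rule ennreal_leI)
    finally show "(\<Sum>\<gamma>\<in>{\<gamma>\<in>F. - \<gamma> + y \<notin> U}. \<integral>\<^sup>+x. ennreal (\<eta> \<gamma> x) * ennreal (K (- y + x)) \<partial>\<mu>) \<le> ennreal \<theta>"
      unfolding Fy_def .
  qed
qed

text \<open>A Schur-type estimate. A weighted Cauchy-Schwarz inequality bounds the square of the
  projection by an integral of |f(y)|^2 K(y^-1 x) over the far region, and Tonelli moves the symbols
  inside. What remains at fixed y is the quantity of \<open>far_symbols_small\<close>.\<close>

lemma far_projection_small:
  assumes "0 < \<delta>"
  obtains U where "compact U"
    "\<And>F f. finite F \<Longrightarrow> F \<subseteq> \<Gamma> \<Longrightarrow> f \<in> L2 \<mu> \<Longrightarrow>
      (\<Sum>\<gamma>\<in>F. \<integral>\<^sup>+x. ennreal (\<eta> \<gamma> x) * ennreal ((cmod (P (\<lambda>y. indicator {y. - \<gamma> + y \<notin> U} y * f y) x))\<^sup>2) \<partial>\<mu>)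
        \<le> ennreal (\<delta> * (L2norm \<mu> f)\<^sup>2)"
proof -
  obtain K :: "'g \<Rightarrow> real" where K: "\<And>x. 0 \<le> K x" "(\<lambda>x. ennreal (K x)) \<in> borel_measurable \<mu>"
    "K \<in> borel_measurable \<mu>"
    "(\<integral>\<^sup>+x. ennreal (K x) \<partial>\<mu>) < \<infinity>" "(\<integral>\<^sup>+x. ennreal (K (- x)) \<partial>\<mu>) < \<infinity>"
    "\<exists>M. AE x in \<mu>. K x \<le> M"
    "\<And>f. f \<in> L2 \<mu> \<Longrightarrow> AE x in \<mu>. ennreal (cmod (P f x)) \<le> (\<integral>\<^sup>+y. ennreal (cmod (f y)) * ennreal (K (- y + x)) \<partial>\<mu>)"
    using kernel by blast
  obtain c where c: "(\<integral>\<^sup>+x. ennreal (K (- x)) \<partial>\<mu>) = ennreal c" "0 \<le> c"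
    using K(5) by (cases "\<integral>\<^sup>+x. ennreal (K (- x)) \<partial>\<mu>") auto
  \<comment> \<open>Cauchy-Schwarz costs the factor c, the integral of K(x^-1); the added 1 covers c
    = 0.\<close>
  define \<theta> where "\<theta> = \<delta> / (c + 1)"
  have \<theta>: "0 < \<theta>" "c * \<theta> \<le> \<delta>"
    using assms c(2) by (auto simp: \<theta>_def field_simps)
  obtain U where U: "compact U"
    "\<And>F y. finite F \<Longrightarrow> F \<subseteq> \<Gamma> \<Longrightarrow> (\<Sum>\<gamma>\<in>{\<gamma>\<in>F. - \<gamma> + y \<notin> U}. \<integral>\<^sup>+x. ennreal (\<eta> \<gamma> x) * ennreal (K (- y + x)) \<partial>\<mu>) \<le> ennreal \<theta>"
    using far_symbols_small[OF \<theta>(1) K(2,4)] by blast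
  show thesis
  proof (rule that[OF U(1)])
    fix F f assume F: "finite F" "F \<subseteq> \<Gamma>" and f: "f \<in> L2 \<mu>"
    have fm [measurable]: "f \<in> borel_measurable \<mu>"
      using f by (rule L2_measurable)
    have UC: "- U \<in> sets \<mu>"
      using sets.compl_sets[OF compact_sets_mu[OF U(1)]] by (simp add: Compl_eq_Diff_UNIV)
    define far where "far \<gamma> = {y. - \<gamma> + y \<notin> U}" for \<gamma>
    have far_sets [measurable]: "far \<gamma> \<in> sets \<mu>" for \<gamma>
      using measurable_sets[OF measurable_translations(1)[of "- \<gamma>"] UC] by (simp add: far_def vimage_def)
    define b where "b \<gamma> y = indicator (far \<gamma>) y * ennreal ((cmod (f y))\<^sup>2)" for \<gamma> y
    have b [measurable]: "b \<gamma> \<in> borel_measurable \<mu>" for \<gamma>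
      unfolding b_def[abs_def] by measurable
    have fL: "(\<lambda>y. indicator (far \<gamma>) y * f y) \<in> L2 \<mu>" for \<gamma>
      by (rule L2I_bounded[OF _ f, of _ 1]) (auto simp: indicator_def)
    have em: "(\<lambda>x. ennreal (\<eta> \<gamma> x)) \<in> borel_measurable \<mu>" if "\<gamma> \<in> F" for \<gamma>
      using meas[of \<gamma>] that F(2) by auto
    have pt: "AE x in \<mu>. ennreal ((cmod (P (\<lambda>y. indicator (far \<gamma>) y * f y) x))\<^sup>2) \<le> ennreal c * (\<integral>\<^sup>+y. b \<gamma> y * ennreal (K (- y + x)) \<partial>\<mu>)" for \<gamma>
      using K(7)[OF fL[of \<gamma>]]
    proof eventually_elim
      case (elim x)
      \<comment> \<open>K is split into two equal square roots: one stays beside f, the square of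
        the other integrates to c.\<close>
      let ?s = "\<lambda>y. ennreal (sqrt (K (- y + x)))"
      have sm: "?s \<in> borel_measurable \<mu>"
        using K(3) by (intro measurable_compose_translations(6)[of "\<lambda>z. ennreal (sqrt (K z))"]) measurable
      have s2: "(?s y)\<^sup>2 = ennreal (K (- y + x))" for y
        using K(1) by (simp add: ennreal_power)
      have "ennreal ((cmod (P (\<lambda>y. indicator (far \<gamma>) y * f y) x))\<^sup>2) = (ennreal (cmod (P (\<lambda>y. indicator (far \<gamma>) y * f y) x)))\<^sup>2"
        by (simp add: ennreal_power)
      also have "\<dots> \<le> (\<integral>\<^sup>+y. ennreal (cmod (indicator (far \<gamma>) y * f y)) * ennreal (K (- y + x)) \<partial>\<mu>)\<^sup>2"
        using elim by (intro power_mono) auto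
      also have "(\<integral>\<^sup>+y. ennreal (cmod (indicator (far \<gamma>) y * f y)) * ennreal (K (- y + x)) \<partial>\<mu>)
         = (\<integral>\<^sup>+y. (ennreal (cmod (indicator (far \<gamma>) y * f y)) * ?s y) * ?s y \<partial>\<mu>)"
        by (simp add: s2[symmetric] power2_eq_square mult.assoc)
      also have "\<dots>\<^sup>2 \<le> (\<integral>\<^sup>+y. (ennreal (cmod (indicator (far \<gamma>) y * f y)) * ?s y)\<^sup>2 \<partial>\<mu>) * (\<integral>\<^sup>+y. (?s y)\<^sup>2 \<partial>\<mu>)"
        by (intro Cauchy_Schwarz_nn_integral borel_measurable_times_ennreal sm) measurable
      also have "(\<integral>\<^sup>+y. (ennreal (cmod (indicator (far \<gamma>) y * f y)) * ?s y)\<^sup>2 \<partial>\<mu>) = (\<integral>\<^sup>+y. b \<gamma> y * ennreal (K (- y + x)) \<partial>\<mu>)"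
        by (intro nn_integral_cong) (auto simp: power_mult_distrib s2 b_def indicator_def ennreal_power)
      also have "(\<integral>\<^sup>+y. (?s y)\<^sup>2 \<partial>\<mu>) = ennreal c"
        unfolding s2 c(1)[symmetric] by (rule reflected_translated_integral[OF K(2)])
      finally show ?case
        by (simp add: mult.commute)
    qed
    have fc: "(\<lambda>x. \<integral>\<^sup>+y. b \<gamma> y * ennreal (K (- y + x)) \<partial>\<mu>) \<in> borel_measurable \<mu>" for \<gamma>
      by (rule uminus_add_swap(1)[OF b b K(2)])
    have gm: "(\<lambda>y. \<integral>\<^sup>+x. ennreal (\<eta> \<gamma> x) * ennreal (K (- y + x)) \<partial>\<mu>) \<in> borel_measurable \<mu>" if "\<gamma> \<in> F" for \<gamma>
      using convolution_swap(1)[OF em[OF that] em[OF that] K(2), of "\<lambda>x y. - x + y"]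
      by (simp add: continuous_group_maps AE_uminus_add AE_left)
    have "(\<Sum>\<gamma>\<in>F. \<integral>\<^sup>+x. ennreal (\<eta> \<gamma> x) * ennreal ((cmod (P (\<lambda>y. indicator (far \<gamma>) y * f y) x))\<^sup>2) \<partial>\<mu>)
      \<le> (\<Sum>\<gamma>\<in>F. ennreal c * (\<integral>\<^sup>+y. b \<gamma> y * (\<integral>\<^sup>+x. ennreal (\<eta> \<gamma> x) * ennreal (K (- y + x)) \<partial>\<mu>) \<partial>\<mu>))"
    proof (rule sum_mono)
      fix \<gamma> assume \<gamma>: "\<gamma> \<in> F"
      have "(\<integral>\<^sup>+x. ennreal (\<eta> \<gamma> x) * ennreal ((cmod (P (\<lambda>y. indicator (far \<gamma>) y * f y) x))\<^sup>2) \<partial>\<mu>)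
        \<le> (\<integral>\<^sup>+x. ennreal (\<eta> \<gamma> x) * (ennreal c * (\<integral>\<^sup>+y. b \<gamma> y * ennreal (K (- y + x)) \<partial>\<mu>)) \<partial>\<mu>)"
      proof (rule nn_integral_mono_AE)
        from pt[of \<gamma>]
        show "AE x in \<mu>. ennreal (\<eta> \<gamma> x) * ennreal ((cmod (P (\<lambda>y. indicator (far \<gamma>) y * f y) x))\<^sup>2)
          \<le> ennreal (\<eta> \<gamma> x) * (ennreal c * (\<integral>\<^sup>+y. b \<gamma> y * ennreal (K (- y + x)) \<partial>\<mu>))"
          by eventually_elim (auto intro: mult_left_mono)
      qed
      also have "\<dots> = (\<integral>\<^sup>+x. ennreal c * (ennreal (\<eta> \<gamma> x) * (\<integral>\<^sup>+y. b \<gamma> y * ennreal (K (- y + x)) \<partial>\<mu>)) \<partial>\<mu>)"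
        by (simp only: mult.left_commute)
      also have "\<dots> = ennreal c * (\<integral>\<^sup>+x. ennreal (\<eta> \<gamma> x) * (\<integral>\<^sup>+y. b \<gamma> y * ennreal (K (- y + x)) \<partial>\<mu>) \<partial>\<mu>)"
        by (intro nn_integral_cmult borel_measurable_times_ennreal em[OF \<gamma>] fc)
      also have "\<dots> = ennreal c * (\<integral>\<^sup>+y. b \<gamma> y * (\<integral>\<^sup>+x. ennreal (\<eta> \<gamma> x) * ennreal (K (- y + x)) \<partial>\<mu>) \<partial>\<mu>)"
        by (subst uminus_add_swap(2)[OF em[OF \<gamma>] b K(2)]) (rule refl)
      finally show "(\<integral>\<^sup>+x. ennreal (\<eta> \<gamma> x) * ennreal ((cmod (P (\<lambda>y. indicator (far \<gamma>) y * f y) x))\<^sup>2) \<partial>\<mu>)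
        \<le> ennreal c * (\<integral>\<^sup>+y. b \<gamma> y * (\<integral>\<^sup>+x. ennreal (\<eta> \<gamma> x) * ennreal (K (- y + x)) \<partial>\<mu>) \<partial>\<mu>)" .
    qed
    also have "\<dots> = ennreal c * (\<integral>\<^sup>+y. (\<Sum>\<gamma>\<in>F. b \<gamma> y * (\<integral>\<^sup>+x. ennreal (\<eta> \<gamma> x) * ennreal (K (- y + x)) \<partial>\<mu>)) \<partial>\<mu>)"
      unfolding sum_distrib_left[symmetric]
      by (subst nn_integral_sum) (auto intro!: borel_measurable_times_ennreal b gm)
    \<comment> \<open>At fixed y the cut-off leaves exactly the \<gamma> with \<gamma>^-1 y outside
      \<open>U\<close>.\<close>
    also have "\<dots> \<le> ennreal c * (\<integral>\<^sup>+y. ennreal \<theta> * ennreal ((cmod (f y))\<^sup>2) \<partial>\<mu>)"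
    proof (intro mult_left_mono nn_integral_mono)
      fix y
      have "(\<Sum>\<gamma>\<in>F. b \<gamma> y * (\<integral>\<^sup>+x. ennreal (\<eta> \<gamma> x) * ennreal (K (- y + x)) \<partial>\<mu>))
        = (\<Sum>\<gamma>\<in>F. if - \<gamma> + y \<notin> U then ennreal ((cmod (f y))\<^sup>2) * (\<integral>\<^sup>+x. ennreal (\<eta> \<gamma> x) * ennreal (K (- y + x)) \<partial>\<mu>) else 0)"
        by (intro sum.cong) (auto simp: b_def far_def indicator_def)
      also have "\<dots> = (\<Sum>\<gamma>\<in>{\<gamma>\<in>F. - \<gamma> + y \<notin> U}. ennreal ((cmod (f y))\<^sup>2) * (\<integral>\<^sup>+x. ennreal (\<eta> \<gamma> x) * ennreal (K (- y + x)) \<partial>\<mu>))"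
        by (rule sum.inter_filter[OF F(1), symmetric])
      also have "\<dots> = ennreal ((cmod (f y))\<^sup>2) * (\<Sum>\<gamma>\<in>{\<gamma>\<in>F. - \<gamma> + y \<notin> U}. \<integral>\<^sup>+x. ennreal (\<eta> \<gamma> x) * ennreal (K (- y + x)) \<partial>\<mu>)"
        by (rule sum_distrib_left[symmetric])
      also have "\<dots> \<le> ennreal ((cmod (f y))\<^sup>2) * ennreal \<theta>"
        using U(2)[OF F] by (intro mult_left_mono) auto
      finally show "(\<Sum>\<gamma>\<in>F. b \<gamma> y * (\<integral>\<^sup>+x. ennreal (\<eta> \<gamma> x) * ennreal (K (- y + x)) \<partial>\<mu>)) \<le> ennreal \<theta> * ennreal ((cmod (f y))\<^sup>2)"
        by (simp only: mult.commute)
    qed simp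
    also have "\<dots> = ennreal c * (ennreal \<theta> * ennreal ((L2norm \<mu> f)\<^sup>2))"
      by (simp add: nn_integral_cmult nn_integral_L2norm[OF f])
    also have "\<dots> = ennreal (c * \<theta> * (L2norm \<mu> f)\<^sup>2)"
      using c(2) \<theta>(1) by (simp add: ennreal_mult mult.assoc)
    also have "\<dots> \<le> ennreal (\<delta> * (L2norm \<mu> f)\<^sup>2)"
      using \<theta>(2) by (intro ennreal_leI mult_right_mono) auto
    finally show "(\<Sum>\<gamma>\<in>F. \<integral>\<^sup>+x. ennreal (\<eta> \<gamma> x) * ennreal ((cmod (P (\<lambda>y. indicator {y. - \<gamma> + y \<notin> U} y * f y) x))\<^sup>2) \<partial>\<mu>)
        \<le> ennreal (\<delta> * (L2norm \<mu> f)\<^sup>2)"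
      unfolding far_def .
  qed
qed

end

section \<open>Spectral truncation\<close>

locale phase_space_spectral = phase_space_symbols \<mu> \<Delta> w V S P \<Gamma> \<eta>
  for \<mu> :: "'g::{topological_group_add,t2_space} measure"
    and \<Delta> w :: "'g \<Rightarrow> real" and V :: "'g set"
    and S :: "('g \<Rightarrow> complex) set" and P :: "('g \<Rightarrow> complex) \<Rightarrow> ('g \<Rightarrow> complex)"
    and \<Gamma> :: "'g set" and \<eta> :: "'g \<Rightarrow> 'g \<Rightarrow> real" +
  fixes lam :: "'g \<Rightarrow> nat \<Rightarrow> real" and phi :: "'g \<Rightarrow> nat \<Rightarrow> 'g \<Rightarrow> complex"
  assumes diag: "\<gamma> \<in> \<Gamma> \<Longrightarrow> diagonalizes \<mu> S P (\<eta> \<gamma>) (lam \<gamma>) (phi \<gamma>)"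
begin

abbreviation coef :: "'g \<Rightarrow> ('g \<Rightarrow> complex) \<Rightarrow> nat \<Rightarrow> real" where
  "coef \<gamma> f k \<equiv> cmod (L2inner \<mu> f (phi \<gamma> k))"

lemma lam_nonneg: "\<gamma> \<in> \<Gamma> \<Longrightarrow> 1 \<le> k \<Longrightarrow> 0 \<le> lam \<gamma> k"
  and lam_Suc: "\<gamma> \<in> \<Gamma> \<Longrightarrow> 1 \<le> k \<Longrightarrow> lam \<gamma> (Suc k) \<le> lam \<gamma> k"
  and phi_S: "\<gamma> \<in> \<Gamma> \<Longrightarrow> 1 \<le> k \<Longrightarrow> 0 < lam \<gamma> k \<Longrightarrow> phi \<gamma> k \<in> S"
  and phi_orthonormal: "\<gamma> \<in> \<Gamma> \<Longrightarrow> 1 \<le> k \<Longrightarrow> 1 \<le> l \<Longrightarrow> 0 < lam \<gamma> k \<Longrightarrow> 0 < lam \<gamma> l \<Longrightarrow>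
    L2inner \<mu> (phi \<gamma> k) (phi \<gamma> l) = (if k = l then 1 else 0)"
  and multiplier_expansion: "\<gamma> \<in> \<Gamma> \<Longrightarrow> f \<in> S \<Longrightarrow> (\<lambda>n. L2norm \<mu> (\<lambda>x. multiplier P (\<eta> \<gamma>) f x -
          (\<Sum>k\<in>{1..n}. complex_of_real (lam \<gamma> k) * L2inner \<mu> f (phi \<gamma> k) * phi \<gamma> k x))) \<longlonglongrightarrow> 0"
  using diag[of \<gamma>] unfolding diagonalizes_def by blast+

lemma lam_antimono:
  assumes "\<gamma> \<in> \<Gamma>" "1 \<le> k" "k \<le> n"
  shows "lam \<gamma> n \<le> lam \<gamma> k"
  using assms(3)
proof (induction n rule: dec_induct)
  case (step m)
  then show ?case
    using lam_Suc[OF assms(1), of m] assms(2) by linarith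
qed simp

text \<open>Since \<open>P\<close> is the orthogonal projection onto \<open>S\<close>, this is the quadratic form
  \<open>\<langle>M f, f\<rangle>\<close> of the multiplier with symbol \<open>\<eta> \<gamma>\<close>.\<close>

definition q :: "'g \<Rightarrow> ('g \<Rightarrow> complex) \<Rightarrow> real" where
  "q \<gamma> f = (\<integral>x. \<eta> \<gamma> x * (cmod (f x))\<^sup>2 \<partial>\<mu>)"

lemma q_integrable:
  assumes "\<gamma> \<in> \<Gamma>" "f \<in> L2 \<mu>"
  shows "integrable \<mu> (\<lambda>x. \<eta> \<gamma> x * (cmod (f x))\<^sup>2)"
proof -
  obtain B where B: "0 < B" "\<And>\<gamma>. \<gamma> \<in> \<Gamma> \<Longrightarrow> AE x in \<mu>. \<eta> \<gamma> x \<le> B"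
    "\<And>F. finite F \<Longrightarrow> F \<subseteq> \<Gamma> \<Longrightarrow> AE x in \<mu>. (\<Sum>\<gamma>\<in>F. \<eta> \<gamma> x) \<le> B"
    using symbol_bounded by metis
  note [measurable] = meas[OF assms(1)] L2_measurable[OF assms(2)]
  show ?thesis
  proof (rule Bochner_Integration.integrable_bound)
    show "integrable \<mu> (\<lambda>x. B * (cmod (f x))\<^sup>2)"
      using L2_integrable[OF assms(2)] by simp
    show "(\<lambda>x. \<eta> \<gamma> x * (cmod (f x))\<^sup>2) \<in> borel_measurable \<mu>" by measurable
    show "AE x in \<mu>. norm (\<eta> \<gamma> x * (cmod (f x))\<^sup>2) \<le> norm (B * (cmod (f x))\<^sup>2)"
      using B(2)[OF assms(1)]
    proof eventually_elim
      case (elim x)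
      then have "\<eta> \<gamma> x * (cmod (f x))\<^sup>2 \<le> B * (cmod (f x))\<^sup>2"
        by (intro mult_right_mono) auto
      then show ?case
        using nonneg[OF assms(1), of x] B(1) by simp
    qed
  qed
qed

lemma q_nonneg: "\<gamma> \<in> \<Gamma> \<Longrightarrow> 0 \<le> q \<gamma> f"
  unfolding q_def using nonneg by (intro integral_nonneg_AE) auto

lemma nn_integral_q:
  assumes "\<gamma> \<in> \<Gamma>" "f \<in> L2 \<mu>"
  shows "(\<integral>\<^sup>+x. ennreal (\<eta> \<gamma> x) * ennreal ((cmod (f x))\<^sup>2) \<partial>\<mu>) = ennreal (q \<gamma> f)"
  using nn_integral_eq_integral[OF q_integrable[OF assms]] nonneg[OF assms(1)]
  by (simp add: q_def ennreal_mult)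

section \<open>Comparison of the summed forms with the norm\<close>

lemma q_sum_upper:
  obtains B where "0 < B" "\<And>F f. finite F \<Longrightarrow> F \<subseteq> \<Gamma> \<Longrightarrow> f \<in> L2 \<mu> \<Longrightarrow> (\<Sum>\<gamma>\<in>F. q \<gamma> f) \<le> B * (L2norm \<mu> f)\<^sup>2"
proof -
  obtain B where B: "0 < B" "\<And>\<gamma>. \<gamma> \<in> \<Gamma> \<Longrightarrow> AE x in \<mu>. \<eta> \<gamma> x \<le> B"
    "\<And>F. finite F \<Longrightarrow> F \<subseteq> \<Gamma> \<Longrightarrow> AE x in \<mu>. (\<Sum>\<gamma>\<in>F. \<eta> \<gamma> x) \<le> B"
    using symbol_bounded by metis
  have "(\<Sum>\<gamma>\<in>F. q \<gamma> f) \<le> B * (L2norm \<mu> f)\<^sup>2" if F: "finite F" "F \<subseteq> \<Gamma>" and f: "f \<in> L2 \<mu>" for F f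
  proof -
    have "(\<Sum>\<gamma>\<in>F. q \<gamma> f) = (\<integral>x. (\<Sum>\<gamma>\<in>F. \<eta> \<gamma> x * (cmod (f x))\<^sup>2) \<partial>\<mu>)"
      unfolding q_def using F f q_integrable by (intro Bochner_Integration.integral_sum[symmetric]) auto
    also have "\<dots> \<le> (\<integral>x. B * (cmod (f x))\<^sup>2 \<partial>\<mu>)"
    proof (rule integral_mono_AE)
      show "integrable \<mu> (\<lambda>x. \<Sum>\<gamma>\<in>F. \<eta> \<gamma> x * (cmod (f x))\<^sup>2)"
        using F f q_integrable by (intro Bochner_Integration.integrable_sum) auto
      show "integrable \<mu> (\<lambda>x. B * (cmod (f x))\<^sup>2)"
        using L2_integrable[OF f] by simp
      show "AE x in \<mu>. (\<Sum>\<gamma>\<in>F. \<eta> \<gamma> x * (cmod (f x))\<^sup>2) \<le> B * (cmod (f x))\<^sup>2"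
        using B(3)[OF F] unfolding sum_distrib_right[symmetric]
        by eventually_elim (intro mult_right_mono, auto)
    qed
    also have "\<dots> = B * (L2norm \<mu> f)\<^sup>2"
      by (simp add: L2norm_square)
    finally show ?thesis .
  qed
  with B(1) show thesis by (rule that)
qed

text \<open>Settling for a proper fraction of A makes a finite subset sufficient, though one
  depending on f. Monotone convergence gives the full constant A in the limit, and a value strictly
  below a supremum is exceeded by one of its members.\<close>

lemma q_sum_lower:
  obtains A where "0 < A" "\<And>f. f \<in> L2 \<mu> \<Longrightarrow> \<exists>F. finite F \<and> F \<subseteq> \<Gamma> \<and> 3 / 4 * A * (L2norm \<mu> f)\<^sup>2 \<le> (\<Sum>\<gamma>\<in>F. q \<gamma> f)"
proof -
  have "\<exists>A>0. AE x in \<mu>. (\<lambda>\<gamma>. \<eta> \<gamma> x) summable_on \<Gamma> \<and> A \<le> (\<Sum>\<^sub>\<infinity>\<gamma>\<in>\<Gamma>. \<eta> \<gamma> x)"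
    by (rule sum_bounds) (intro exI conjI)
  then obtain A where A: "0 < A" and ae: "AE x in \<mu>. (\<lambda>\<gamma>. \<eta> \<gamma> x) summable_on \<Gamma> \<and> A \<le> (\<Sum>\<^sub>\<infinity>\<gamma>\<in>\<Gamma>. \<eta> \<gamma> x)"
    by blast
  have "\<exists>F. finite F \<and> F \<subseteq> \<Gamma> \<and> 3 / 4 * A * (L2norm \<mu> f)\<^sup>2 \<le> (\<Sum>\<gamma>\<in>F. q \<gamma> f)" if f: "f \<in> L2 \<mu>" for f
  \<comment> \<open>The strict inequality between the two multiples of the squared norm fails
    exactly here.\<close>
  proof (cases "L2norm \<mu> f = 0")
    case True
    then show ?thesis by (intro exI[of _ "{}"]) simp
  next
    case False
    \<comment> \<open>Monotone convergence wants a sequence, whereas \<open>summable_on\<close>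
      speaks of a net of finite subsets; an enumeration of the countable \<Gamma> mediates.\<close>
    define F where "F n = {\<gamma>\<in>\<Gamma>. to_nat_on \<Gamma> \<gamma> < n}" for n
    have inj: "inj_on (to_nat_on \<Gamma>) \<Gamma>"
      by (rule inj_on_to_nat_on[OF countable_index])
    have F: "finite (F n)" "F n \<subseteq> \<Gamma>" for n
    proof -
      have "inj_on (to_nat_on \<Gamma>) (F n)"
        by (rule inj_on_subset[OF inj]) (auto simp: F_def)
      moreover have "finite (to_nat_on \<Gamma> ` F n)"
        by (rule finite_subset[of _ "{..<n}"]) (auto simp: F_def)
      ultimately show "finite (F n)"
        by (rule finite_imageD[rotated])
    qed (auto simp: F_def)
    have Fmono: "F m \<subseteq> F n" if "m \<le> n" for m n
      using that by (auto simp: F_def)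
    define h where "h n x = (\<Sum>\<gamma>\<in>F n. ennreal (\<eta> \<gamma> x) * ennreal ((cmod (f x))\<^sup>2))" for n x
    note [measurable] = L2_measurable[OF f]
    have tm: "(\<lambda>x. ennreal (\<eta> \<gamma> x) * ennreal ((cmod (f x))\<^sup>2)) \<in> borel_measurable \<mu>" if "\<gamma> \<in> F n" for \<gamma> n
    proof -
      have [measurable]: "\<eta> \<gamma> \<in> borel_measurable \<mu>"
        using that F(2) by (intro meas) auto
      show ?thesis
        by measurable
    qed
    have hm: "h n \<in> borel_measurable \<mu>" for n
      unfolding h_def[abs_def] by (rule borel_measurable_sum) (rule tm)
    have hinc: "incseq h"
      unfolding incseq_def le_fun_def h_def by (intro allI impI sum_mono2 F(1) Fmono) auto
    have hint: "(\<integral>\<^sup>+x. h n x \<partial>\<mu>) = ennreal (\<Sum>\<gamma>\<in>F n. q \<gamma> f)" for n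
    proof -
      have "(\<integral>\<^sup>+x. h n x \<partial>\<mu>) = (\<Sum>\<gamma>\<in>F n. \<integral>\<^sup>+x. ennreal (\<eta> \<gamma> x) * ennreal ((cmod (f x))\<^sup>2) \<partial>\<mu>)"
        unfolding h_def by (rule nn_integral_sum) (rule tm)
      also have "\<dots> = (\<Sum>\<gamma>\<in>F n. ennreal (q \<gamma> f))"
        using nn_integral_q[OF _ f] F(2) by (intro sum.cong) auto
      also have "\<dots> = ennreal (\<Sum>\<gamma>\<in>F n. q \<gamma> f)"
        using q_nonneg F(2) by (intro sum_ennreal) auto
      finally show ?thesis .
    qed
    have pt: "AE x in \<mu>. ennreal A * ennreal ((cmod (f x))\<^sup>2) \<le> (SUP n. h n x)"
      using ae
    proof eventually_elim
      case (elim x)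
      have sup: "(SUP n. \<Sum>\<gamma>\<in>F n. ennreal (\<eta> \<gamma> x)) \<ge> ennreal A"
      proof (rule ennreal_le_epsilon)
        fix e :: real assume e: "0 < e"
        have "((\<lambda>\<gamma>. \<eta> \<gamma> x) has_sum (\<Sum>\<^sub>\<infinity>\<gamma>\<in>\<Gamma>. \<eta> \<gamma> x)) \<Gamma>"
          using elim by (intro has_sum_infsum) simp
        then have "eventually (\<lambda>X. dist (\<Sum>\<gamma>\<in>X. \<eta> \<gamma> x) (\<Sum>\<^sub>\<infinity>\<gamma>\<in>\<Gamma>. \<eta> \<gamma> x) < e) (finite_subsets_at_top \<Gamma>)"
          unfolding has_sum_def using e by (rule tendstoD)
        then obtain X where X: "finite X" "X \<subseteq> \<Gamma>" "dist (\<Sum>\<gamma>\<in>X. \<eta> \<gamma> x) (\<Sum>\<^sub>\<infinity>\<gamma>\<in>\<Gamma>. \<eta> \<gamma> x) < e"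
          unfolding eventually_finite_subsets_at_top by blast
        obtain n where n: "X \<subseteq> F n"
        proof (rule that[of "Suc (Max (insert 0 (to_nat_on \<Gamma> ` X)))"])
          show "X \<subseteq> F (Suc (Max (insert 0 (to_nat_on \<Gamma> ` X))))"
            using X(1,2) by (auto simp: F_def less_Suc_eq_le)
        qed
        have "A \<le> (\<Sum>\<gamma>\<in>X. \<eta> \<gamma> x) + e"
          using X(3) elim by (auto simp: dist_real_def)
        also have "(\<Sum>\<gamma>\<in>X. \<eta> \<gamma> x) \<le> (\<Sum>\<gamma>\<in>F n. \<eta> \<gamma> x)"
          using n F[of n] nonneg by (intro sum_mono2) auto
        finally have "ennreal A \<le> ennreal ((\<Sum>\<gamma>\<in>F n. \<eta> \<gamma> x) + e)"
          by (intro ennreal_leI) simp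
        also have "\<dots> = ennreal (\<Sum>\<gamma>\<in>F n. \<eta> \<gamma> x) + ennreal e"
          using nonneg F(2)[of n] e by (intro ennreal_plus) (auto intro!: sum_nonneg)
        also have "ennreal (\<Sum>\<gamma>\<in>F n. \<eta> \<gamma> x) = (\<Sum>\<gamma>\<in>F n. ennreal (\<eta> \<gamma> x))"
          using nonneg F(2)[of n] by (intro sum_ennreal[symmetric]) auto
        also have "\<dots> \<le> (SUP n. \<Sum>\<gamma>\<in>F n. ennreal (\<eta> \<gamma> x))"
          by (rule SUP_upper) simp
        finally show "ennreal A \<le> (SUP n. \<Sum>\<gamma>\<in>F n. ennreal (\<eta> \<gamma> x)) + ennreal e"
          by simp
      qed
      have "(SUP n. h n x) = (SUP n. (\<Sum>\<gamma>\<in>F n. ennreal (\<eta> \<gamma> x))) * ennreal ((cmod (f x))\<^sup>2)"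
        unfolding h_def sum_distrib_right[symmetric] by (rule SUP_mult_right_ennreal[symmetric])
      then show ?case
        using sup by (simp add: mult_right_mono)
    qed
    have "ennreal (3 / 4 * A * (L2norm \<mu> f)\<^sup>2) < ennreal (A * (L2norm \<mu> f)\<^sup>2)"
      using A False by (intro ennreal_lessI) auto
    also have "\<dots> = (\<integral>\<^sup>+x. ennreal A * ennreal ((cmod (f x))\<^sup>2) \<partial>\<mu>)"
      using A by (simp add: nn_integral_cmult nn_integral_L2norm[OF f] ennreal_mult)
    also have "\<dots> \<le> (\<integral>\<^sup>+x. (SUP n. h n x) \<partial>\<mu>)"
      by (rule nn_integral_mono_AE[OF pt])
    also have "\<dots> = (SUP n. \<integral>\<^sup>+x. h n x \<partial>\<mu>)"
      by (rule nn_integral_monotone_convergence_SUP[OF hinc hm])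
    finally obtain n where "ennreal (3 / 4 * A * (L2norm \<mu> f)\<^sup>2) < ennreal (\<Sum>\<gamma>\<in>F n. q \<gamma> f)"
      unfolding hint less_SUP_iff by blast
    then have "3 / 4 * A * (L2norm \<mu> f)\<^sup>2 \<le> (\<Sum>\<gamma>\<in>F n. q \<gamma> f)"
      using q_nonneg F(2)[of n] A by (subst (asm) ennreal_less_iff) auto
    then show ?thesis
      using F[of n] by blast
  qed
  with A show thesis by (rule that)
qed

section \<open>Spectral expansion of the forms and bounds on eigenvalues\<close>

lemma multiplier_L2:
  assumes "\<gamma> \<in> \<Gamma>" "f \<in> L2 \<mu>"
  shows "(\<lambda>x. complex_of_real (\<eta> \<gamma> x) * f x) \<in> L2 \<mu>"
proof -
  obtain B where B: "0 < B" "\<And>\<gamma>. \<gamma> \<in> \<Gamma> \<Longrightarrow> AE x in \<mu>. \<eta> \<gamma> x \<le> B"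
    "\<And>F. finite F \<Longrightarrow> F \<subseteq> \<Gamma> \<Longrightarrow> AE x in \<mu>. (\<Sum>\<gamma>\<in>F. \<eta> \<gamma> x) \<le> B"
    using symbol_bounded by metis
  note [measurable] = meas[OF assms(1)] L2_measurable[OF assms(2)]
  show ?thesis
  proof (rule L2I_bounded[OF _ assms(2)])
    show "(\<lambda>x. complex_of_real (\<eta> \<gamma> x) * f x) \<in> borel_measurable \<mu>" by measurable
    show "AE x in \<mu>. cmod (complex_of_real (\<eta> \<gamma> x) * f x) \<le> B * cmod (f x)"
      using B(2)[OF assms(1)]
      by eventually_elim (simp add: norm_mult nonneg[OF assms(1)] mult_right_mono)
  qed
qed

text \<open>The norm-convergent expansion of the multiplier is paired with f. The partial sums turn
  into those of the statement, and in the limit P drops out of the inner product because f lies in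
  S.\<close>

lemma spectral_sum:
  assumes \<gamma>: "\<gamma> \<in> \<Gamma>" and f: "f \<in> S"
  shows "(\<lambda>n. \<Sum>k\<in>{1..n}. lam \<gamma> k * (coef \<gamma> f k)\<^sup>2) \<longlonglongrightarrow> q \<gamma> f"
proof -
  let ?F = "\<lambda>n x. \<Sum>k\<in>{1..n}. complex_of_real (lam \<gamma> k) * L2inner \<mu> f (phi \<gamma> k) * phi \<gamma> k x"
  have fL: "f \<in> L2 \<mu>" by (rule S_L2[OF f])
  \<comment> \<open>For eigenvalue zero nothing is known about \<open>phi \<gamma> k\<close>, but
    then the whole term vanishes.\<close>
  have term_L2: "(\<lambda>x. complex_of_real (lam \<gamma> k) * L2inner \<mu> f (phi \<gamma> k) * phi \<gamma> k x) \<in> L2 \<mu>" if "1 \<le> k" for k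
  proof (cases "lam \<gamma> k = 0")
    case False
    then have "phi \<gamma> k \<in> L2 \<mu>"
      using phi_S[OF \<gamma> that] lam_nonneg[OF \<gamma> that] S_L2 by fastforce
    then show ?thesis by (rule L2_cmult)
  qed (simp add: L2_zero)
  have F: "?F n \<in> L2 \<mu>" for n
    by (intro L2_sum term_L2) auto
  have M: "multiplier P (\<eta> \<gamma>) f \<in> L2 \<mu>"
    unfolding multiplier_def by (intro P_L2 multiplier_L2 \<gamma> fL)
  have "(\<lambda>n. L2inner \<mu> (?F n) f) \<longlonglongrightarrow> L2inner \<mu> (multiplier P (\<eta> \<gamma>) f) f"
    by (rule L2inner_tendsto[OF F M fL multiplier_expansion[OF \<gamma> f]])
  also have "(\<lambda>n. L2inner \<mu> (?F n) f) = (\<lambda>n. complex_of_real (\<Sum>k\<in>{1..n}. lam \<gamma> k * (coef \<gamma> f k)\<^sup>2))"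
  proof
    fix n
    have "L2inner \<mu> (?F n) f = (\<Sum>k\<in>{1..n}. L2inner \<mu> (\<lambda>x. complex_of_real (lam \<gamma> k) * L2inner \<mu> f (phi \<gamma> k) * phi \<gamma> k x) f)"
      by (rule L2inner_sum_left[OF term_L2 fL]) auto
    also have "\<dots> = (\<Sum>k\<in>{1..n}. complex_of_real (lam \<gamma> k) * complex_of_real ((coef \<gamma> f k)\<^sup>2))"
      unfolding L2inner_cmult_left complex_norm_square
      by (intro sum.cong refl) (simp add: L2inner_commute[of \<mu> f "phi \<gamma> _"] mult.assoc)
    finally show "L2inner \<mu> (?F n) f = complex_of_real (\<Sum>k\<in>{1..n}. lam \<gamma> k * (coef \<gamma> f k)\<^sup>2)"
      by simp
  qed
  also have "L2inner \<mu> (multiplier P (\<eta> \<gamma>) f) f = L2inner \<mu> (\<lambda>x. complex_of_real (\<eta> \<gamma> x) * f x) f"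
    unfolding multiplier_def by (rule P_inner[OF multiplier_L2[OF \<gamma> fL] f])
  also have "\<dots> = (\<integral>x. complex_of_real (\<eta> \<gamma> x * (cmod (f x))\<^sup>2) \<partial>\<mu>)"
    unfolding L2inner_def of_real_mult complex_norm_square by (simp add: mult.assoc)
  also have "\<dots> = complex_of_real (q \<gamma> f)"
    unfolding q_def by (rule integral_complex_of_real)
  finally show ?thesis
    unfolding tendsto_of_real_iff .
qed

lemma spectral_partial_sum_le:
  assumes \<gamma>: "\<gamma> \<in> \<Gamma>" and f: "f \<in> S" and I: "finite I" "\<And>k. k \<in> I \<Longrightarrow> 1 \<le> k"
  shows "(\<Sum>k\<in>I. lam \<gamma> k * (coef \<gamma> f k)\<^sup>2) \<le> q \<gamma> f"
proof (rule LIMSEQ_le_const[OF spectral_sum[OF \<gamma> f]])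
  show "\<exists>N. \<forall>n\<ge>N. (\<Sum>k\<in>I. lam \<gamma> k * (coef \<gamma> f k)\<^sup>2) \<le> (\<Sum>k\<in>{1..n}. lam \<gamma> k * (coef \<gamma> f k)\<^sup>2)"
  proof (intro exI[of _ "Max (insert 0 I)"] allI impI sum_mono2)
    fix n assume n: "Max (insert 0 I) \<le> n"
    show "I \<subseteq> {1..n}"
    proof
      fix k assume k: "k \<in> I"
      then have "k \<le> Max (insert 0 I)"
        using I(1) by (intro Max_ge) auto
      then show "k \<in> {1..n}"
        using n I(2)[OF k] by simp
    qed
    show "0 \<le> lam \<gamma> k * (coef \<gamma> f k)\<^sup>2" if "k \<in> {1..n} - I" for k
      using that lam_nonneg[OF \<gamma>, of k] by simp
  qed simp
qed

text \<open>On an eigenfunction the spectral sum reduces to a single term. Bounds for the symbol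
  thereby become bounds for eigenvalues.\<close>

lemma lam_eq_q:
  assumes \<gamma>: "\<gamma> \<in> \<Gamma>" and k: "1 \<le> k" "0 < lam \<gamma> k"
  shows "lam \<gamma> k = q \<gamma> (phi \<gamma> k)"
proof (rule LIMSEQ_unique[OF _ spectral_sum[OF \<gamma> phi_S[OF \<gamma> k]]])
  have "(\<Sum>j\<in>{1..n}. lam \<gamma> j * (cmod (L2inner \<mu> (phi \<gamma> k) (phi \<gamma> j)))\<^sup>2) = lam \<gamma> k" if "k \<le> n" for n
  proof -
    have "(\<Sum>j\<in>{1..n}. lam \<gamma> j * (cmod (L2inner \<mu> (phi \<gamma> k) (phi \<gamma> j)))\<^sup>2) = (\<Sum>j\<in>{1..n}. if j = k then lam \<gamma> k else 0)"
    proof (rule sum.cong[OF refl])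
      fix j assume "j \<in> {1..n}"
      then have j: "1 \<le> j" by simp
      show "lam \<gamma> j * (cmod (L2inner \<mu> (phi \<gamma> k) (phi \<gamma> j)))\<^sup>2 = (if j = k then lam \<gamma> k else 0)"
      proof (cases "lam \<gamma> j = 0")
        case True
        then show ?thesis using k(2) by auto
      next
        case False
        then have "0 < lam \<gamma> j"
          using lam_nonneg[OF \<gamma> j] by simp
        from phi_orthonormal[OF \<gamma> k(1) j k(2) this] show ?thesis
          by auto
      qed
    qed
    also have "\<dots> = lam \<gamma> k"
      using that k(1) by simp
    finally show ?thesis .
  qed
  then show "(\<lambda>n. \<Sum>j\<in>{1..n}. lam \<gamma> j * (cmod (L2inner \<mu> (phi \<gamma> k) (phi \<gamma> j)))\<^sup>2) \<longlonglongrightarrow> lam \<gamma> k"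
    by (intro tendsto_eventually eventually_sequentiallyI[of k])
qed

lemma lam_bounded:
  obtains B where "0 < B" "\<And>\<gamma> k. \<gamma> \<in> \<Gamma> \<Longrightarrow> 1 \<le> k \<Longrightarrow> lam \<gamma> k \<le> B"
    "\<And>F f. finite F \<Longrightarrow> F \<subseteq> \<Gamma> \<Longrightarrow> f \<in> L2 \<mu> \<Longrightarrow> (\<Sum>\<gamma>\<in>F. q \<gamma> f) \<le> B * (L2norm \<mu> f)\<^sup>2"
proof -
  obtain B where B: "0 < B" "\<And>F f. finite F \<Longrightarrow> F \<subseteq> \<Gamma> \<Longrightarrow> f \<in> L2 \<mu> \<Longrightarrow> (\<Sum>\<gamma>\<in>F. q \<gamma> f) \<le> B * (L2norm \<mu> f)\<^sup>2"
    using q_sum_upper by metis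
  have "lam \<gamma> k \<le> B" if \<gamma>: "\<gamma> \<in> \<Gamma>" and k: "1 \<le> k" for \<gamma> k
  proof (cases "0 < lam \<gamma> k")
    case True
    have "complex_of_real ((L2norm \<mu> (phi \<gamma> k))\<^sup>2) = 1"
      using phi_orthonormal[OF \<gamma> k k True True] by (simp add: L2inner_self)
    then have "(L2norm \<mu> (phi \<gamma> k))\<^sup>2 = 1"
      by (simp only: of_real_eq_1_iff)
    then show ?thesis
      using B(2)[of "{\<gamma>}" "phi \<gamma> k"] \<gamma> S_L2[OF phi_S[OF \<gamma> k True]] lam_eq_q[OF \<gamma> k True] by simp
  qed (use B(1) in simp)
  then show thesis
    using B by (intro that[of B]) auto
qed

text \<open>As the eigenvalues decrease, n times the n-th is at most the sum of the first n. Through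
  \<open>lam_eq_q\<close> that sum is the integral of the symbol against the squared eigenfunctions,
  whose pointwise sum is at most D.\<close>

lemma trace_bound:
  obtains D where "0 \<le> D" "\<And>\<gamma> n. \<gamma> \<in> \<Gamma> \<Longrightarrow> 1 \<le> n \<Longrightarrow> real n * lam \<gamma> n \<le> D * (\<integral>x. \<eta> \<gamma> x \<partial>\<mu>)"
proof -
  obtain D :: real where D: "0 \<le> D"
    "\<And>(I::nat set) phi x. finite I \<Longrightarrow> (\<And>k. k \<in> I \<Longrightarrow> phi k \<in> S) \<Longrightarrow>
      (\<And>k l. k \<in> I \<Longrightarrow> l \<in> I \<Longrightarrow> L2inner \<mu> (phi k) (phi l) = (if k = l then 1 else 0)) \<Longrightarrow>
      (\<Sum>k\<in>I. (cmod (phi k x))\<^sup>2) \<le> D"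
    using orthonormal_pointwise_bound by metis
  have "real n * lam \<gamma> n \<le> D * (\<integral>x. \<eta> \<gamma> x \<partial>\<mu>)" if \<gamma>: "\<gamma> \<in> \<Gamma>" and n: "1 \<le> n" for \<gamma> n
  proof -
    define I where "I = {k\<in>{1..n}. 0 < lam \<gamma> k}"
    have I: "finite I" "\<And>k. k \<in> I \<Longrightarrow> 1 \<le> k" "\<And>k. k \<in> I \<Longrightarrow> 0 < lam \<gamma> k"
      by (auto simp: I_def)
    have "real n * lam \<gamma> n = (\<Sum>k\<in>{1..n}. lam \<gamma> n)"
      by simp
    also have "\<dots> \<le> (\<Sum>k\<in>{1..n}. lam \<gamma> k)"
      using lam_antimono[OF \<gamma>] by (intro sum_mono) auto
    also have "\<dots> = (\<Sum>k\<in>I. lam \<gamma> k)"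
      using lam_nonneg[OF \<gamma>] by (intro sum.mono_neutral_right) (auto simp: I_def order_antisym not_less)
    also have "\<dots> = (\<Sum>k\<in>I. q \<gamma> (phi \<gamma> k))"
      using lam_eq_q[OF \<gamma>] I by (intro sum.cong) auto
    also have "\<dots> = (\<integral>x. (\<Sum>k\<in>I. \<eta> \<gamma> x * (cmod (phi \<gamma> k x))\<^sup>2) \<partial>\<mu>)"
      unfolding q_def using I phi_S[OF \<gamma>] S_L2 q_integrable[OF \<gamma>]
      by (intro Bochner_Integration.integral_sum[symmetric]) auto
    also have "\<dots> \<le> (\<integral>x. D * \<eta> \<gamma> x \<partial>\<mu>)"
    proof (rule integral_mono)
      show "integrable \<mu> (\<lambda>x. \<Sum>k\<in>I. \<eta> \<gamma> x * (cmod (phi \<gamma> k x))\<^sup>2)"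
        using I phi_S[OF \<gamma>] S_L2 q_integrable[OF \<gamma>] by (intro Bochner_Integration.integrable_sum) auto
      show "integrable \<mu> (\<lambda>x. D * \<eta> \<gamma> x)"
        using symbol_integrable[OF \<gamma>] by simp
      show "(\<Sum>k\<in>I. \<eta> \<gamma> x * (cmod (phi \<gamma> k x))\<^sup>2) \<le> D * \<eta> \<gamma> x" for x
      proof -
        have "(\<Sum>k\<in>I. (cmod (phi \<gamma> k x))\<^sup>2) \<le> D"
          by (rule D(2)[where phi = "phi \<gamma>", OF I(1)]) (use I phi_S[OF \<gamma>] phi_orthonormal[OF \<gamma>] in auto)
        then show ?thesis
          unfolding sum_distrib_left[symmetric] mult.commute[of D]
          by (intro mult_left_mono nonneg[OF \<gamma>])
      qed
    qed
    finally show ?thesis by simp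
  qed
  with D(1) show thesis by (rule that)
qed

text \<open>Guarantees that \<open>trunc_multiplier\<close> is a genuine sum: over an infinite index
  set it would be zero by convention. The trace bound makes the eigenvalues decay at least like
  1/k.\<close>

lemma finite_large_eigenvalues:
  assumes \<gamma>: "\<gamma> \<in> \<Gamma>" and "0 < \<epsilon>"
  shows "finite {k. 1 \<le> k \<and> lam \<gamma> k > \<epsilon>}"
proof -
  obtain D where "0 \<le> D" and D: "\<And>\<gamma> n. \<gamma> \<in> \<Gamma> \<Longrightarrow> 1 \<le> n \<Longrightarrow> real n * lam \<gamma> n \<le> D * (\<integral>x. \<eta> \<gamma> x \<partial>\<mu>)"
    using trace_bound by metis
  have "k \<le> nat \<lceil>D * (\<integral>x. \<eta> \<gamma> x \<partial>\<mu>) / \<epsilon>\<rceil>" if k: "1 \<le> k" "lam \<gamma> k > \<epsilon>" for k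
  proof -
    have "real k * \<epsilon> \<le> real k * lam \<gamma> k"
      using k by (intro mult_left_mono) auto
    also have "\<dots> \<le> D * (\<integral>x. \<eta> \<gamma> x \<partial>\<mu>)"
      by (rule D[OF \<gamma> k(1)])
    finally have "real k \<le> D * (\<integral>x. \<eta> \<gamma> x \<partial>\<mu>) / \<epsilon>"
      using assms(2) by (simp add: field_simps)
    then show ?thesis by linarith
  qed
  then have "{k. 1 \<le> k \<and> lam \<gamma> k > \<epsilon>} \<subseteq> {..nat \<lceil>D * (\<integral>x. \<eta> \<gamma> x \<partial>\<mu>) / \<epsilon>\<rceil>}"
    by auto
  then show ?thesis
    by (rule finite_subset) simp
qed

section \<open>Truncation at a threshold\<close>

lemma trunc_multiplier_norm:
  assumes \<gamma>: "\<gamma> \<in> \<Gamma>" and "0 < \<epsilon>"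
  shows "(L2norm \<mu> (trunc_multiplier \<mu> (lam \<gamma>) (phi \<gamma>) \<epsilon> f))\<^sup>2
    = (\<Sum>k\<in>{k. 1 \<le> k \<and> lam \<gamma> k > \<epsilon>}. (lam \<gamma> k)\<^sup>2 * (coef \<gamma> f k)\<^sup>2)"
proof -
  have "(L2norm \<mu> (trunc_multiplier \<mu> (lam \<gamma>) (phi \<gamma>) \<epsilon> f))\<^sup>2
    = (\<Sum>k\<in>{k. 1 \<le> k \<and> lam \<gamma> k > \<epsilon>}. (cmod (complex_of_real (lam \<gamma> k) * L2inner \<mu> f (phi \<gamma> k)))\<^sup>2)"
    unfolding trunc_multiplier_def
    by (rule L2_orthonormal_sum(1)[where phi = "phi \<gamma>" and a = "\<lambda>k. complex_of_real (lam \<gamma> k) * L2inner \<mu> f (phi \<gamma> k)",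
        OF finite_large_eigenvalues[OF assms]])
      (use assms(2) S_L2[OF phi_S[OF \<gamma>]] phi_orthonormal[OF \<gamma>] in auto)
  then show ?thesis
    by (simp add: norm_mult power_mult_distrib)
qed

text \<open>The spectral sum is cut at \<epsilon>. Below the cut |a + b|^2 is bounded by 2|a|^2 +
  2|b|^2; Bessel's inequality with eigenvalues at most \<epsilon> handles \<open>f1\<close>, and the
  full form handles \<open>f2\<close>.\<close>

lemma truncated_form_tail:
  assumes \<gamma>: "\<gamma> \<in> \<Gamma>" and \<epsilon>: "0 < \<epsilon>" and f1: "f1 \<in> S" and f2: "f2 \<in> S" and f: "f = (\<lambda>x. f1 x + f2 x)"
  shows "q \<gamma> f \<le> (\<Sum>k\<in>{k. 1 \<le> k \<and> lam \<gamma> k > \<epsilon>}. lam \<gamma> k * (coef \<gamma> f k)\<^sup>2)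
    + 2 * \<epsilon> * (L2norm \<mu> f1)\<^sup>2 + 2 * q \<gamma> f2" (is "_ \<le> ?Q + _ + _")
proof -
  have fS: "f \<in> S"
    unfolding f by (rule S_add[OF f1 f2])
  let ?a = "\<lambda>f k. lam \<gamma> k * (coef \<gamma> f k)\<^sup>2"
  have a0: "0 \<le> ?a f k" if "1 \<le> k" for f k
    using lam_nonneg[OF \<gamma> that] by simp
  have "(\<Sum>k\<in>{1..n}. ?a f k) \<le> ?Q + 2 * \<epsilon> * (L2norm \<mu> f1)\<^sup>2 + 2 * q \<gamma> f2" for n
  proof -
    \<comment> \<open>Zero eigenvalues are left out, since their terms vanish and their
      eigenfunctions are unconstrained, so that Bessel's inequality applies on
      \<open>I\<close>.\<close>
    define I where "I = {k\<in>{1..n}. lam \<gamma> k \<le> \<epsilon> \<and> 0 < lam \<gamma> k}"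
    have I: "finite I" "\<And>k. k \<in> I \<Longrightarrow> 1 \<le> k" "\<And>k. k \<in> I \<Longrightarrow> 0 < lam \<gamma> k" "\<And>k. k \<in> I \<Longrightarrow> lam \<gamma> k \<le> \<epsilon>"
      by (auto simp: I_def)
    have phiL: "phi \<gamma> k \<in> L2 \<mu>" if "k \<in> I" for k
      using S_L2[OF phi_S[OF \<gamma>]] I that by blast
    have "(\<Sum>k\<in>{1..n}. ?a f k) = (\<Sum>k\<in>{k\<in>{1..n}. lam \<gamma> k > \<epsilon>}. ?a f k) + (\<Sum>k\<in>{k\<in>{1..n}. \<not> lam \<gamma> k > \<epsilon>}. ?a f k)"
      by (subst sum.union_disjoint[symmetric]) (auto intro!: sum.cong)
    also have "(\<Sum>k\<in>{k\<in>{1..n}. lam \<gamma> k > \<epsilon>}. ?a f k) \<le> ?Q"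
      using finite_large_eigenvalues[OF \<gamma> \<epsilon>] a0 by (intro sum_mono2) auto
    also have "(\<Sum>k\<in>{k\<in>{1..n}. \<not> lam \<gamma> k > \<epsilon>}. ?a f k) = (\<Sum>k\<in>I. ?a f k)"
      using lam_nonneg[OF \<gamma>] by (intro sum.mono_neutral_right) (auto simp: I_def not_less order_antisym)
    also have "\<dots> \<le> (\<Sum>k\<in>I. 2 * ?a f1 k + 2 * ?a f2 k)"
    proof (rule sum_mono)
      fix k assume k: "k \<in> I"
      let ?z1 = "cmod (L2inner \<mu> f1 (phi \<gamma> k))" and ?z2 = "cmod (L2inner \<mu> f2 (phi \<gamma> k))"
      have "L2inner \<mu> f (phi \<gamma> k) = L2inner \<mu> f1 (phi \<gamma> k) + L2inner \<mu> f2 (phi \<gamma> k)"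
        unfolding f by (rule L2inner_add_left[OF S_L2[OF f1] S_L2[OF f2] phiL[OF k]])
      then have "(coef \<gamma> f k)\<^sup>2 \<le> (?z1 + ?z2)\<^sup>2"
        by (auto intro!: power_mono norm_triangle_ineq)
      also have "\<dots> \<le> 2 * ?z1\<^sup>2 + 2 * ?z2\<^sup>2"
        using sum_squares_bound[of ?z1 ?z2] by (simp add: power2_sum)
      finally have "?a f k \<le> lam \<gamma> k * (2 * ?z1\<^sup>2 + 2 * ?z2\<^sup>2)"
        using I(3)[OF k] by (intro mult_left_mono) auto
      then show "?a f k \<le> 2 * ?a f1 k + 2 * ?a f2 k"
        by (simp add: algebra_simps)
    qed
    also have "\<dots> = 2 * (\<Sum>k\<in>I. ?a f1 k) + 2 * (\<Sum>k\<in>I. ?a f2 k)"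
      by (simp add: sum.distrib sum_distrib_left)
    also have "(\<Sum>k\<in>I. ?a f2 k) \<le> q \<gamma> f2"
      by (rule spectral_partial_sum_le[OF \<gamma> f2 I(1,2)])
    also have "(\<Sum>k\<in>I. ?a f1 k) \<le> (\<Sum>k\<in>I. \<epsilon> * (coef \<gamma> f1 k)\<^sup>2)"
      using I(4) by (intro sum_mono mult_right_mono) auto
    also have "\<dots> = \<epsilon> * (\<Sum>k\<in>I. (coef \<gamma> f1 k)\<^sup>2)"
      by (rule sum_distrib_left[symmetric])
    also have "(\<Sum>k\<in>I. (coef \<gamma> f1 k)\<^sup>2) \<le> (L2norm \<mu> f1)\<^sup>2"
      by (rule L2_Bessel[where phi = "phi \<gamma>", OF I(1) phiL])
        (use phi_orthonormal[OF \<gamma>] I S_L2[OF f1] in auto)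
    finally show ?thesis
      using \<epsilon> by (simp add: algebra_simps)
  qed
  then show ?thesis
    by (intro LIMSEQ_le_const2[OF spectral_sum[OF \<gamma> fS]]) auto
qed

text \<open>The squared norm of g equals the inner product of f with g. The function g is a
  representative in S, as \<open>P f\<close> is tied to S only almost everywhere.\<close>

lemma projection_contraction:
  assumes f: "f \<in> L2 \<mu>" and g: "g \<in> S" "AE x in \<mu>. P f x = g x"
  shows "L2norm \<mu> g \<le> L2norm \<mu> f"
proof -
  have "complex_of_real ((L2norm \<mu> g)\<^sup>2) = L2inner \<mu> g g"
    by (rule L2inner_self[symmetric])
  also have "\<dots> = L2inner \<mu> (P f) g"
    using L2inner_cong_AE[OF P_measurable[OF f] S_measurable[OF g(1)] S_measurable[OF g(1)] g(2)] by simp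
  also have "\<dots> = L2inner \<mu> f g"
    by (rule P_inner[OF f g(1)])
  finally have "cmod (complex_of_real ((L2norm \<mu> g)\<^sup>2)) \<le> L2norm \<mu> f * L2norm \<mu> g"
    using L2_Cauchy_Schwarz[OF f S_L2[OF g(1)]] by simp
  then have "L2norm \<mu> g * L2norm \<mu> g \<le> L2norm \<mu> f * L2norm \<mu> g"
    by (simp add: power2_eq_square norm_mult L2norm_nonneg)
  then show ?thesis
    using L2norm_nonneg[of \<mu> g] L2norm_nonneg[of \<mu> f] by (cases "L2norm \<mu> g = 0") auto
qed

text \<open>The far summand is defined as f minus the near one, so the decomposition holds at every
  point and the summand lies in S; linearity of P identifies it with the projected far part almost
  everywhere.\<close>

lemma near_far_decomposition:
  assumes "U \<in> sets \<mu>" and f: "f \<in> S"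
  obtains f1 f2 where "f1 \<in> S" "f2 \<in> S" "f = (\<lambda>x. f1 x + f2 x)"
    "L2norm \<mu> f1 \<le> L2norm \<mu> (\<lambda>y. indicator {y. - \<gamma> + y \<in> U} y * f y)"
    "AE x in \<mu>. f2 x = P (\<lambda>y. indicator {y. - \<gamma> + y \<notin> U} y * f y) x"
proof -
  note [measurable] = S_measurable[OF f]
  have s [measurable]: "{y. - \<gamma> + y \<in> U} \<in> sets \<mu>"
    using measurable_sets[OF measurable_translations(1)[of "- \<gamma>"] assms(1)] by (simp add: vimage_def)
  have s' [measurable]: "{y. - \<gamma> + y \<notin> U} \<in> sets \<mu>"
    using sets.compl_sets[OF s] by (simp add: Collect_neg_eq Compl_eq_Diff_UNIV)
  let ?n = "\<lambda>y. indicator {y. - \<gamma> + y \<in> U} y * f y" and ?f = "\<lambda>y. indicator {y. - \<gamma> + y \<notin> U} y * f y"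
  have n: "?n \<in> L2 \<mu>"
  proof (rule L2I_bounded[OF _ S_L2[OF f], of _ 1])
    show "?n \<in> borel_measurable \<mu>" by measurable
  qed (auto simp: indicator_def)
  have ff: "?f \<in> L2 \<mu>"
  proof (rule L2I_bounded[OF _ S_L2[OF f], of _ 1])
    show "?f \<in> borel_measurable \<mu>" by measurable
  qed (auto simp: indicator_def)
  obtain f1 where f1: "f1 \<in> S" "AE x in \<mu>. P ?n x = f1 x"
    using P_into_S[OF n] by blast
  have eq: "(\<lambda>y. 1 * ?n y + 1 * ?f y) = f"
    by (auto simp: indicator_def)
  have "AE x in \<mu>. P f x = P ?n x + P ?f x"
    using P_linear[OF n ff, of 1 1] unfolding eq by simp
  with f1(2) P_on_S[OF f] have "AE x in \<mu>. f x - f1 x = P ?f x"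
  proof eventually_elim
    case (elim x)
    then have "f x = f1 x + P ?f x" by simp
    then show ?case by simp
  qed
  then show thesis
    by (intro that[of f1 "\<lambda>x. f x - f1 x"] f1(1) S_diff[OF f f1(1)] projection_contraction[OF n f1]) auto
qed

text \<open>Under the integral each y is counted once for every set \<gamma>U containing it, hence
  at most N times.\<close>

lemma near_norms_sum:
  assumes U: "compact U" and N: "\<And>y. finite {\<gamma>\<in>\<Gamma>. - \<gamma> + y \<in> U}" "\<And>y. card {\<gamma>\<in>\<Gamma>. - \<gamma> + y \<in> U} \<le> N"
    and F: "finite F" "F \<subseteq> \<Gamma>" and f: "f \<in> L2 \<mu>"
  shows "(\<Sum>\<gamma>\<in>F. (L2norm \<mu> (\<lambda>y. indicator {y. - \<gamma> + y \<in> U} y * f y))\<^sup>2) \<le> real N * (L2norm \<mu> f)\<^sup>2"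
proof -
  note [measurable] = L2_measurable[OF f]
  have s [measurable]: "{y. - \<gamma> + y \<in> U} \<in> sets \<mu>" for \<gamma>
    using measurable_sets[OF measurable_translations(1)[of "- \<gamma>"] compact_sets_mu[OF U]] by (simp add: vimage_def)
  have sq: "(cmod (indicator {y. - \<gamma> + y \<in> U} y * f y))\<^sup>2 = indicator {y. - \<gamma> + y \<in> U} y * (cmod (f y))\<^sup>2" for \<gamma> y
    by (simp add: indicator_def)
  have n: "(\<lambda>y. indicator {y. - \<gamma> + y \<in> U} y * f y) \<in> L2 \<mu>" for \<gamma>
  proof (rule L2I_bounded[OF _ f, of _ 1])
    show "(\<lambda>y. indicator {y. - \<gamma> + y \<in> U} y * f y) \<in> borel_measurable \<mu>" by measurable
  qed (auto simp: indicator_def)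
  have int: "integrable \<mu> (\<lambda>y. indicator {y. - \<gamma> + y \<in> U} y * (cmod (f y))\<^sup>2)" for \<gamma>
    using L2_integrable[OF n[of \<gamma>]] unfolding sq .
  have "(\<Sum>\<gamma>\<in>F. (L2norm \<mu> (\<lambda>y. indicator {y. - \<gamma> + y \<in> U} y * f y))\<^sup>2)
    = (\<integral>y. (\<Sum>\<gamma>\<in>F. indicator {y. - \<gamma> + y \<in> U} y * (cmod (f y))\<^sup>2) \<partial>\<mu>)"
    unfolding L2norm_square sq by (rule Bochner_Integration.integral_sum[symmetric]) (rule int)
  also have "\<dots> \<le> (\<integral>y. real N * (cmod (f y))\<^sup>2 \<partial>\<mu>)"
  proof (rule integral_mono)
    show "integrable \<mu> (\<lambda>y. \<Sum>\<gamma>\<in>F. indicator {y. - \<gamma> + y \<in> U} y * (cmod (f y))\<^sup>2)"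
      by (intro Bochner_Integration.integrable_sum int)
    show "integrable \<mu> (\<lambda>y. real N * (cmod (f y))\<^sup>2)"
      using L2_integrable[OF f] by simp
    fix y
    have "(\<Sum>\<gamma>\<in>F. indicator {y. - \<gamma> + y \<in> U} y :: real) = real (card {\<gamma>\<in>F. - \<gamma> + y \<in> U})"
      using F(1) by (simp add: indicator_def sum.If_cases Int_def)
    also have "\<dots> \<le> real N"
    proof -
      have "card {\<gamma>\<in>F. - \<gamma> + y \<in> U} \<le> card {\<gamma>\<in>\<Gamma>. - \<gamma> + y \<in> U}"
        using F(2) by (intro card_mono N(1)) auto
      with N(2)[of y] show ?thesis by linarith
    qed
    finally show "(\<Sum>\<gamma>\<in>F. indicator {y. - \<gamma> + y \<in> U} y * (cmod (f y))\<^sup>2) \<le> real N * (cmod (f y))\<^sup>2"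
      unfolding sum_distrib_right[symmetric] by (intro mult_right_mono) auto
  qed
  also have "\<dots> = real N * (L2norm \<mu> f)\<^sup>2"
    by (simp add: L2norm_square)
  finally show ?thesis .
qed

text \<open>Of the constant 3A/4 for the full forms the near parts consume 2 \<epsilon> N, at most
  A/4, and the far parts 2 A/8 = A/4, so that A/4 remains. Above the threshold \<epsilon> \<lambda>
  is at most \<lambda>^2, which trades the form for the squared norm of the truncated multiplier at
  the price of a factor \<epsilon>.\<close>

lemma truncated_forms_bounded_below:
  obtains \<epsilon> c where "0 < \<epsilon>" "0 < c"
    "\<And>f. f \<in> S \<Longrightarrow> \<exists>F. finite F \<and> F \<subseteq> \<Gamma> \<and> c * (L2norm \<mu> f)\<^sup>2 \<le>
      (\<Sum>\<gamma>\<in>F. \<Sum>k\<in>{k. 1 \<le> k \<and> lam \<gamma> k > \<epsilon>}. (lam \<gamma> k)\<^sup>2 * (coef \<gamma> f k)\<^sup>2)"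
proof -
  obtain A where A: "0 < A" "\<And>f. f \<in> L2 \<mu> \<Longrightarrow> \<exists>F. finite F \<and> F \<subseteq> \<Gamma> \<and> 3 / 4 * A * (L2norm \<mu> f)\<^sup>2 \<le> (\<Sum>\<gamma>\<in>F. q \<gamma> f)"
    using q_sum_lower by metis
  have A8: "0 < A / 8" using A(1) by simp
  show thesis
  proof (rule far_projection_small[OF A8])
    fix U assume U: "compact U"
      "\<And>F f. finite F \<Longrightarrow> F \<subseteq> \<Gamma> \<Longrightarrow> f \<in> L2 \<mu> \<Longrightarrow>
      (\<Sum>\<gamma>\<in>F. \<integral>\<^sup>+x. ennreal (\<eta> \<gamma> x) * ennreal ((cmod (P (\<lambda>y. indicator {y. - \<gamma> + y \<notin> U} y * f y) x))\<^sup>2) \<partial>\<mu>)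
        \<le> ennreal (A / 8 * (L2norm \<mu> f)\<^sup>2)"
    obtain n :: nat where n: "\<And>x. finite (\<Gamma> \<inter> (\<lambda>v. x + v) ` V) \<and> card (\<Gamma> \<inter> (\<lambda>v. x + v) ` V) \<le> n"
      using separated by metis
    obtain N where N: "\<And>y. finite {\<gamma>\<in>\<Gamma>. - \<gamma> + y \<in> U}" "\<And>y. card {\<gamma>\<in>\<Gamma>. - \<gamma> + y \<in> U} \<le> N"
      using separated_count[OF n U(1)] by metis
    \<comment> \<open>The far estimate has fixed \<open>U\<close> and with it the overlap N; the
      threshold is adapted to them. The added 1 covers N = 0.\<close>
    define \<epsilon> where "\<epsilon> = A / (8 * (real N + 1))"
    have \<epsilon>: "0 < \<epsilon>" "\<epsilon> * real N \<le> A / 8"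
      using A(1) by (auto simp: \<epsilon>_def field_simps)
    show thesis
    proof (rule that[OF \<epsilon>(1), of "\<epsilon> * A / 4"])
      show "0 < \<epsilon> * A / 4" using \<epsilon>(1) A(1) by simp
      fix f assume f: "f \<in> S"
      have fL: "f \<in> L2 \<mu>" by (rule S_L2[OF f])
      obtain F where F: "finite F" "F \<subseteq> \<Gamma>" "3 / 4 * A * (L2norm \<mu> f)\<^sup>2 \<le> (\<Sum>\<gamma>\<in>F. q \<gamma> f)"
        using A(2)[OF fL] by blast
      \<comment> \<open>Bundles the decomposition into one predicate so that both summands can be
        chosen as functions of \<gamma>.\<close>
      define R where "R \<gamma> f1 f2 \<longleftrightarrow> f1 \<in> S \<and> f2 \<in> S \<and> f = (\<lambda>x. f1 x + f2 x) \<and>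
        L2norm \<mu> f1 \<le> L2norm \<mu> (\<lambda>y. indicator {y. - \<gamma> + y \<in> U} y * f y) \<and>
        (AE x in \<mu>. f2 x = P (\<lambda>y. indicator {y. - \<gamma> + y \<notin> U} y * f y) x)" for \<gamma> f1 f2
      have "\<exists>f1 f2. R \<gamma> f1 f2" for \<gamma>
      proof (rule near_far_decomposition[OF compact_sets_mu[OF U(1)] f, of \<gamma>])
        fix f1 f2
        assume "f1 \<in> S" "f2 \<in> S" "f = (\<lambda>x. f1 x + f2 x)"
          "L2norm \<mu> f1 \<le> L2norm \<mu> (\<lambda>y. indicator {y. - \<gamma> + y \<in> U} y * f y)"
          "AE x in \<mu>. f2 x = P (\<lambda>y. indicator {y. - \<gamma> + y \<notin> U} y * f y) x"
        then have "R \<gamma> f1 f2"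
          unfolding R_def by (intro conjI)
        then show ?thesis
          by (intro exI)
      qed
      then obtain f1 f2 where fR: "\<And>\<gamma>. R \<gamma> (f1 \<gamma>) (f2 \<gamma>)"
        by metis
      note fR' = fR[unfolded R_def]
      note d = fR'[THEN conjunct1] fR'[THEN conjunct2, THEN conjunct1]
        fR'[THEN conjunct2, THEN conjunct2, THEN conjunct1]
        fR'[THEN conjunct2, THEN conjunct2, THEN conjunct2, THEN conjunct1]
        fR'[THEN conjunct2, THEN conjunct2, THEN conjunct2, THEN conjunct2]
      let ?Q = "\<lambda>\<gamma>. \<Sum>k\<in>{k. 1 \<le> k \<and> lam \<gamma> k > \<epsilon>}. lam \<gamma> k * (coef \<gamma> f k)\<^sup>2"
      have far: "(\<Sum>\<gamma>\<in>F. q \<gamma> (f2 \<gamma>)) \<le> A / 8 * (L2norm \<mu> f)\<^sup>2"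
      proof -
        have "ennreal (\<Sum>\<gamma>\<in>F. q \<gamma> (f2 \<gamma>)) = (\<Sum>\<gamma>\<in>F. ennreal (q \<gamma> (f2 \<gamma>)))"
          using q_nonneg F(2) by (intro sum_ennreal[symmetric]) auto
        also have "\<dots> = (\<Sum>\<gamma>\<in>F. \<integral>\<^sup>+x. ennreal (\<eta> \<gamma> x) * ennreal ((cmod (P (\<lambda>y. indicator {y. - \<gamma> + y \<notin> U} y * f y) x))\<^sup>2) \<partial>\<mu>)"
        proof (rule sum.cong[OF refl])
          fix \<gamma> assume "\<gamma> \<in> F"
          then have "ennreal (q \<gamma> (f2 \<gamma>)) = (\<integral>\<^sup>+x. ennreal (\<eta> \<gamma> x) * ennreal ((cmod (f2 \<gamma> x))\<^sup>2) \<partial>\<mu>)"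
            using F(2) by (intro nn_integral_q[symmetric] S_L2[OF d(2)]) auto
          also have "\<dots> = (\<integral>\<^sup>+x. ennreal (\<eta> \<gamma> x) * ennreal ((cmod (P (\<lambda>y. indicator {y. - \<gamma> + y \<notin> U} y * f y) x))\<^sup>2) \<partial>\<mu>)"
          proof (rule nn_integral_cong_AE)
            from d(5)[of \<gamma>] show "AE x in \<mu>. ennreal (\<eta> \<gamma> x) * ennreal ((cmod (f2 \<gamma> x))\<^sup>2)
              = ennreal (\<eta> \<gamma> x) * ennreal ((cmod (P (\<lambda>y. indicator {y. - \<gamma> + y \<notin> U} y * f y) x))\<^sup>2)"
              by eventually_elim simp
          qed
          finally show "ennreal (q \<gamma> (f2 \<gamma>)) = (\<integral>\<^sup>+x. ennreal (\<eta> \<gamma> x) * ennreal ((cmod (P (\<lambda>y. indicator {y. - \<gamma> + y \<notin> U} y * f y) x))\<^sup>2) \<partial>\<mu>)" .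
        qed
        also have "\<dots> \<le> ennreal (A / 8 * (L2norm \<mu> f)\<^sup>2)"
          by (rule U(2)[OF F(1,2) fL])
        finally show ?thesis
          using A(1) by (subst (asm) ennreal_le_iff) auto
      qed
      have near: "(\<Sum>\<gamma>\<in>F. (L2norm \<mu> (f1 \<gamma>))\<^sup>2) \<le> real N * (L2norm \<mu> f)\<^sup>2"
      proof -
        have "(\<Sum>\<gamma>\<in>F. (L2norm \<mu> (f1 \<gamma>))\<^sup>2) \<le> (\<Sum>\<gamma>\<in>F. (L2norm \<mu> (\<lambda>y. indicator {y. - \<gamma> + y \<in> U} y * f y))\<^sup>2)"
          by (intro sum_mono power_mono d(4) L2norm_nonneg)
        also have "\<dots> \<le> real N * (L2norm \<mu> f)\<^sup>2"
          by (rule near_norms_sum[OF U(1) N F(1,2) fL])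
        finally show ?thesis .
      qed
      have "(\<Sum>\<gamma>\<in>F. q \<gamma> f) \<le> (\<Sum>\<gamma>\<in>F. ?Q \<gamma> + 2 * \<epsilon> * (L2norm \<mu> (f1 \<gamma>))\<^sup>2 + 2 * q \<gamma> (f2 \<gamma>))"
      proof (rule sum_mono)
        fix \<gamma> assume "\<gamma> \<in> F"
        then have "\<gamma> \<in> \<Gamma>" using F(2) by blast
        then show "q \<gamma> f \<le> ?Q \<gamma> + 2 * \<epsilon> * (L2norm \<mu> (f1 \<gamma>))\<^sup>2 + 2 * q \<gamma> (f2 \<gamma>)"
          by (rule truncated_form_tail[OF _ \<epsilon>(1) d(1,2,3)])
      qed
      also have "\<dots> = (\<Sum>\<gamma>\<in>F. ?Q \<gamma>) + 2 * \<epsilon> * (\<Sum>\<gamma>\<in>F. (L2norm \<mu> (f1 \<gamma>))\<^sup>2) + 2 * (\<Sum>\<gamma>\<in>F. q \<gamma> (f2 \<gamma>))"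
        by (simp only: sum.distrib sum_distrib_left)
      also have "\<dots> \<le> (\<Sum>\<gamma>\<in>F. ?Q \<gamma>) + 2 * \<epsilon> * (real N * (L2norm \<mu> f)\<^sup>2) + 2 * (A / 8 * (L2norm \<mu> f)\<^sup>2)"
        using \<epsilon>(1) by (intro add_mono mult_left_mono near far) auto
      also have "2 * \<epsilon> * (real N * (L2norm \<mu> f)\<^sup>2) \<le> 2 * (A / 8 * (L2norm \<mu> f)\<^sup>2)"
        using mult_right_mono[OF \<epsilon>(2), of "(L2norm \<mu> f)\<^sup>2"] by simp
      finally have Q: "A / 4 * (L2norm \<mu> f)\<^sup>2 \<le> (\<Sum>\<gamma>\<in>F. ?Q \<gamma>)"
        using F(3) by (simp add: algebra_simps)
      have "\<epsilon> * A / 4 * (L2norm \<mu> f)\<^sup>2 \<le> \<epsilon> * (\<Sum>\<gamma>\<in>F. ?Q \<gamma>)"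
        using mult_left_mono[OF Q, of \<epsilon>] \<epsilon>(1) by simp
      also have "\<dots> = (\<Sum>\<gamma>\<in>F. \<Sum>k\<in>{k. 1 \<le> k \<and> lam \<gamma> k > \<epsilon>}. \<epsilon> * (lam \<gamma> k * (coef \<gamma> f k)\<^sup>2))"
        by (simp only: sum_distrib_left)
      also have "\<dots> \<le> (\<Sum>\<gamma>\<in>F. \<Sum>k\<in>{k. 1 \<le> k \<and> lam \<gamma> k > \<epsilon>}. (lam \<gamma> k)\<^sup>2 * (coef \<gamma> f k)\<^sup>2)"
        unfolding power2_eq_square[of "lam _ _"] mult.assoc[symmetric]
        using \<epsilon>(1) by (intro sum_mono mult_right_mono) auto
      finally show "\<exists>F. finite F \<and> F \<subseteq> \<Gamma> \<and> \<epsilon> * A / 4 * (L2norm \<mu> f)\<^sup>2 \<le>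
        (\<Sum>\<gamma>\<in>F. \<Sum>k\<in>{k. 1 \<le> k \<and> lam \<gamma> k > \<epsilon>}. (lam \<gamma> k)\<^sup>2 * (coef \<gamma> f k)\<^sup>2)"
        using F by blast
    qed
  qed
qed

text \<open>One factor of each squared eigenvalue is bounded by B, the other builds the form, whose
  sum over \<gamma> costs a second B. The index sets are left general to serve both the eigenvalues
  above a threshold and an initial segment of indices.\<close>

lemma spectral_square_sums_upper:
  obtains C where "0 < C" "\<And>F I f. finite F \<Longrightarrow> F \<subseteq> \<Gamma> \<Longrightarrow> (\<And>\<gamma>. \<gamma> \<in> F \<Longrightarrow> finite (I \<gamma>)) \<Longrightarrow> (\<And>\<gamma> k. \<gamma> \<in> F \<Longrightarrow> k \<in> I \<gamma> \<Longrightarrow> 1 \<le> k) \<Longrightarrow>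
    f \<in> S \<Longrightarrow> (\<Sum>\<gamma>\<in>F. \<Sum>k\<in>I \<gamma>. (lam \<gamma> k)\<^sup>2 * (coef \<gamma> f k)\<^sup>2) \<le> C * (L2norm \<mu> f)\<^sup>2"
proof -
  obtain B where B: "0 < B" "\<And>\<gamma> k. \<gamma> \<in> \<Gamma> \<Longrightarrow> 1 \<le> k \<Longrightarrow> lam \<gamma> k \<le> B"
    "\<And>F f. finite F \<Longrightarrow> F \<subseteq> \<Gamma> \<Longrightarrow> f \<in> L2 \<mu> \<Longrightarrow> (\<Sum>\<gamma>\<in>F. q \<gamma> f) \<le> B * (L2norm \<mu> f)\<^sup>2"
    using lam_bounded by metis
  show thesis
  proof (rule that[of "B * B"])
    show "0 < B * B" using B(1) by simp
    fix F and I :: "'g \<Rightarrow> nat set" and f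
    assume F: "finite F" "F \<subseteq> \<Gamma>" and I: "\<And>\<gamma>. \<gamma> \<in> F \<Longrightarrow> finite (I \<gamma>)" "\<And>\<gamma> k. \<gamma> \<in> F \<Longrightarrow> k \<in> I \<gamma> \<Longrightarrow> 1 \<le> k" and f: "f \<in> S"
    have "(\<Sum>\<gamma>\<in>F. \<Sum>k\<in>I \<gamma>. (lam \<gamma> k)\<^sup>2 * (coef \<gamma> f k)\<^sup>2) \<le> (\<Sum>\<gamma>\<in>F. B * q \<gamma> f)"
    proof (rule sum_mono)
      fix \<gamma> assume \<gamma>F: "\<gamma> \<in> F"
      then have \<gamma>: "\<gamma> \<in> \<Gamma>" using F(2) by blast
      have "(\<Sum>k\<in>I \<gamma>. (lam \<gamma> k)\<^sup>2 * (coef \<gamma> f k)\<^sup>2) \<le> (\<Sum>k\<in>I \<gamma>. B * (lam \<gamma> k * (coef \<gamma> f k)\<^sup>2))"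
        unfolding power2_eq_square[of "lam _ _"] mult.assoc[symmetric]
        using B(2)[OF \<gamma> I(2)[OF \<gamma>F]] lam_nonneg[OF \<gamma> I(2)[OF \<gamma>F]] by (intro sum_mono mult_right_mono) auto
      also have "\<dots> = B * (\<Sum>k\<in>I \<gamma>. lam \<gamma> k * (coef \<gamma> f k)\<^sup>2)"
        by (rule sum_distrib_left[symmetric])
      also have "\<dots> \<le> B * q \<gamma> f"
        using B(1) spectral_partial_sum_le[OF \<gamma> f I(1)[OF \<gamma>F] I(2)[OF \<gamma>F]] by (intro mult_left_mono) auto
      finally show "(\<Sum>k\<in>I \<gamma>. (lam \<gamma> k)\<^sup>2 * (coef \<gamma> f k)\<^sup>2) \<le> B * q \<gamma> f" .
    qed
    also have "\<dots> = B * (\<Sum>\<gamma>\<in>F. q \<gamma> f)"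
      by (rule sum_distrib_left[symmetric])
    also have "\<dots> \<le> B * (B * (L2norm \<mu> f)\<^sup>2)"
      using B(1) B(3)[OF F S_L2[OF f]] by (intro mult_left_mono) auto
    finally show "(\<Sum>\<gamma>\<in>F. \<Sum>k\<in>I \<gamma>. (lam \<gamma> k)\<^sup>2 * (coef \<gamma> f k)\<^sup>2) \<le> B * B * (L2norm \<mu> f)\<^sup>2"
      by (simp add: mult.assoc)
  qed
qed

end

section \<open>Norm equivalence and frames\<close>

context phase_space_spectral
begin

text \<open>The lower bound is needed at \<open>\<epsilon>\<^sub>0\<close> only, as the index sets
  grow when \<epsilon> decreases, and the upper bound is indifferent to the index sets. The same
  constants therefore serve all smaller thresholds.\<close>

lemma truncated_multipliers_norm_equivalence:
  "\<exists>c C. 0 < c \<and> c \<le> C \<and>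
     (\<forall>\<^sub>F \<epsilon> in at_right 0. \<forall>f\<in>S.
        (\<lambda>\<gamma>. (L2norm \<mu> (trunc_multiplier \<mu> (lam \<gamma>) (phi \<gamma>) \<epsilon> f))\<^sup>2) summable_on \<Gamma> \<and>
        c * (L2norm \<mu> f)\<^sup>2 \<le> (\<Sum>\<^sub>\<infinity>\<gamma>\<in>\<Gamma>. (L2norm \<mu> (trunc_multiplier \<mu> (lam \<gamma>) (phi \<gamma>) \<epsilon> f))\<^sup>2) \<and>
        (\<Sum>\<^sub>\<infinity>\<gamma>\<in>\<Gamma>. (L2norm \<mu> (trunc_multiplier \<mu> (lam \<gamma>) (phi \<gamma>) \<epsilon> f))\<^sup>2) \<le> C * (L2norm \<mu> f)\<^sup>2)"
proof (rule truncated_forms_bounded_below, rule spectral_square_sums_upper)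
  fix \<epsilon>\<^sub>0 c C :: real
  let ?a = "\<lambda>f \<gamma> k. (lam \<gamma> k)\<^sup>2 * (coef \<gamma> f k)\<^sup>2"
  let ?I = "\<lambda>\<epsilon> \<gamma>. {k. 1 \<le> k \<and> lam \<gamma> k > \<epsilon>}"
  assume pos: "0 < \<epsilon>\<^sub>0" "0 < c" "0 < C"
    and lower: "\<And>f. f \<in> S \<Longrightarrow> \<exists>F. finite F \<and> F \<subseteq> \<Gamma> \<and> c * (L2norm \<mu> f)\<^sup>2 \<le> (\<Sum>\<gamma>\<in>F. \<Sum>k\<in>?I \<epsilon>\<^sub>0 \<gamma>. ?a f \<gamma> k)"
    and upper: "\<And>F I f. finite F \<Longrightarrow> F \<subseteq> \<Gamma> \<Longrightarrow> (\<And>\<gamma>. \<gamma> \<in> F \<Longrightarrow> finite (I \<gamma>)) \<Longrightarrow> (\<And>\<gamma> k. \<gamma> \<in> F \<Longrightarrow> k \<in> I \<gamma> \<Longrightarrow> 1 \<le> k) \<Longrightarrow>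
      f \<in> S \<Longrightarrow> (\<Sum>\<gamma>\<in>F. \<Sum>k\<in>I \<gamma>. ?a f \<gamma> k) \<le> C * (L2norm \<mu> f)\<^sup>2"
  let ?T = "\<lambda>\<epsilon> f \<gamma>. (L2norm \<mu> (trunc_multiplier \<mu> (lam \<gamma>) (phi \<gamma>) \<epsilon> f))\<^sup>2"
  have main: "?T \<epsilon> f summable_on \<Gamma> \<and> c * (L2norm \<mu> f)\<^sup>2 \<le> infsum (?T \<epsilon> f) \<Gamma> \<and>
      infsum (?T \<epsilon> f) \<Gamma> \<le> max c C * (L2norm \<mu> f)\<^sup>2"
    if \<epsilon>: "0 < \<epsilon>" "\<epsilon> < \<epsilon>\<^sub>0" and f: "f \<in> S" for \<epsilon> f
  proof -
    have bound: "sum (?T \<epsilon> f) F \<le> max c C * (L2norm \<mu> f)\<^sup>2" if F: "finite F" "F \<subseteq> \<Gamma>" for F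
    proof -
      have "sum (?T \<epsilon> f) F = (\<Sum>\<gamma>\<in>F. \<Sum>k\<in>?I \<epsilon> \<gamma>. ?a f \<gamma> k)"
        using trunc_multiplier_norm[OF _ \<epsilon>(1)] F(2) by (intro sum.cong) auto
      also have "\<dots> \<le> C * (L2norm \<mu> f)\<^sup>2"
      proof (rule upper[OF F _ _ f])
        show "finite (?I \<epsilon> \<gamma>)" if "\<gamma> \<in> F" for \<gamma>
          using finite_large_eigenvalues[OF _ \<epsilon>(1)] F(2) that by blast
      qed auto
      also have "\<dots> \<le> max c C * (L2norm \<mu> f)\<^sup>2"
        by (intro mult_right_mono) auto
      finally show ?thesis .
    qed
    have summable: "?T \<epsilon> f summable_on \<Gamma>"
    proof (rule nonneg_bdd_above_summable_on)
      show "bdd_above (sum (?T \<epsilon> f) ` {F. F \<subseteq> \<Gamma> \<and> finite F})"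
        by (rule bdd_aboveI[of _ "max c C * (L2norm \<mu> f)\<^sup>2"]) (use bound in blast)
    qed simp
    moreover have "infsum (?T \<epsilon> f) \<Gamma> \<le> max c C * (L2norm \<mu> f)\<^sup>2"
      by (rule infsum_le_finite_sums[OF summable bound])
    moreover have "c * (L2norm \<mu> f)\<^sup>2 \<le> infsum (?T \<epsilon> f) \<Gamma>"
    proof -
      obtain F where F: "finite F" "F \<subseteq> \<Gamma>" "c * (L2norm \<mu> f)\<^sup>2 \<le> (\<Sum>\<gamma>\<in>F. \<Sum>k\<in>?I \<epsilon>\<^sub>0 \<gamma>. ?a f \<gamma> k)"
        using lower[OF f] by blast
      note F(3)
      also have "(\<Sum>\<gamma>\<in>F. \<Sum>k\<in>?I \<epsilon>\<^sub>0 \<gamma>. ?a f \<gamma> k) \<le> (\<Sum>\<gamma>\<in>F. \<Sum>k\<in>?I \<epsilon> \<gamma>. ?a f \<gamma> k)"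
      proof (intro sum_mono sum_mono2)
        show "finite (?I \<epsilon> \<gamma>)" if "\<gamma> \<in> F" for \<gamma>
          using finite_large_eigenvalues[OF _ \<epsilon>(1)] F(2) that by blast
      qed (use \<epsilon> in auto)
      also have "\<dots> = sum (?T \<epsilon> f) F"
        using trunc_multiplier_norm[OF _ \<epsilon>(1)] F(2) by (intro sum.cong) auto
      also have "\<dots> \<le> infsum (?T \<epsilon> f) \<Gamma>"
        by (rule finite_sum_le_infsum[OF summable F(1,2)]) simp
      finally show ?thesis .
    qed
    ultimately show ?thesis by blast
  qed
  \<comment> \<open>The maximum secures the required order of the constants even if S contains only
    the zero function, when the two estimates do not compare c with C.\<close>
  show ?thesis
  proof (rule exI[of _ c], rule exI[of _ "max c C"], intro conjI pos(2))
    show "\<forall>\<^sub>F \<epsilon> in at_right 0. \<forall>f\<in>S.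
        ?T \<epsilon> f summable_on \<Gamma> \<and> c * (L2norm \<mu> f)\<^sup>2 \<le> infsum (?T \<epsilon> f) \<Gamma> \<and>
        infsum (?T \<epsilon> f) \<Gamma> \<le> max c C * (L2norm \<mu> f)\<^sup>2"
      unfolding eventually_at_right_field
    proof (rule exI[of _ "\<epsilon>\<^sub>0"], intro conjI allI impI ballI pos(1))
      fix \<epsilon> f assume "0 < \<epsilon>" "\<epsilon> < \<epsilon>\<^sub>0" "f \<in> S"
      from main[OF this] show "?T \<epsilon> f summable_on \<Gamma>" "c * (L2norm \<mu> f)\<^sup>2 \<le> infsum (?T \<epsilon> f) \<Gamma>"
        "infsum (?T \<epsilon> f) \<Gamma> \<le> max c C * (L2norm \<mu> f)\<^sup>2"
        by blast+
    qed
  qed simp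
qed

text \<open>By the trace bound an eigenvalue above \<epsilon> has an index k with \<epsilon> k at
  most D times the integral of the symbol, so k is at most \<open>N \<gamma>\<close>. The family
  then contains every term of the truncated lower bound, and its further terms are
  non-negative.\<close>

lemma eigenfunction_frames:
  "\<exists>\<alpha>>0. \<forall>N :: 'g \<Rightarrow> nat.
      (\<forall>\<gamma>\<in>\<Gamma>. \<alpha> * (\<integral>x. \<eta> \<gamma> x \<partial>\<mu>) \<le> real (N \<gamma>)) \<longrightarrow>
      is_frame \<mu> S {(\<gamma>, k). \<gamma> \<in> \<Gamma> \<and> 1 \<le> k \<and> k \<le> N \<gamma>}
        (\<lambda>(\<gamma>, k) x. complex_of_real (lam \<gamma> k) * phi \<gamma> k x)"
proof (rule truncated_forms_bounded_below, rule spectral_square_sums_upper, rule trace_bound)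
  fix \<epsilon> c C D :: real
  let ?a = "\<lambda>f \<gamma> k. (lam \<gamma> k)\<^sup>2 * (coef \<gamma> f k)\<^sup>2"
  let ?I = "\<lambda>\<gamma>. {k. 1 \<le> k \<and> lam \<gamma> k > \<epsilon>}"
  assume pos: "0 < \<epsilon>" "0 < c" "0 < C" "0 \<le> D"
    and lower: "\<And>f. f \<in> S \<Longrightarrow> \<exists>F. finite F \<and> F \<subseteq> \<Gamma> \<and> c * (L2norm \<mu> f)\<^sup>2 \<le> (\<Sum>\<gamma>\<in>F. \<Sum>k\<in>?I \<gamma>. ?a f \<gamma> k)"
    and upper: "\<And>F I f. finite F \<Longrightarrow> F \<subseteq> \<Gamma> \<Longrightarrow> (\<And>\<gamma>. \<gamma> \<in> F \<Longrightarrow> finite (I \<gamma>)) \<Longrightarrow> (\<And>\<gamma> k. \<gamma> \<in> F \<Longrightarrow> k \<in> I \<gamma> \<Longrightarrow> 1 \<le> k) \<Longrightarrow>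
      f \<in> S \<Longrightarrow> (\<Sum>\<gamma>\<in>F. \<Sum>k\<in>I \<gamma>. ?a f \<gamma> k) \<le> C * (L2norm \<mu> f)\<^sup>2"
    and trace: "\<And>\<gamma> n. \<gamma> \<in> \<Gamma> \<Longrightarrow> 1 \<le> n \<Longrightarrow> real n * lam \<gamma> n \<le> D * (\<integral>x. \<eta> \<gamma> x \<partial>\<mu>)"
  \<comment> \<open>The index estimate asks for D / \<epsilon>; adding 1 keeps \<alpha> positive
    when D = 0.\<close>
  define \<alpha> where "\<alpha> = D / \<epsilon> + 1"
  have \<alpha>: "0 < \<alpha>" "D \<le> \<epsilon> * \<alpha>"
    using pos(1,4) by (auto simp: \<alpha>_def field_simps intro: add_nonneg_pos)
  show ?thesis
  proof (intro exI[of _ \<alpha>] conjI \<alpha>(1) allI impI)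
    fix N :: "'g \<Rightarrow> nat"
    assume N: "\<forall>\<gamma>\<in>\<Gamma>. \<alpha> * (\<integral>x. \<eta> \<gamma> x \<partial>\<mu>) \<le> real (N \<gamma>)"
    let ?J = "{(\<gamma>, k). \<gamma> \<in> \<Gamma> \<and> 1 \<le> k \<and> k \<le> N \<gamma>}"
    let ?e = "\<lambda>(\<gamma>, k) x. complex_of_real (lam \<gamma> k) * phi \<gamma> k x"
    have IN: "?I \<gamma> \<subseteq> {1..N \<gamma>}" if \<gamma>: "\<gamma> \<in> \<Gamma>" for \<gamma>
    proof
      fix k assume k: "k \<in> ?I \<gamma>"
      have eta: "0 \<le> (\<integral>x. \<eta> \<gamma> x \<partial>\<mu>)"
        using nonneg[OF \<gamma>] by (intro integral_nonneg_AE) auto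
      have "\<epsilon> * real k \<le> real k * lam \<gamma> k"
        using k by (subst mult.commute) (intro mult_left_mono, auto)
      also have "\<dots> \<le> D * (\<integral>x. \<eta> \<gamma> x \<partial>\<mu>)"
        using trace[OF \<gamma>, of k] k by simp
      also have "\<dots> \<le> \<epsilon> * \<alpha> * (\<integral>x. \<eta> \<gamma> x \<partial>\<mu>)"
        by (intro mult_right_mono \<alpha>(2) eta)
      also have "\<dots> \<le> \<epsilon> * real (N \<gamma>)"
        using N \<gamma> pos(1) by (simp add: mult.assoc)
      finally have "real k \<le> real (N \<gamma>)"
        using pos(1) by simp
      then show "k \<in> {1..N \<gamma>}"
        using k by simp
    qed
    have sq: "(cmod (L2inner \<mu> f (?e j)))\<^sup>2 = (case j of (\<gamma>, k) \<Rightarrow> ?a f \<gamma> k)" for f j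
      by (cases j) (simp add: L2inner_cmult_right norm_mult power_mult_distrib)
    let ?T = "\<lambda>f j. case j of (\<gamma>, k) \<Rightarrow> ?a f \<gamma> k"
    have frame: "?T f summable_on ?J \<and> c * (L2norm \<mu> f)\<^sup>2 \<le> infsum (?T f) ?J \<and>
        infsum (?T f) ?J \<le> max c C * (L2norm \<mu> f)\<^sup>2" if f: "f \<in> S" for f
    proof -
      have bound: "sum (?T f) X \<le> max c C * (L2norm \<mu> f)\<^sup>2" if X: "finite X" "X \<subseteq> ?J" for X
      proof -
        have X': "finite (fst ` X)" "fst ` X \<subseteq> \<Gamma>"
          using X by auto
        have "sum (?T f) X \<le> sum (?T f) (Sigma (fst ` X) (\<lambda>\<gamma>. {1..N \<gamma>}))"
        proof (rule sum_mono2)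
          show "X \<subseteq> Sigma (fst ` X) (\<lambda>\<gamma>. {1..N \<gamma>})"
            using X(2) by force
        qed (use X'(1) in auto)
        also have "\<dots> = (\<Sum>\<gamma>\<in>fst ` X. \<Sum>k\<in>{1..N \<gamma>}. ?a f \<gamma> k)"
          using X'(1) by (intro sum.Sigma[symmetric]) auto
        also have "\<dots> \<le> C * (L2norm \<mu> f)\<^sup>2"
          by (rule upper[OF X' _ _ f]) auto
        also have "\<dots> \<le> max c C * (L2norm \<mu> f)\<^sup>2"
          by (intro mult_right_mono) auto
        finally show ?thesis .
      qed
      have nn: "0 \<le> ?T f j" for j
        by (cases j) simp
      have summable: "?T f summable_on ?J"
      proof (rule nonneg_bdd_above_summable_on)
        show "bdd_above (sum (?T f) ` {F. F \<subseteq> ?J \<and> finite F})"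
          by (rule bdd_aboveI[of _ "max c C * (L2norm \<mu> f)\<^sup>2"]) (use bound in blast)
      qed (rule nn)
      moreover have "infsum (?T f) ?J \<le> max c C * (L2norm \<mu> f)\<^sup>2"
        by (rule infsum_le_finite_sums[OF summable bound])
      moreover have "c * (L2norm \<mu> f)\<^sup>2 \<le> infsum (?T f) ?J"
      proof -
        obtain F where F: "finite F" "F \<subseteq> \<Gamma>" "c * (L2norm \<mu> f)\<^sup>2 \<le> (\<Sum>\<gamma>\<in>F. \<Sum>k\<in>?I \<gamma>. ?a f \<gamma> k)"
          using lower[OF f] by blast
        note F(3)
        also have "(\<Sum>\<gamma>\<in>F. \<Sum>k\<in>?I \<gamma>. ?a f \<gamma> k) \<le> (\<Sum>\<gamma>\<in>F. \<Sum>k\<in>{1..N \<gamma>}. ?a f \<gamma> k)"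
          using IN F(2) by (intro sum_mono sum_mono2) auto
        also have "\<dots> = sum (?T f) (Sigma F (\<lambda>\<gamma>. {1..N \<gamma>}))"
          using F(1) by (intro sum.Sigma) auto
        also have "\<dots> \<le> infsum (?T f) ?J"
          by (rule finite_sum_le_infsum[OF summable]) (use F nn in auto)
        finally show ?thesis .
      qed
      ultimately show ?thesis by blast
    qed
    show "is_frame \<mu> S ?J ?e"
      unfolding is_frame_def sq
    proof (rule exI[of _ c], rule exI[of _ "max c C"], intro conjI pos(2) ballI)
      fix f assume "f \<in> S"
      from frame[OF this] show "?T f summable_on ?J" "c * (L2norm \<mu> f)\<^sup>2 \<le> infsum (?T f) ?J"
        "infsum (?T f) ?J \<le> max c C * (L2norm \<mu> f)\<^sup>2"
        by blast+
    qed simp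
  qed
qed

end

theorem theorem6p1:
  fixes \<mu> :: "'g::{topological_group_add,t2_space} measure"
    and \<Delta> w :: "'g \<Rightarrow> real" and V :: "'g set"
    and S :: "('g \<Rightarrow> complex) set" and P :: "('g \<Rightarrow> complex) \<Rightarrow> ('g \<Rightarrow> complex)"
    and \<Gamma> :: "'g set" and \<eta> :: "'g \<Rightarrow> 'g \<Rightarrow> real"
    and lam :: "'g \<Rightarrow> nat \<Rightarrow> real" and phi :: "'g \<Rightarrow> nat \<Rightarrow> 'g \<Rightarrow> complex"
  assumes setting: "phase_space_setting \<mu> \<Delta> w V S P"
    and spread: "well_spread \<mu> V w \<Gamma> \<eta>"
    and meas: "\<forall>\<gamma>\<in>\<Gamma>. \<eta> \<gamma> \<in> borel_measurable \<mu>"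
    and nonneg: "\<forall>\<gamma>\<in>\<Gamma>. \<forall>x. \<eta> \<gamma> x \<ge> 0"
    and approx1: "sum_approx_one \<mu> \<Gamma> \<eta>"
    and diag: "\<forall>\<gamma>\<in>\<Gamma>. diagonalizes \<mu> S P (\<eta> \<gamma>) (lam \<gamma>) (phi \<gamma>)"
  shows "(\<exists>c C. 0 < c \<and> c \<le> C \<and>
           (\<forall>\<^sub>F \<epsilon> in at_right 0. \<forall>f\<in>S.
              (\<lambda>\<gamma>. (L2norm \<mu> (trunc_multiplier \<mu> (lam \<gamma>) (phi \<gamma>) \<epsilon> f))\<^sup>2) summable_on \<Gamma> \<and>
              c * (L2norm \<mu> f)\<^sup>2 \<le> (\<Sum>\<^sub>\<infinity>\<gamma>\<in>\<Gamma>. (L2norm \<mu> (trunc_multiplier \<mu> (lam \<gamma>) (phi \<gamma>) \<epsilon> f))\<^sup>2) \<and>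
              (\<Sum>\<^sub>\<infinity>\<gamma>\<in>\<Gamma>. (L2norm \<mu> (trunc_multiplier \<mu> (lam \<gamma>) (phi \<gamma>) \<epsilon> f))\<^sup>2) \<le> C * (L2norm \<mu> f)\<^sup>2))
       \<and> (\<exists>\<alpha>>0. \<forall>N :: 'g \<Rightarrow> nat.
            (\<forall>\<gamma>\<in>\<Gamma>. \<alpha> * (\<integral>x. \<eta> \<gamma> x \<partial>\<mu>) \<le> real (N \<gamma>)) \<longrightarrow>
            (\<exists>B. \<forall>\<gamma>\<in>\<Gamma>. N \<gamma> \<le> B) \<longrightarrow>
            is_frame \<mu> S {(\<gamma>, k). \<gamma> \<in> \<Gamma> \<and> 1 \<le> k \<and> k \<le> N \<gamma>}
              (\<lambda>(\<gamma>, k) x. complex_of_real (lam \<gamma> k) * phi \<gamma> k x))"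
proof -
  interpret phase_space_spectral \<mu> \<Delta> w V S P \<Gamma> \<eta> lam phi
    using assms by unfold_locales auto
  obtain \<alpha> where "0 < \<alpha>" and frame: "\<forall>N :: 'g \<Rightarrow> nat.
      (\<forall>\<gamma>\<in>\<Gamma>. \<alpha> * (\<integral>x. \<eta> \<gamma> x \<partial>\<mu>) \<le> real (N \<gamma>)) \<longrightarrow>
      is_frame \<mu> S {(\<gamma>, k). \<gamma> \<in> \<Gamma> \<and> 1 \<le> k \<and> k \<le> N \<gamma>}
        (\<lambda>(\<gamma>, k) x. complex_of_real (lam \<gamma> k) * phi \<gamma> k x)"
    using eigenfunction_frames by (elim exE conjE)
  show ?thesis
    by (intro conjI truncated_multipliers_norm_equivalence exI[of _ \<alpha>] \<open>0 < \<alpha>\<close> allI impI frame[rule_format]) blast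
qed

end
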